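(* The operator space $T(\ell_2)$ of trace-class operators on the Hilbert space $\ell_2$ is a strong generator for the category $\mathbf{OS}$ of operator spaces and linear complete contractions.
   Context: Conventions: all vector spaces are over $\mathbb C$, all maps are linear, $\mathbb N=\{1,2,\dots\}$. For a vector space $V$, $\mathbb M_n(V)$ is the vector space of $n\times n$ matrices with entries in $V$; $M_n$ denotes $\mathbb M_n(\mathbb C)$ with the operator norm on $\mathbb C^n$. An (abstract) operator space is a vector space $X$ with norms $\|\cdot\|_n$ on $\mathbb M_n(X)$, $n\in\mathbb N$, such that: $(\mathbb M_1(X),\|\cdot\|_1)\cong X$ is a Banach space; $\|x\oplus y\|_{m+n}=\max\{\|x\|_m,\|y\|_n\}$ for $x\in \mathbb M_m(X)$, $y\in \mathbb M_n(X)$, where $x\oplus y$ is the block-diagonal matrix; and $\|\alpha x\beta\|_m\le\|\alpha\|\,\|x\|_m\,\|\beta\|$ for $x\in\mathbb M_m(X)$, $\alpha,\beta\in M_m$. Write $M_n(X)=(\mathbb M_n(X),\|\cdot\|_n)$. For linear $u:X\to Y$ let $u_n:\mathbb M_n(X)\to\mathbb M_n(Y)$ be entrywise application of $u$; $\|u\|_{\mathrm{cb}}=\sup_n\|u_n\|$; $u$ is completely bounded if $\|u\|_{\mathrm{cb}}<\infty$ and a complete contraction if $\|u\|_{\mathrm{cb}}\le1$; $\mathrm{CB}(X,Y)$ is the Banach space of completely bounded maps with norm $\|\cdot\|_{\mathrm{cb}}$. $\mathbf{OS}$ is the category of operator spaces and linear complete contractions. $M_n$ is an operator space via $\mathbb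 M_m(M_n)\cong M_{mn}$. The dual $X^*$ of an operator space is an operator space with norms determined by $\mathbb M_n(X^* )\cong \mathrm{CB}(X,M_n)$. For a Hilbert space $H$, $B(H)$ is an operator space via $\mathbb M_n(B(H))\cong B(H^{\oplus n})$ with the operator norm. $T(\ell_2)$, the Banach space of trace-class operators with the trace norm, carries its standard operator space structure as the predual of $B(\ell_2)$, i.e. the one inherited from the embedding $T(\ell_2)\subseteq B(\ell_2)^*$ as the space of normal functionals via the trace pairing. A set $\mathcal S$ of objects of a category $\mathbf C$ is generating if for any distinct parallel $f,g:A\to B$ there are $S\in\mathcal S$ and $s:S\to A$ with $f\circ s\ne g\circ s$. A generating set $\mathcal S$ is strong if for each monomorphism $m:A\to B$ that is not an isomorphism there are $S\in\mathcal S$ and $f:S\to B$ that does not factorise through $m$. An object $S$ is a (strong) generator if $\{S\}$ is a (strong) generating set. *)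

theory Defs
  imports
    "HOL-Analysis.Inner_Product"
    "HOL-Analysis.L2_Norm"
    "HOL-Library.FuncSet"
    "HOL-Library.Nonpos_Ints"
    "HOL-Library.Extended_Nonnegative_Real"
    "Jordan_Normal_Form.VS_Connect"
begin

section \<open>Categories, generators and strong generators\<close>

text \<open>The composition takes the objects \<open>A\<close>, \<open>B\<close>, \<open>C\<close> as arguments, as the same function may
  be a morphism between several pairs of objects; \<open>Comp \<C> A B C g f\<close> is
  \<open>g \<circ> f\<close> for \<open>f : A \<rightarrow> B\<close> and \<open>g : B \<rightarrow> C\<close>.\<close>

record ('o, 'm) category =
  Ob :: "'o set"
  Hom :: "'o \<Rightarrow> 'o \<Rightarrow> 'm set"
  Ident :: "'o \<Rightarrow> 'm"
  Comp :: "'o \<Rightarrow> 'o \<Rightarrow> 'o \<Rightarrow> 'm \<Rightarrow> 'm \<Rightarrow> 'm"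

definition monomorphism :: "('o, 'm) category \<Rightarrow> 'o \<Rightarrow> 'o \<Rightarrow> 'm \<Rightarrow> bool" where
  "monomorphism \<C> A B m \<longleftrightarrow> m \<in> Hom \<C> A B \<and>
     (\<forall>X\<in>Ob \<C>. \<forall>g\<in>Hom \<C> X A. \<forall>h\<in>Hom \<C> X A.
        Comp \<C> X A B m g = Comp \<C> X A B m h \<longrightarrow> g = h)"

definition isomorphism :: "('o, 'm) category \<Rightarrow> 'o \<Rightarrow> 'o \<Rightarrow> 'm \<Rightarrow> bool" where
  "isomorphism \<C> A B m \<longleftrightarrow> m \<in> Hom \<C> A B \<and>
     (\<exists>k\<in>Hom \<C> B A. Comp \<C> A B A k m = Ident \<C> A \<and> Comp \<C> B A B m k = Ident \<C> B)"

definition generating_set :: "('o, 'm) category \<Rightarrow> 'o set \<Rightarrow> bool" where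
  "generating_set \<C> \<S> \<longleftrightarrow> \<S> \<subseteq> Ob \<C> \<and>
     (\<forall>A\<in>Ob \<C>. \<forall>B\<in>Ob \<C>. \<forall>f\<in>Hom \<C> A B. \<forall>g\<in>Hom \<C> A B. f \<noteq> g \<longrightarrow>
        (\<exists>S\<in>\<S>. \<exists>s\<in>Hom \<C> S A. Comp \<C> S A B f s \<noteq> Comp \<C> S A B g s))"

definition strong_generating_set :: "('o, 'm) category \<Rightarrow> 'o set \<Rightarrow> bool" where
  "strong_generating_set \<C> \<S> \<longleftrightarrow> generating_set \<C> \<S> \<and>
     (\<forall>A\<in>Ob \<C>. \<forall>B\<in>Ob \<C>. \<forall>m. monomorphism \<C> A B m \<and> \<not> isomorphism \<C> A B m \<longrightarrow>
        (\<exists>S\<in>\<S>. \<exists>f\<in>Hom \<C> S B. \<not> (\<exists>g\<in>Hom \<C> S A. f = Comp \<C> S A B m g)))"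

definition strong_generator :: "('o, 'm) category \<Rightarrow> 'o \<Rightarrow> bool" where
  "strong_generator \<C> S \<longleftrightarrow> strong_generating_set \<C> {S}"


section \<open>Operator spaces\<close>

text \<open>\<open>L2_set\<close> is the \<open>\<ell>\<^sub>2\<close>-norm of a finite family, so this is the operator norm of a matrix of
  operators on \<open>H\<close>, acting between finite direct sums of copies of \<open>H\<close>.\<close>

definition op_mat_norm :: "('h::real_normed_vector \<Rightarrow> 'h) mat \<Rightarrow> real" where
  "op_mat_norm a =
     Sup {L2_set (\<lambda>i. norm (\<Sum>j<dim_col a. (a $$ (i, j)) (\<xi> j))) {..<dim_row a} | \<xi>.
            L2_set (\<lambda>j. norm (\<xi> j)) {..<dim_col a} \<le> 1}"

definition cmat_norm :: "complex mat \<Rightarrow> real" where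
  "cmat_norm \<alpha> = op_mat_norm (map_mat (*) \<alpha>)"

text \<open>The inherited \<open>ring\<close> fields \<open>mult\<close> and \<open>one\<close> of a module record are not used, and
  are left undefined in the examples below. The single function \<open>mnorm\<close> comprises the norms on all
  the matrix spaces, as the size is part of a matrix.\<close>

record 'a opspace = "(complex, 'a) module" +
  mnorm :: "'a mat \<Rightarrow> real"

definition Mats :: "nat \<Rightarrow> ('a, 'z) ring_scheme \<Rightarrow> 'a mat set" where
  "Mats n X = {x \<in> carrier_mat n n. elements_mat x \<subseteq> carrier X}"

definition mat_plus :: "('a, 'z) ring_scheme \<Rightarrow> 'a mat \<Rightarrow> 'a mat \<Rightarrow> 'a mat" where
  "mat_plus X x y = Matrix.mat (dim_row x) (dim_col x) (\<lambda>ij. x $$ ij \<oplus>\<^bsub>X\<^esub> y $$ ij)"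

definition mat_scale :: "(complex, 'a, 'z) module_scheme \<Rightarrow> complex \<Rightarrow> 'a mat \<Rightarrow> 'a mat" where
  "mat_scale X c x = map_mat (\<lambda>a. c \<odot>\<^bsub>X\<^esub> a) x"

definition mat_zero :: "('a, 'z) ring_scheme \<Rightarrow> nat \<Rightarrow> nat \<Rightarrow> 'a mat" where
  "mat_zero X m n = Matrix.mat m n (\<lambda>_. \<zero>\<^bsub>X\<^esub>)"

definition mat_dsum :: "('a, 'z) ring_scheme \<Rightarrow> 'a mat \<Rightarrow> 'a mat \<Rightarrow> 'a mat" where
  "mat_dsum X x y =
     four_block_mat x (mat_zero X (dim_row x) (dim_col y)) (mat_zero X (dim_row y) (dim_col x)) y"

text \<open>The product \<open>\<alpha> x \<beta>\<close> of a matrix over \<open>X\<close> with scalar matrices.\<close>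

definition mat_sandwich ::
  "(complex, 'a, 'z) module_scheme \<Rightarrow> complex mat \<Rightarrow> 'a mat \<Rightarrow> complex mat \<Rightarrow> 'a mat" where
  "mat_sandwich X \<alpha> x \<beta> = Matrix.mat (dim_row \<alpha>) (dim_col \<beta>) (\<lambda>(i, j).
     \<Oplus>\<^bsub>X\<^esub>k\<in>{..<dim_row x}. \<Oplus>\<^bsub>X\<^esub>l\<in>{..<dim_col x}. (\<alpha> $$ (i, k) * \<beta> $$ (l, j)) \<odot>\<^bsub>X\<^esub> x $$ (k, l))"

definition vnorm :: "'a opspace \<Rightarrow> 'a \<Rightarrow> real" where
  "vnorm X a = mnorm X (Matrix.mat 1 1 (\<lambda>_. a))"

locale operator_space = vectorspace class_ring X for X :: "'a opspace" (structure) +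
  assumes mnorm_nonneg: "\<lbrakk>n > 0; x \<in> Mats n X\<rbrakk> \<Longrightarrow> mnorm X x \<ge> 0"
    and mnorm_eq_0: "\<lbrakk>n > 0; x \<in> Mats n X\<rbrakk> \<Longrightarrow> mnorm X x = 0 \<longleftrightarrow> x = mat_zero X n n"
    and mnorm_scale: "\<lbrakk>n > 0; x \<in> Mats n X\<rbrakk> \<Longrightarrow> mnorm X (mat_scale X c x) = cmod c * mnorm X x"
    and mnorm_triangle:
      "\<lbrakk>n > 0; x \<in> Mats n X; y \<in> Mats n X\<rbrakk> \<Longrightarrow> mnorm X (mat_plus X x y) \<le> mnorm X x + mnorm X y"
    and vnorm_complete:
      "\<lbrakk>range s \<subseteq> carrier X; \<forall>\<epsilon>>0. \<exists>N. \<forall>i\<ge>N. \<forall>j\<ge>N. vnorm X (s i \<ominus> s j) < \<epsilon>\<rbrakk>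
         \<Longrightarrow> \<exists>a\<in>carrier X. (\<lambda>i. vnorm X (s i \<ominus> a)) \<longlonglongrightarrow> 0"
    and mnorm_dsum:
      "\<lbrakk>m > 0; n > 0; x \<in> Mats m X; y \<in> Mats n X\<rbrakk>
         \<Longrightarrow> mnorm X (mat_dsum X x y) = max (mnorm X x) (mnorm X y)"
    and mnorm_sandwich:
      "\<lbrakk>m > 0; x \<in> Mats m X; \<alpha> \<in> carrier_mat m m; \<beta> \<in> carrier_mat m m\<rbrakk>
         \<Longrightarrow> mnorm X (mat_sandwich X \<alpha> x \<beta>) \<le> cmat_norm \<alpha> * mnorm X x * cmat_norm \<beta>"


section \<open>Completely bounded maps and the category of operator spaces\<close>

text \<open>The norms are extended-valued, so that the suprema of unbounded sets are \<open>\<infinity>\<close>.\<close>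

definition amp_norm :: "nat \<Rightarrow> 'a opspace \<Rightarrow> 'b opspace \<Rightarrow> ('a \<Rightarrow> 'b) \<Rightarrow> ennreal" where
  "amp_norm n X Y u = (SUP x\<in>{x \<in> Mats n X. mnorm X x \<le> 1}. ennreal (mnorm Y (map_mat u x)))"

definition cb_norm :: "'a opspace \<Rightarrow> 'b opspace \<Rightarrow> ('a \<Rightarrow> 'b) \<Rightarrow> ennreal" where
  "cb_norm X Y u = (SUP n\<in>{0<..}. amp_norm n X Y u)"

definition complete_contraction :: "'a opspace \<Rightarrow> 'b opspace \<Rightarrow> ('a \<Rightarrow> 'b) \<Rightarrow> bool" where
  "complete_contraction X Y u \<longleftrightarrow> u \<in> module_hom class_ring X Y \<and> cb_norm X Y u \<le> 1"

text \<open>The operator spaces whose underlying set is contained in the type \<open>'u\<close>. A map is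
  represented by the function that is undefined outside the domain, so that equality of morphisms is
  equality on the domain.\<close>

definition OS :: "('u opspace, 'u \<Rightarrow> 'u) category" where
  "OS = \<lparr>Ob = {X. operator_space X},
         Hom = (\<lambda>A B. {u \<in> extensional (carrier A). complete_contraction A B u}),
         Ident = (\<lambda>A. restrict id (carrier A)),
         Comp = (\<lambda>A B C g f. compose (carrier A) g f)\<rparr>"


section \<open>Matrix algebras and duals\<close>

text \<open>The identification of an \<open>m \<times> m\<close> matrix over \<open>M\<^sub>n\<close> with an \<open>mn \<times> mn\<close> matrix.\<close>

definition flatten_mat :: "nat \<Rightarrow> 'a mat mat \<Rightarrow> 'a mat" where
  "flatten_mat n x = Matrix.mat (dim_row x * n) (dim_col x * n)
     (\<lambda>(r, s). (x $$ (r div n, s div n)) $$ (r mod n, s mod n))"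

definition matrix_space :: "nat \<Rightarrow> complex mat opspace" where
  "matrix_space n = \<lparr>carrier = carrier_mat n n, mult = undefined, one = undefined,
     zero = 0\<^sub>m n n, add = (+), smult = (\<cdot>\<^sub>m), mnorm = (\<lambda>x. cmat_norm (flatten_mat n x))\<rparr>"

definition bounded_functional :: "'a opspace \<Rightarrow> ('a \<Rightarrow> complex) \<Rightarrow> bool" where
  "bounded_functional X f \<longleftrightarrow>
     (\<forall>x\<in>carrier X. \<forall>y\<in>carrier X. f (x \<oplus>\<^bsub>X\<^esub> y) = f x + f y) \<and>
     (\<forall>c. \<forall>x\<in>carrier X. f (c \<odot>\<^bsub>X\<^esub> x) = c * f x) \<and>
     (\<exists>K. \<forall>x\<in>carrier X. cmod (f x) \<le> K * vnorm X x)"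

definition dual_space :: "'a opspace \<Rightarrow> ('a \<Rightarrow> complex) opspace" where
  "dual_space X = \<lparr>carrier = {f \<in> extensional (carrier X). bounded_functional X f},
     mult = undefined, one = undefined,
     zero = (\<lambda>x\<in>carrier X. 0),
     add = (\<lambda>f g. \<lambda>x\<in>carrier X. f x + g x),
     smult = (\<lambda>c f. \<lambda>x\<in>carrier X. c * f x),
     mnorm = (\<lambda>F. enn2real (cb_norm X (matrix_space (dim_row F)) (\<lambda>x. map_mat (\<lambda>f. f x) F)))\<rparr>"


section \<open>The Hilbert space $\ell_2$\<close>

typedef ell2 = "{x :: nat \<Rightarrow> complex. summable (\<lambda>n. (cmod (x n))\<^sup>2)}"
  by (rule exI[of _ "\<lambda>_. 0"]) simp

setup_lifting type_definition_ell2

lemma ell2_summable_add: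
  assumes "summable (\<lambda>n. (cmod (x n))\<^sup>2)" "summable (\<lambda>n. (cmod (y n))\<^sup>2)"
  shows "summable (\<lambda>n. (cmod (x n + y n))\<^sup>2)"
proof (rule summable_comparison_test)
  show "\<exists>N. \<forall>n\<ge>N. norm ((cmod (x n + y n))\<^sup>2) \<le> 2 * (cmod (x n))\<^sup>2 + 2 * (cmod (y n))\<^sup>2"
  proof (intro exI allI impI)
    fix n
    have "(cmod (x n + y n))\<^sup>2 \<le> (cmod (x n) + cmod (y n))\<^sup>2"
      by (intro power_mono norm_triangle_ineq) auto
    also have "\<dots> \<le> 2 * (cmod (x n))\<^sup>2 + 2 * (cmod (y n))\<^sup>2"
      using sum_squares_bound[of "cmod (x n)" "cmod (y n)"] by (simp add: power2_sum)
    finally show "norm ((cmod (x n + y n))\<^sup>2) \<le> 2 * (cmod (x n))\<^sup>2 + 2 * (cmod (y n))\<^sup>2"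
      by simp
  qed
  show "summable (\<lambda>n. 2 * (cmod (x n))\<^sup>2 + 2 * (cmod (y n))\<^sup>2)"
    using assms by (intro summable_add summable_mult)
qed

lemma ell2_summable_scale:
  assumes "summable (\<lambda>n. (cmod (x n))\<^sup>2)"
  shows "summable (\<lambda>n. (cmod (c * x n))\<^sup>2)"
  using summable_mult[OF assms, of "(cmod c)\<^sup>2"] by (simp add: norm_mult power_mult_distrib)

lemma ell2_summable_inner:
  assumes "summable (\<lambda>n. (cmod (x n))\<^sup>2)" "summable (\<lambda>n. (cmod (y n))\<^sup>2)"
  shows "summable (\<lambda>n. cnj (x n) * y n)"
proof (rule summable_comparison_test)
  show "\<exists>N. \<forall>n\<ge>N. norm (cnj (x n) * y n) \<le> (cmod (x n))\<^sup>2 + (cmod (y n))\<^sup>2"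
  proof (intro exI allI impI)
    fix n
    have "2 * (cmod (x n) * cmod (y n)) \<le> (cmod (x n))\<^sup>2 + (cmod (y n))\<^sup>2"
      using sum_squares_bound[of "cmod (x n)" "cmod (y n)"] by simp
    moreover have "cmod (x n) * cmod (y n) \<ge> 0" by simp
    ultimately show "norm (cnj (x n) * y n) \<le> (cmod (x n))\<^sup>2 + (cmod (y n))\<^sup>2"
      unfolding norm_mult complex_mod_cnj by linarith
  qed
  show "summable (\<lambda>n. (cmod (x n))\<^sup>2 + (cmod (y n))\<^sup>2)"
    using assms by (intro summable_add)
qed

lift_definition cscale :: "complex \<Rightarrow> ell2 \<Rightarrow> ell2" is "\<lambda>c x n. c * x n"
  by (rule ell2_summable_scale)

text \<open>The inner product is conjugate-linear in the first argument.\<close>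

definition cinner :: "ell2 \<Rightarrow> ell2 \<Rightarrow> complex" where
  "cinner x y = (\<Sum>n. cnj (Rep_ell2 x n) * Rep_ell2 y n)"

instantiation ell2 :: real_inner
begin

lift_definition zero_ell2 :: ell2 is "\<lambda>_. 0" by simp
lift_definition plus_ell2 :: "ell2 \<Rightarrow> ell2 \<Rightarrow> ell2" is "\<lambda>x y n. x n + y n"
  by (rule ell2_summable_add)
lift_definition uminus_ell2 :: "ell2 \<Rightarrow> ell2" is "\<lambda>x n. - x n" by simp
definition minus_ell2 :: "ell2 \<Rightarrow> ell2 \<Rightarrow> ell2" where "minus_ell2 x y = x + (- y)"
definition scaleR_ell2 :: "real \<Rightarrow> ell2 \<Rightarrow> ell2" where "scaleR_ell2 r x = cscale (of_real r) x"
definition inner_ell2 :: "ell2 \<Rightarrow> ell2 \<Rightarrow> real" where "inner_ell2 x y = Re (cinner x y)"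
definition norm_ell2 :: "ell2 \<Rightarrow> real" where "norm_ell2 x = sqrt (inner x x)"
definition dist_ell2 :: "ell2 \<Rightarrow> ell2 \<Rightarrow> real" where "dist_ell2 x y = norm (x - y)"
definition sgn_ell2 :: "ell2 \<Rightarrow> ell2" where "sgn_ell2 x = inverse (norm x) *\<^sub>R x"
definition uniformity_ell2 :: "(ell2 \<times> ell2) filter" where
  "uniformity_ell2 = (INF e\<in>{0<..}. principal {(x, y). dist x y < e})"
definition open_ell2 :: "ell2 set \<Rightarrow> bool" where
  "open_ell2 U = (\<forall>x\<in>U. eventually (\<lambda>(x', y). x' = x \<longrightarrow> y \<in> U) uniformity)"

instance
proof
  have sq: "summable (\<lambda>n. (cmod (Rep_ell2 x n))\<^sup>2)" for x
    using Rep_ell2[of x] by simp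
  have smi: "summable (\<lambda>n. cnj (Rep_ell2 x n) * Rep_ell2 y n)" for x y
    by (rule ell2_summable_inner[OF sq sq])
  have inner_eq: "inner x y = (\<Sum>n. Re (cnj (Rep_ell2 x n) * Rep_ell2 y n))"
    and sumRe: "summable (\<lambda>n. Re (cnj (Rep_ell2 x n) * Rep_ell2 y n))" for x y :: ell2
    using summable_Re[OF smi[of x y]] Re_suminf[OF smi[of x y]]
    by (auto simp: inner_ell2_def cinner_def)
  have inner_self: "inner x x = (\<Sum>n. (cmod (Rep_ell2 x n))\<^sup>2)" for x :: ell2
    unfolding inner_eq by (simp add: cmod_power2) (simp add: power2_eq_square)
  fix x y z :: ell2 and a b r :: real
  show "x + y + z = x + (y + z)" by transfer (simp add: add.assoc)
  show "x + y = y + x" by transfer (simp add: add.commute)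
  show "0 + x = x" by transfer simp
  show "- x + x = 0" by transfer simp
  show "x - y = x + - y" by (rule minus_ell2_def)
  show "a *\<^sub>R (x + y) = a *\<^sub>R x + a *\<^sub>R y"
    unfolding scaleR_ell2_def by transfer (simp add: distrib_left)
  show "(a + b) *\<^sub>R x = a *\<^sub>R x + b *\<^sub>R x"
    unfolding scaleR_ell2_def by transfer (simp add: distrib_right)
  show "a *\<^sub>R b *\<^sub>R x = (a * b) *\<^sub>R x"
    unfolding scaleR_ell2_def by transfer (simp add: mult.assoc)
  show "1 *\<^sub>R x = x" unfolding scaleR_ell2_def by transfer simp
  show "dist x y = norm (x - y)" by (rule dist_ell2_def)
  show "sgn x = inverse (norm x) *\<^sub>R x" by (rule sgn_ell2_def)
  show "(uniformity :: (ell2 \<times> ell2) filter) = (INF e\<in>{0<..}. principal {(x, y). dist x y < e})"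
    by (rule uniformity_ell2_def)
  show "open U = (\<forall>x\<in>U. \<forall>\<^sub>F (x', y) in uniformity. x' = x \<longrightarrow> y \<in> U)" for U :: "ell2 set"
    by (rule open_ell2_def)
  show "inner x y = inner y x" unfolding inner_eq by (simp add: mult.commute)
  show "inner (x + y) z = inner x z + inner y z"
    unfolding inner_eq suminf_add[OF sumRe sumRe]
    by (intro arg_cong[of _ _ suminf] ext) (simp add: plus_ell2.rep_eq algebra_simps)
  show "inner (r *\<^sub>R x) y = r * inner x y"
    unfolding inner_eq suminf_mult[OF sumRe, symmetric]
    by (intro arg_cong[of _ _ suminf] ext)
       (simp add: scaleR_ell2_def cscale.rep_eq algebra_simps)
  show "0 \<le> inner x x" unfolding inner_self by (intro suminf_nonneg sq) simp
  show "inner x x = 0 \<longleftrightarrow> x = 0"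
    unfolding inner_self by (subst suminf_eq_zero_iff[OF sq]) (auto simp: Rep_ell2_inject[symmetric] zero_ell2.rep_eq)
  show "norm x = sqrt (inner x x)" by (rule norm_ell2_def)
qed

end


section \<open>The operator spaces $B(\ell_2)$ and $T(\ell_2)$\<close>

definition bounded_clinear :: "(ell2 \<Rightarrow> ell2) \<Rightarrow> bool" where
  "bounded_clinear T \<longleftrightarrow> bounded_linear T \<and> (\<forall>c x. T (cscale c x) = cscale c (T x))"

definition B_ell2 :: "(ell2 \<Rightarrow> ell2) opspace" where
  "B_ell2 = \<lparr>carrier = {T. bounded_clinear T}, mult = undefined, one = undefined,
     zero = (\<lambda>_. 0), add = (\<lambda>S T x. S x + T x), smult = (\<lambda>c T x. cscale c (T x)),
     mnorm = op_mat_norm\<rparr>"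

lift_definition ell2_basis :: "nat \<Rightarrow> ell2" is "\<lambda>k n. if n = k then 1 else 0"
proof -
  fix k :: nat
  have "(\<lambda>n. (cmod (if n = k then 1 else 0))\<^sup>2) = (\<lambda>n. if n = k then 1 else 0)"
    by auto
  then show "summable (\<lambda>n. (cmod (if n = k then 1 else 0))\<^sup>2)"
    using summable_single[of k "\<lambda>_. 1 :: real"] by simp
qed

definition positive_op :: "(ell2 \<Rightarrow> ell2) \<Rightarrow> bool" where
  "positive_op P \<longleftrightarrow> bounded_clinear P \<and> (\<forall>x. cinner x (P x) \<in> \<real>\<^sub>\<ge>\<^sub>0)"

text \<open>\<open>P = \<bar>T\<bar>\<close>, the positive operator with \<open>P\<^sup>2 = T\<^sup>* T\<close>; the latter
  equation is tested against vectors, to avoid choosing a definition of the adjoint.\<close>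

definition is_abs_op :: "(ell2 \<Rightarrow> ell2) \<Rightarrow> (ell2 \<Rightarrow> ell2) \<Rightarrow> bool" where
  "is_abs_op T P \<longleftrightarrow> positive_op P \<and> (\<forall>x y. cinner x (P (P y)) = cinner (T x) (T y))"

text \<open>\<open>T\<close> is of trace class if \<open>\<bar>T\<bar>\<close> has finite trace.\<close>

definition trace_class :: "(ell2 \<Rightarrow> ell2) \<Rightarrow> bool" where
  "trace_class T \<longleftrightarrow> bounded_clinear T \<and>
     (\<exists>P. is_abs_op T P \<and> summable (\<lambda>n. cinner (ell2_basis n) (P (ell2_basis n))))"

definition op_trace :: "(ell2 \<Rightarrow> ell2) \<Rightarrow> complex" where
  "op_trace T = (\<Sum>n. cinner (ell2_basis n) (T (ell2_basis n)))"

definition normal_functional :: "(ell2 \<Rightarrow> ell2) \<Rightarrow> (ell2 \<Rightarrow> ell2) \<Rightarrow> complex" where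
  "normal_functional T = (\<lambda>b\<in>carrier B_ell2. op_trace (T \<circ> b))"

text \<open>The matrix norms are those inherited from the embedding \<open>normal_functional\<close> into the
  dual of \<open>B_ell2\<close>; on the first level this is the trace norm.\<close>

definition T_ell2 :: "(ell2 \<Rightarrow> ell2) opspace" where
  "T_ell2 = \<lparr>carrier = {T. trace_class T}, mult = undefined, one = undefined,
     zero = (\<lambda>_. 0), add = (\<lambda>S T x. S x + T x), smult = (\<lambda>c T x. cscale c (T x)),
     mnorm = (\<lambda>t. mnorm (dual_space B_ell2) (map_mat normal_functional t))\<rparr>"

text \<open>Transport of structure along a map \<open>e\<close> that is injective on the carrier. It serves
  to regard \<open>T_ell2\<close> as an object of \<open>OS\<close> over an arbitrary type \<open>'u\<close> that is large
  enough to contain it.\<close>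

definition opspace_copy :: "('a \<Rightarrow> 'b) \<Rightarrow> 'a opspace \<Rightarrow> 'b opspace" where
  "opspace_copy e X = (let d = inv_into (carrier X) e in
     \<lparr>carrier = e ` carrier X, mult = undefined, one = undefined,
      zero = e \<zero>\<^bsub>X\<^esub>,
      add = (\<lambda>a b. e (d a \<oplus>\<^bsub>X\<^esub> d b)),
      smult = (\<lambda>c a. e (c \<odot>\<^bsub>X\<^esub> d a)),
      mnorm = (\<lambda>x. mnorm X (map_mat d x))\<rparr>)"

end

theory Submission
  imports Defs "HOL-Analysis.Infinite_Sum" "HOL-Analysis.Elementary_Metric_Spaces" "HOL-Analysis.Convex"
begin

text \<open>Let \<open>X\<close> be an operator space and \<open>b\<close> in the unit ball of \<open>M\<^sub>n(X)\<close>. The map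
  \<open>f t = \<Sum>\<^sub>i\<^sub>j \<langle>e\<^sub>j, t e\<^sub>i\<rangle> b\<^sub>i\<^sub>j\<close> from \<open>T(\<ell>\<^sub>2)\<close> to \<open>X\<close> sends the matrix of the operators
  \<open>|e\<^sub>l\<rangle>\<langle>e\<^sub>k|\<close>, which has norm at most one, to \<open>b\<close>. If \<open>f\<close> is a complete contraction for every
  such \<open>b\<close>, then \<open>T(\<ell>\<^sub>2)\<close> separates morphisms, and a monomorphism through which all these maps
  factor is bijective with completely contractive inverse.

  A matrix \<open>t\<close> in the unit ball of \<open>M\<^sub>p(T(\<ell>\<^sub>2))\<close> is a completely contractive map
  \<open>B(\<ell>\<^sub>2) \<rightarrow> M\<^sub>p\<close>; let \<open>\<Phi> : M\<^sub>n \<rightarrow> M\<^sub>p\<close> be its restriction to a corner. Then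
  \<open>f\<close> maps \<open>t\<close> to \<open>(\<Phi> \<otimes> id)(b)\<close>, so what is needed is \<open>\<parallel>(\<Phi> \<otimes> id)(b)\<parallel> \<le> \<parallel>b\<parallel>\<close>. This
  follows from Ruan's axioms once \<open>\<Phi> = \<Sum>\<^sub>q \<alpha>\<^sub>q \<cdot> \<beta>\<^sub>q\<close> with
  \<open>\<parallel>\<Sum> \<alpha>\<^sub>q \<alpha>\<^sub>q\<^sup>*\<parallel>, \<parallel>\<Sum> \<beta>\<^sub>q\<^sup>* \<beta>\<^sub>q\<parallel> \<le> 1 + \<epsilon>\<close>, a finite-dimensional form of Wittstock's
  decomposition, which is obtained by separating \<open>(1, 1, \<Phi>)\<close> from the convex cone of the triples
  \<open>(\<Sum> \<alpha>\<^sub>q \<alpha>\<^sub>q\<^sup>*, \<Sum> \<beta>\<^sub>q\<^sup>* \<beta>\<^sub>q, \<Sum> \<alpha>\<^sub>q \<cdot> \<beta>\<^sub>q)\<close>.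

  That \<open>T(\<ell>\<^sub>2)\<close> is an operator space at all requires that the trace class, defined through
  \<open>|T|\<close>, is closed under sums. For this it is characterised as the set of \<open>T\<close> with a bound on
  \<open>\<Sum>\<^sub>i |\<langle>e\<^sub>i, T b e\<^sub>i\<rangle>|\<close> over all contractions \<open>b\<close>.\<close>

section \<open>The Hilbert space\<close>

text \<open>Complete contractions into X from the trace-class operators on C^n correspond to points
  of the unit ball of M_n(X), and all these spaces are compressions of the one space T(l2). Hence
  one object probes every matrix size at once. X is known only through Ruan's axioms, not as a space
  of operators, so the norm estimate must be produced from sandwiches and direct sums alone; this
  dictates the form of the decomposition of \<Phi>. In its hypothesis one amplification, of the size
  p of the target, is enough, because a separating functional yields a contraction with just p block
  rows and columns. Separation concerns the closure of the cone and so gives an approximation;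
  turning it into an exact identity is what costs \<epsilon>. The trace class is delicate since |S +
  T| is not dominated by |S| + |T|. The passage between |T| and pairings with contractions uses a
  square root of |T| and a polar decomposition. The latter is taken approximately, with the
  invertible operator |T| + \<epsilon>, so that no partial isometry has to be extended from the
  range of |T|.\<close>

lemma ell2_eqI: "(\<And>n. Rep_ell2 x n = Rep_ell2 y n) \<Longrightarrow> x = y"
  by (simp add: Rep_ell2_inject[symmetric] ext)

lemma ell2_summable: "summable (\<lambda>n. (cmod (Rep_ell2 x n))\<^sup>2)"
  using Rep_ell2[of x] by simp

lemma Rep_ell2_diff [simp]: "Rep_ell2 (x - y) n = Rep_ell2 x n - Rep_ell2 y n"
  unfolding minus_ell2_def plus_ell2.rep_eq uminus_ell2.rep_eq by simp

lemmas ell2_rep [simp] =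
  plus_ell2.rep_eq uminus_ell2.rep_eq zero_ell2.rep_eq cscale.rep_eq ell2_basis.rep_eq

lemma Rep_ell2_scaleR [simp]: "Rep_ell2 (r *\<^sub>R x) n = of_real r * Rep_ell2 x n"
  by (simp add: scaleR_ell2_def)

lemma Rep_ell2_sum [simp]: "Rep_ell2 (sum f A) n = (\<Sum>a\<in>A. Rep_ell2 (f a) n)"
  by (induction A rule: infinite_finite_induct) auto

lemma cscale_add_right: "cscale c (x + y) = cscale c x + cscale c y"
  and cscale_add_left: "cscale (c + d) x = cscale c x + cscale d x"
  and cscale_cscale [simp]: "cscale c (cscale d x) = cscale (c * d) x"
  and cscale_one [simp]: "cscale 1 x = x"
  and cscale_zero_left [simp]: "cscale 0 x = 0"
  and cscale_zero_right [simp]: "cscale c 0 = 0"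
  and cscale_diff_right: "cscale c (x - y) = cscale c x - cscale c y"
  and cscale_of_real: "cscale (of_real r) x = r *\<^sub>R x"
  by (auto intro!: ell2_eqI simp: algebra_simps)

lemma cscale_sum_right: "cscale c (sum f A) = (\<Sum>a\<in>A. cscale c (f a))"
  by (induction A rule: infinite_finite_induct) (auto simp: cscale_add_right)

lemma cscale_scaleR: "cscale c (r *\<^sub>R x) = r *\<^sub>R cscale c x"
  by (auto intro!: ell2_eqI)

section \<open>The complex inner product and its Cauchy-Schwarz inequality\<close>

lemma cinner_summable: "summable (\<lambda>n. cnj (Rep_ell2 x n) * Rep_ell2 y n)"
  by (rule ell2_summable_inner[OF ell2_summable ell2_summable])

lemma cinner_sums: "(\<lambda>n. cnj (Rep_ell2 x n) * Rep_ell2 y n) sums cinner x y"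
  using cinner_summable unfolding cinner_def by (rule summable_sums)

lemma cinner_add_right: "cinner x (y + z) = cinner x y + cinner x z"
  by (rule sums_unique2[OF cinner_sums])
     (use sums_add[OF cinner_sums[of x y] cinner_sums[of x z]] in \<open>simp add: algebra_simps\<close>)

lemma cinner_scale_right [simp]: "cinner x (cscale c y) = c * cinner x y"
  by (rule sums_unique2[OF cinner_sums])
     (use sums_mult[OF cinner_sums[of x y], of c] in \<open>simp add: algebra_simps\<close>)

lemma cinner_cnj: "cnj (cinner x y) = cinner y x"
proof (rule sums_unique2[OF _ cinner_sums])
  show "(\<lambda>n. cnj (Rep_ell2 y n) * Rep_ell2 x n) sums cnj (cinner x y)"
    using sums_cnj[THEN iffD2, OF cinner_sums[of x y]] by (simp add: mult.commute)
qed

lemma cinner_add_left: "cinner (x + y) z = cinner x z + cinner y z"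
  by (metis cinner_cnj cinner_add_right complex_cnj_add)

lemma cinner_scale_left [simp]: "cinner (cscale c x) y = cnj c * cinner x y"
  by (metis cinner_cnj cinner_scale_right complex_cnj_mult)

lemma cinner_zero [simp]: "cinner x 0 = 0" "cinner 0 x = 0"
  by (simp_all add: cinner_def)

lemma cinner_minus_right: "cinner x (- y) = - cinner x y"
  using cinner_scale_right[of x "-1" y]
  by (metis (no_types) cinner_add_right cinner_zero(1) eq_neg_iff_add_eq_0 left_minus)

lemma cinner_minus_left: "cinner (- x) y = - cinner x y"
  by (metis cinner_cnj cinner_minus_right complex_cnj_minus)

lemma cinner_diff_right: "cinner x (y - z) = cinner x y - cinner x z"
  by (metis cinner_add_right cinner_minus_right diff_conv_add_uminus)

lemma cinner_diff_left: "cinner (x - y) z = cinner x z - cinner y z"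
  by (metis cinner_add_left cinner_minus_left diff_conv_add_uminus)

lemma cinner_scaleR_right [simp]: "cinner x (r *\<^sub>R y) = of_real r * cinner x y"
  by (simp add: scaleR_ell2_def)

lemma cinner_scaleR_left [simp]: "cinner (r *\<^sub>R x) y = of_real r * cinner x y"
  by (simp add: scaleR_ell2_def)

lemma cinner_sum_right: "cinner x (sum f A) = (\<Sum>a\<in>A. cinner x (f a))"
  by (induction A rule: infinite_finite_induct) (auto simp: cinner_add_right)

lemma cinner_sum_left: "cinner (sum f A) x = (\<Sum>a\<in>A. cinner (f a) x)"
  by (induction A rule: infinite_finite_induct) (auto simp: cinner_add_left)

lemma cinner_self: "cinner x x = of_real ((norm x)\<^sup>2)"
proof -
  have "Im (cinner x x) = 0"
    using arg_cong[OF cinner_cnj[of x x], of Im] by simp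
  moreover have "Re (cinner x x) = (norm x)\<^sup>2"
    by (simp add: power2_norm_eq_inner inner_ell2_def)
  ultimately show ?thesis by (simp add: complex_eq_iff)
qed

lemma norm_ell2_sums: "(\<lambda>n. (cmod (Rep_ell2 x n))\<^sup>2) sums (norm x)\<^sup>2"
  using sums_Re[OF cinner_sums[of x x]]
  by (simp add: cinner_self cmod_power2) (simp add: power2_eq_square)

lemma norm_cscale [simp]: "norm (cscale c x) = cmod c * norm x"
proof -
  have "(norm (cscale c x))\<^sup>2 = (cmod c * norm x)\<^sup>2"
    by (rule sums_unique2[OF norm_ell2_sums])
       (use sums_mult[OF norm_ell2_sums[of x], of "(cmod c)\<^sup>2"] in
         \<open>simp add: norm_mult power_mult_distrib\<close>)
  then show ?thesis by (simp add: power2_eq_iff_nonneg)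
qed

text \<open>Multiplying y by a phase makes the inner product real and nonnegative; it then equals
  the real inner product of the instance, whose inequality applies.\<close>

lemma cinner_cauchy_schwarz: "cmod (cinner x y) \<le> norm x * norm y"
proof (cases "cinner x y = 0")
  case False
  define c where "c = cnj (sgn (cinner x y))"
  have c: "cmod c = 1" using False by (simp add: c_def norm_sgn)
  have "of_real (cmod (cinner x y)) = c * cinner x y"
    using False by (simp add: c_def sgn_eq complex_norm_square[symmetric] power2_eq_square field_simps)
  then have "cmod (cinner x y) = Re (cinner x (cscale c y))"
    by (metis Re_complex_of_real cinner_scale_right)
  also have "\<dots> = inner x (cscale c y)" by (simp add: inner_ell2_def)
  also have "\<dots> \<le> norm x * norm (cscale c y)" by (rule norm_cauchy_schwarz)
  finally show ?thesis using c by simp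
qed simp

lemma cinner_basis_left [simp]: "cinner (ell2_basis k) x = Rep_ell2 x k"
proof -
  have "(\<lambda>n. cnj (Rep_ell2 (ell2_basis k) n) * Rep_ell2 x n) = (\<lambda>n. if n = k then Rep_ell2 x n else 0)"
    by auto
  then have "(\<lambda>n. cnj (Rep_ell2 (ell2_basis k) n) * Rep_ell2 x n) sums Rep_ell2 x k"
    using sums_single[of k "Rep_ell2 x"] by simp
  then show ?thesis using sums_unique2[OF cinner_sums] by blast
qed

lemma cinner_basis_right [simp]: "cinner x (ell2_basis k) = cnj (Rep_ell2 x k)"
  by (metis cinner_basis_left cinner_cnj)

lemma norm_basis [simp]: "norm (ell2_basis k) = 1"
proof -
  have "(of_real ((norm (ell2_basis k))\<^sup>2) :: complex) = 1"
    unfolding cinner_self[symmetric] by simp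
  then have "(norm (ell2_basis k))\<^sup>2 = 1"
    using of_real_eq_1_iff by blast
  then show ?thesis by (simp add: power2_eq_1_iff) (smt (verit) norm_ge_zero)
qed

lemma norm_Rep_le: "cmod (Rep_ell2 x k) \<le> norm x"
  using cinner_cauchy_schwarz[of "ell2_basis k" x] by simp

lemma sum_Rep_le: "finite A \<Longrightarrow> (\<Sum>k\<in>A. (cmod (Rep_ell2 x k))\<^sup>2) \<le> (norm x)\<^sup>2"
  using sum_le_suminf[OF ell2_summable, of A x] norm_ell2_sums[of x] by (simp add: sums_iff)

lemma cinner_ext: "(\<And>x. cinner x y = cinner x z) \<Longrightarrow> y = z"
  by (metis cinner_basis_left ell2_eqI)

section \<open>Continuity of the operations and completeness\<close>

lemma bounded_linear_cinner_right: "bounded_linear (cinner x)"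
  by (rule bounded_linear_intro[of _ "norm x"])
     (auto simp: cinner_add_right scaleR_conv_of_real intro: order_trans[OF cinner_cauchy_schwarz] simp: mult.commute)

lemma bounded_linear_cinner_left: "bounded_linear (\<lambda>y. cinner y x)"
  by (rule bounded_linear_intro[of _ "norm x"])
     (auto simp: cinner_add_left scaleR_conv_of_real intro: order_trans[OF cinner_cauchy_schwarz])

lemma bounded_linear_cscale: "bounded_linear (cscale c)"
  by (rule bounded_linear_intro[of _ "cmod c"]) (auto simp: cscale_add_right cscale_scaleR mult.commute)

lemma Rep_ell2_tendsto: "(f \<longlongrightarrow> x) F \<Longrightarrow> ((\<lambda>i. Rep_ell2 (f i) k) \<longlongrightarrow> Rep_ell2 x k) F"
  using bounded_linear.tendsto[OF bounded_linear_cinner_right[of "ell2_basis k"]] by simp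

lemma Rep_ell2_Abs: "summable (\<lambda>n. (cmod (f n))\<^sup>2) \<Longrightarrow> Rep_ell2 (Abs_ell2 f) = f"
  by (simp add: Abs_ell2_inverse)

lemma summable_square_bound:
  fixes f :: "nat \<Rightarrow> complex"
  assumes "\<And>N. (\<Sum>n<N. (cmod (f n))\<^sup>2) \<le> B"
  shows "summable (\<lambda>n. (cmod (f n))\<^sup>2)"
  by (rule summableI_nonneg_bounded[of _ B]) (use assms in auto)

lemma norm_ell2_bound:
  assumes "\<And>N. (\<Sum>n<N. (cmod (Rep_ell2 x n))\<^sup>2) \<le> B\<^sup>2" "B \<ge> 0"
  shows "norm x \<le> B"
proof -
  have "(norm x)\<^sup>2 \<le> B\<^sup>2"
    using suminf_le_const[OF ell2_summable assms(1)] unfolding sums_unique[OF norm_ell2_sums, symmetric] .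
  then show ?thesis using assms(2) by (rule power2_le_imp_le)
qed

instance ell2 :: complete_space
proof
  fix X :: "nat \<Rightarrow> ell2" assume X: "Cauchy X"
  have "Cauchy (\<lambda>i. Rep_ell2 (X i) k)" for k
  proof (rule metric_CauchyI)
    fix e :: real assume "e > 0"
    then obtain M where "\<forall>m\<ge>M. \<forall>n\<ge>M. dist (X m) (X n) < e" using metric_CauchyD[OF X] by blast
    then show "\<exists>M. \<forall>m\<ge>M. \<forall>n\<ge>M. dist (Rep_ell2 (X m) k) (Rep_ell2 (X n) k) < e"
      by (metis Rep_ell2_diff dist_norm norm_Rep_le order_le_less_trans)
  qed
  then have "\<forall>k. \<exists>l. (\<lambda>i. Rep_ell2 (X i) k) \<longlonglongrightarrow> l"
    by (simp add: Cauchy_convergent_iff convergent_def)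
  then obtain y where y: "\<And>k. (\<lambda>i. Rep_ell2 (X i) k) \<longlonglongrightarrow> y k" by metis
  \<comment> \<open>Finite partial sums commute with the coordinatewise limit, so the Cauchy
    estimate passes to y uniformly in N. This yields both that y is square-summable and that the
    convergence is in norm.\<close>
  have lim: "(\<Sum>n<N. (cmod (y n - Rep_ell2 (X i) n))\<^sup>2) \<le> e\<^sup>2"
    if "\<forall>m\<ge>i. dist (X m) (X i) < e" for N i e
  proof (rule LIMSEQ_le_const2)
    show "(\<lambda>j. \<Sum>n<N. (cmod (Rep_ell2 (X j) n - Rep_ell2 (X i) n))\<^sup>2)
       \<longlonglongrightarrow> (\<Sum>n<N. (cmod (y n - Rep_ell2 (X i) n))\<^sup>2)"
      by (intro tendsto_intros y)
    have "(\<Sum>n<N. (cmod (Rep_ell2 (X j) n - Rep_ell2 (X i) n))\<^sup>2) \<le> e\<^sup>2" if "j \<ge> i" for j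
    proof -
      have "(\<Sum>n<N. (cmod (Rep_ell2 (X j) n - Rep_ell2 (X i) n))\<^sup>2) \<le> (norm (X j - X i))\<^sup>2"
        using sum_Rep_le[of "{..<N}" "X j - X i"] by simp
      also have "\<dots> \<le> e\<^sup>2"
        using \<open>\<forall>m\<ge>i. dist (X m) (X i) < e\<close> that by (intro power_mono) (auto simp: dist_norm less_imp_le)
      finally show ?thesis .
    qed
    then show "\<exists>M. \<forall>j\<ge>M. (\<Sum>n<N. (cmod (Rep_ell2 (X j) n - Rep_ell2 (X i) n))\<^sup>2) \<le> e\<^sup>2"
      by blast
  qed
  obtain i0 where i0: "\<forall>m\<ge>i0. dist (X m) (X i0) < 1"
    using metric_CauchyD[OF X, of 1] by auto
  have "summable (\<lambda>n. (cmod ((y n - Rep_ell2 (X i0) n)))\<^sup>2)"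
    by (rule summable_square_bound[of _ "1\<^sup>2"]) (rule lim[OF i0])
  from ell2_summable_add[OF this ell2_summable[of "X i0"]]
  have sy: "summable (\<lambda>n. (cmod (y n))\<^sup>2)" by simp
  have "X \<longlonglongrightarrow> Abs_ell2 y"
  proof (rule metric_LIMSEQ_I)
    fix e :: real assume e: "e > 0"
    then obtain M where M: "\<forall>m\<ge>M. \<forall>n\<ge>M. dist (X m) (X n) < e/2"
      using metric_CauchyD[OF X, of "e/2"] by auto
    have "dist (X i) (Abs_ell2 y) < e" if "i \<ge> M" for i
    proof -
      have "norm (Abs_ell2 y - X i) \<le> e/2"
        by (rule norm_ell2_bound) (use lim[of i "e/2"] M that e in \<open>auto simp: Rep_ell2_Abs[OF sy]\<close>)
      then show ?thesis using e by (simp add: dist_norm norm_minus_commute)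
    qed
    then show "\<exists>M. \<forall>i\<ge>M. dist (X i) (Abs_ell2 y) < e" by blast
  qed
  then show "convergent X" by (auto simp: convergent_def)
qed

instance ell2 :: banach ..

section \<open>Bounded operators\<close>

lemma bounded_clinear_bl: "bounded_clinear T \<Longrightarrow> bounded_linear T"
  and bounded_clinear_scale: "bounded_clinear T \<Longrightarrow> T (cscale c x) = cscale c (T x)"
  by (auto simp: bounded_clinear_def)

lemma bounded_clinearI:
  assumes "\<And>x y. T (x + y) = T x + T y" "\<And>c x. T (cscale c x) = cscale c (T x)"
    "\<And>x. norm (T x) \<le> K * norm x"
  shows "bounded_clinear T"
  unfolding bounded_clinear_def
proof
  show "bounded_linear T"
    by (rule bounded_linear_intro[of _ K])
       (use assms in \<open>auto simp: scaleR_ell2_def mult.commute\<close>)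
qed (use assms in auto)

lemma bounded_clinear_simps:
  assumes "bounded_clinear T"
  shows "T (x + y) = T x + T y" "T (x - y) = T x - T y" "T 0 = 0" "T (- x) = - T x"
    "T (r *\<^sub>R x) = r *\<^sub>R T x" "T (sum f A) = (\<Sum>a\<in>A. T (f a))" "T (cscale c x) = cscale c (T x)"
  using bounded_clinear_bl[OF assms] bounded_clinear_scale[OF assms]
  by (auto dest!: bounded_linear.linear simp: linear_add linear_diff linear_0 linear_neg linear_scale linear_sum)

lemma bounded_clinear_bound:
  assumes "bounded_clinear T"
  obtains K where "K > 0" "\<And>x. norm (T x) \<le> K * norm x"
  using bounded_linear.pos_bounded[OF bounded_clinear_bl[OF assms]] by (auto simp: mult.commute)

lemma bounded_clinear_zero: "bounded_clinear (\<lambda>_. 0)"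
  by (rule bounded_clinearI[of _ 0]) auto

lemma bounded_clinear_ident: "bounded_clinear (\<lambda>x. x)"
  by (rule bounded_clinearI[of _ 1]) auto

lemma bounded_clinear_comp:
  assumes "bounded_clinear S" "bounded_clinear T" shows "bounded_clinear (\<lambda>x. S (T x))"
  using assms bounded_linear_compose[of S T] unfolding bounded_clinear_def by simp

lemma bounded_clinear_add:
  assumes "bounded_clinear S" "bounded_clinear T" shows "bounded_clinear (\<lambda>x. S x + T x)"
  using assms bounded_linear_add[of S T] unfolding bounded_clinear_def by (simp add: cscale_add_right)

lemma bounded_clinear_cscale:
  assumes "bounded_clinear T" shows "bounded_clinear (\<lambda>x. cscale c (T x))"
  using assms bounded_linear_compose[OF bounded_linear_cscale[of c], of T] unfolding bounded_clinear_def
  by (simp add: mult.commute)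

lemma bounded_clinear_sum:
  "(\<And>a. a \<in> A \<Longrightarrow> bounded_clinear (T a)) \<Longrightarrow> bounded_clinear (\<lambda>x. \<Sum>a\<in>A. T a x)"
  by (induction A rule: infinite_finite_induct) (auto intro: bounded_clinear_zero bounded_clinear_add)

text \<open>The rank-one operator |u><v| of bra-ket notation.\<close>

definition butterfly :: "ell2 \<Rightarrow> ell2 \<Rightarrow> ell2 \<Rightarrow> ell2" where
  "butterfly u v x = cscale (cinner v x) u"

lemma norm_butterfly: "norm (butterfly u v x) \<le> norm u * norm v * norm x"
  using mult_right_mono[OF cinner_cauchy_schwarz[of v x], of "norm u"]
  by (simp add: butterfly_def ac_simps)

lemma bounded_clinear_butterfly: "bounded_clinear (butterfly u v)"
  by (rule bounded_clinearI[OF _ _ norm_butterfly])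
     (auto simp: butterfly_def cinner_add_right cscale_add_left)

section \<open>Contractions and diagonal operators\<close>

definition contraction :: "(ell2 \<Rightarrow> ell2) \<Rightarrow> bool" where
  "contraction b \<longleftrightarrow> bounded_clinear b \<and> (\<forall>x. norm (b x) \<le> norm x)"

lemma contraction_comp: "contraction a \<Longrightarrow> contraction b \<Longrightarrow> contraction (\<lambda>x. a (b x))"
  unfolding contraction_def by (auto intro: bounded_clinear_comp order_trans)

text \<open>\<open>Abs_ell2\<close> is meaningful here if d is bounded. The lemmas below assume |d
  n| <= 1, which covers coordinate projections and phases.\<close>

definition diag_op :: "(nat \<Rightarrow> complex) \<Rightarrow> ell2 \<Rightarrow> ell2" where
  "diag_op d x = Abs_ell2 (\<lambda>n. d n * Rep_ell2 x n)"

lemma diag_op: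
  assumes "\<And>n. cmod (d n) \<le> 1"
  shows Rep_diag_op: "Rep_ell2 (diag_op d x) n = d n * Rep_ell2 x n"
    and contraction_diag_op: "contraction (diag_op d)"
proof -
  have le: "(cmod (d n * Rep_ell2 x n))\<^sup>2 \<le> (cmod (Rep_ell2 x n))\<^sup>2" for x n
    using assms[of n] by (auto simp: norm_mult intro!: power_mono mult_left_le_one_le)
  have s: "summable (\<lambda>n. (cmod (d n * Rep_ell2 x n))\<^sup>2)" for x
    by (rule summable_comparison_test'[OF ell2_summable[of x], of 0]) (use le in auto)
  show rep: "Rep_ell2 (diag_op d x) n = d n * Rep_ell2 x n" for x n
    by (simp add: diag_op_def Rep_ell2_Abs[OF s])
  have "norm (diag_op d x) \<le> norm x" for x
  proof (rule norm_ell2_bound)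
    fix N show "(\<Sum>n<N. (cmod (Rep_ell2 (diag_op d x) n))\<^sup>2) \<le> (norm x)\<^sup>2"
      unfolding rep by (rule order_trans[OF sum_mono[OF le] sum_Rep_le]) simp
  qed simp
  then show "contraction (diag_op d)"
    unfolding contraction_def
    by (auto intro!: bounded_clinearI[of _ 1] ell2_eqI simp: rep algebra_simps)
qed

lemma diag_op_basis:
  assumes "\<And>n. cmod (d n) \<le> 1"
  shows "diag_op d (ell2_basis n) = cscale (d n) (ell2_basis n)"
  by (rule ell2_eqI) (auto simp: Rep_diag_op[OF assms])

text \<open>For unbounded \<open>T\<close> the sequence need not be square-summable, and then this is a junk value.\<close>

definition adj :: "(ell2 \<Rightarrow> ell2) \<Rightarrow> ell2 \<Rightarrow> ell2" where
  "adj T y = Abs_ell2 (\<lambda>n. cinner (T (ell2_basis n)) y)"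

text \<open>Splitting the norm series gives |x - s_N|^2 as |x|^2 minus the first N squares, which
  tends to 0.\<close>

lemma ell2_expansion:
  "(\<lambda>N. \<Sum>n<N. cscale (Rep_ell2 x n) (ell2_basis n)) \<longlonglongrightarrow> x"
proof -
  let ?s = "\<lambda>N. \<Sum>n<N. cscale (Rep_ell2 x n) (ell2_basis n)"
  have rep: "Rep_ell2 (?s N) k = (if k < N then Rep_ell2 x k else 0)" for N k
    by (simp add: if_distrib[of "\<lambda>c. _ * c"] cong: if_cong)
  have nrm: "(norm (x - ?s N))\<^sup>2 = (norm x)\<^sup>2 - (\<Sum>n<N. (cmod (Rep_ell2 x n))\<^sup>2)" for N
  proof -
    have "(\<lambda>n. (cmod (Rep_ell2 x n))\<^sup>2 - (if n \<in> {..<N} then (cmod (Rep_ell2 x n))\<^sup>2 else 0))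
       sums ((norm x)\<^sup>2 - (\<Sum>n<N. (cmod (Rep_ell2 x n))\<^sup>2))"
      by (intro sums_diff norm_ell2_sums sums_If_finite_set) auto
    moreover have "(\<lambda>n. (cmod (Rep_ell2 x n))\<^sup>2 - (if n \<in> {..<N} then (cmod (Rep_ell2 x n))\<^sup>2 else 0))
       = (\<lambda>n. (cmod (Rep_ell2 (x - ?s N) n))\<^sup>2)"
      unfolding Rep_ell2_diff rep by (intro ext) simp
    ultimately show ?thesis using norm_ell2_sums[of "x - ?s N"] sums_unique2 by metis
  qed
  have "(\<lambda>N. (norm (x - ?s N))\<^sup>2) \<longlonglongrightarrow> (norm x)\<^sup>2 - (norm x)\<^sup>2"
    unfolding nrm using norm_ell2_sums[of x] by (intro tendsto_intros) (simp add: sums_def)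
  then have "(\<lambda>N. sqrt ((norm (x - ?s N))\<^sup>2)) \<longlonglongrightarrow> sqrt 0"
    using tendsto_real_sqrt by fastforce
  then have "(\<lambda>N. x - ?s N) \<longlonglongrightarrow> 0"
    by (simp add: tendsto_norm_zero_iff)
  from tendsto_diff[OF tendsto_const this, of x] show ?thesis by simp
qed

text \<open>The point is that the coefficients <T e_n, y> are square-summable. The finite vector v
  with the first N of them as coordinates satisfies <T v, y> = |v|^2, so |v|^2 <= K |v| |y| and one
  factor |v| cancels.\<close>

lemma adj:
  assumes T: "bounded_clinear T"
  shows cinner_adj_left: "cinner (adj T y) x = cinner y (T x)"
    and cinner_adj_right: "cinner x (adj T y) = cinner (T x) y"
    and norm_adj: "(\<And>x. norm (T x) \<le> K * norm x) \<Longrightarrow> norm (adj T y) \<le> K * norm y"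
    and bounded_clinear_adj: "bounded_clinear (adj T)"
proof -
  have fin: "(\<Sum>n<N. (cmod (cinner (T (ell2_basis n)) y))\<^sup>2) \<le> (K * norm y)\<^sup>2"
    if K: "\<And>x. norm (T x) \<le> K * norm x" for K N y
  proof -
    define v where "v = (\<Sum>n<N. cscale (cinner (T (ell2_basis n)) y) (ell2_basis n))"
    define S where "S = (\<Sum>n<N. (cmod (cinner (T (ell2_basis n)) y))\<^sup>2)"
    have S0: "S \<ge> 0" unfolding S_def by (intro sum_nonneg) auto
    have 1: "cinner (T v) y = of_real S"
      unfolding v_def S_def bounded_clinear_simps[OF T] cinner_sum_left cinner_scale_left of_real_sum
      by (intro sum.cong refl) (simp only: complex_norm_square, simp add: mult.commute)
    have "cinner v v = of_real S"
      unfolding S_def of_real_sum complex_norm_square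
      by (subst (1) v_def)
         (auto simp: cinner_sum_left v_def if_distrib[of "\<lambda>c. _ * c"] mult.commute cong: if_cong intro!: sum.cong)
    then have 2: "(norm v)\<^sup>2 = S"
      unfolding cinner_self by (metis of_real_eq_iff)
    have "S \<le> norm (T v) * norm y"
      using cinner_cauchy_schwarz[of "T v" y] S0 unfolding 1 by simp
    also have "\<dots> \<le> (K * norm v) * norm y" using K[of v] by (intro mult_right_mono) auto
    finally have "norm v * norm v \<le> norm v * (K * norm y)"
      using 2 by (simp add: power2_eq_square ac_simps)
    then have "norm v \<le> K * norm y \<or> norm v = 0"
      by (metis mult_le_cancel_left_pos norm_ge_zero order_le_less)
    moreover have "0 \<le> K * norm y"
      using order_trans[OF norm_ge_zero K[of "ell2_basis 0"]] by simp
    ultimately have "norm v \<le> K * norm y" by auto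
    then show ?thesis using 2 unfolding S_def[symmetric] by (metis norm_ge_zero power_mono)
  qed
  obtain K0 where K0: "K0 > 0" "\<And>x. norm (T x) \<le> K0 * norm x" by (rule bounded_clinear_bound[OF T]) blast
  have rep: "Rep_ell2 (adj T y) n = cinner (T (ell2_basis n)) y" for y n
    by (simp add: adj_def Rep_ell2_Abs[OF summable_square_bound[OF fin[OF K0(2)]]])
  \<comment> \<open>The expansion of x turns <T x, y> into the coordinate series that computes <x,
    adj T y>.\<close>
  have right: "cinner x (adj T y) = cinner (T x) y" for x y
  proof -
    have "(\<lambda>N. cinner (T (\<Sum>n<N. cscale (Rep_ell2 x n) (ell2_basis n))) y) \<longlonglongrightarrow> cinner (T x) y"
      by (intro bounded_linear.tendsto[OF bounded_linear_cinner_left]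
            bounded_linear.tendsto[OF bounded_clinear_bl[OF T]] ell2_expansion)
    then have "(\<lambda>n. cnj (Rep_ell2 x n) * cinner (T (ell2_basis n)) y) sums cinner (T x) y"
      unfolding bounded_clinear_simps[OF T] cinner_sum_left cinner_scale_left sums_def .
    then show ?thesis
      using cinner_sums[of x "adj T y"] unfolding rep using sums_unique2 by blast
  qed
  then show "cinner x (adj T y) = cinner (T x) y" by simp
  show "cinner (adj T y) x = cinner y (T x)" using right by (metis cinner_cnj)
  have bound: "norm (adj T y) \<le> K * norm y" if K: "\<And>x. norm (T x) \<le> K * norm x" for y K
  proof (rule norm_ell2_bound)
    fix N show "(\<Sum>n<N. (cmod (Rep_ell2 (adj T y) n))\<^sup>2) \<le> (K * norm y)\<^sup>2"
      unfolding rep by (rule fin[OF K])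
    show "0 \<le> K * norm y"
      using order_trans[OF norm_ge_zero K[of "ell2_basis 0"]] by simp
  qed
  then show "(\<And>x. norm (T x) \<le> K * norm x) \<Longrightarrow> norm (adj T y) \<le> K * norm y" by blast
  show "bounded_clinear (adj T)"
    by (rule bounded_clinearI[OF _ _ bound[OF K0(2)]])
       (auto intro!: cinner_ext simp: right cinner_add_right)
qed

lemma contraction_adj: "contraction b \<Longrightarrow> contraction (adj b)"
  using norm_adj[of b 1] bounded_clinear_adj by (auto simp: contraction_def)

section \<open>Square roots and trace-class operators\<close>

lemma positive_op_Re: "positive_op P \<Longrightarrow> cinner x (P x) = of_real (Re (cinner x (P x)))"
  and positive_op_ge: "positive_op P \<Longrightarrow> 0 \<le> Re (cinner x (P x))"
  and positive_op_bounded: "positive_op P \<Longrightarrow> bounded_clinear P"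
  by (auto simp: positive_op_def complex_nonneg_Reals_iff complex_eq_iff)

text \<open>The form <z, P z> is real for every z. Evaluating it at x + y and at x + i y compares
  the imaginary and the real parts of <x, P y> and <P x, y>.\<close>

lemma positive_op_selfadj:
  assumes P: "positive_op P"
  shows "cinner (P x) y = cinner x (P y)"
proof -
  have bl: "bounded_clinear P" using P by (rule positive_op_bounded)
  have im: "Im (cinner z (P z)) = 0" for z
    using arg_cong[OF positive_op_Re[OF P, of z], of Im] by simp
  have "Im (cinner x (P y)) + Im (cinner y (P x)) = 0"
    using im[of "x + y"] im[of x] im[of y]
    by (simp add: bounded_clinear_simps[OF bl] cinner_add_left cinner_add_right)
  moreover have "Re (cinner x (P y)) - Re (cinner y (P x)) = 0"
    using im[of "x + cscale \<i> y"] im[of x] im[of y]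
    by (simp add: bounded_clinear_simps[OF bl] cinner_add_left cinner_add_right)
  ultimately have "cnj (cinner y (P x)) = cinner x (P y)"
    by (simp add: complex_eq_iff)
  then show ?thesis by (simp add: cinner_cnj)
qed

lemma norm_diff_scale_sq:
  "(norm (x - r *\<^sub>R y))\<^sup>2 = (norm x)\<^sup>2 - 2 * r * Re (cinner x y) + r\<^sup>2 * (norm y)\<^sup>2"
  unfolding power2_norm_eq_inner inner_ell2_def[symmetric] inner_diff_left inner_diff_right
    inner_scaleR_left inner_scaleR_right inner_commute[of y x]
  by (simp only: power2_eq_square algebra_simps)

text \<open>This is P^2 <= M P. With q the form of P, the nonnegative number q(x - P x / M) is
  expanded and q(P x) is bounded by M |P x|^2.\<close>

lemma positive_op_norm_sq:
  assumes P: "positive_op P" and M: "M > 0" "\<And>x. norm (P x) \<le> M * norm x"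
  shows "(norm (P x))\<^sup>2 \<le> M * Re (cinner x (P x))"
proof -
  have bl: "bounded_clinear P" using P by (rule positive_op_bounded)
  let ?q = "\<lambda>x. Re (cinner x (P x))"
  have "?q (P x) \<le> norm (P x) * norm (P (P x))"
    using complex_Re_le_cmod order_trans cinner_cauchy_schwarz by blast
  also have "\<dots> \<le> norm (P x) * (M * norm (P x))" using M by (intro mult_left_mono) auto
  finally have 1: "?q (P x) \<le> M * (norm (P x))\<^sup>2" by (simp add: power2_eq_square ac_simps)
  have 2: "cinner x (P (P x)) = of_real ((norm (P x))\<^sup>2)"
    by (simp add: positive_op_selfadj[OF P, symmetric] cinner_self)
  have "0 \<le> ?q (x - (1 / M) *\<^sub>R P x)" by (rule positive_op_ge[OF P])
  also have "\<dots> = ?q x - 2 / M * (norm (P x))\<^sup>2 + (1 / M)\<^sup>2 * ?q (P x)"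
    unfolding bounded_clinear_simps[OF bl] cinner_diff_left cinner_diff_right
      cinner_scaleR_left cinner_scaleR_right 2 using M(1) by (simp add: cinner_self power2_eq_square field_simps)
  also have "\<dots> \<le> ?q x - 2 / M * (norm (P x))\<^sup>2 + (1 / M)\<^sup>2 * (M * (norm (P x))\<^sup>2)"
    using 1 by (intro add_left_mono mult_left_mono) auto
  also have "\<dots> = ?q x - (norm (P x))\<^sup>2 / M" using M(1) by (simp add: field_simps power2_eq_square)
  finally show ?thesis using M(1) by (simp add: field_simps)
qed

text \<open>The operator 1 - P/M is a contraction. Its powers are summed for the square root, and
  the same bound drives the fixed-point argument for P + \<epsilon>.\<close>

lemma norm_positive_shift:
  assumes P: "positive_op P" and M: "M > 0" "\<And>x. norm (P x) \<le> M * norm x"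
  shows "norm (x - (1 / M) *\<^sub>R P x) \<le> norm x"
proof -
  have "(norm (x - (1 / M) *\<^sub>R P x))\<^sup>2 =
     (norm x)\<^sup>2 - 2 / M * Re (cinner x (P x)) + (1 / M)\<^sup>2 * (norm (P x))\<^sup>2"
    unfolding norm_diff_scale_sq by simp
  also have "\<dots> \<le> (norm x)\<^sup>2 - 2 / M * Re (cinner x (P x)) + (1 / M)\<^sup>2 * (M * Re (cinner x (P x)))"
    using positive_op_norm_sq[OF P M, of x] by (intro add_left_mono mult_left_mono) auto
  also have "\<dots> = (norm x)\<^sup>2 - Re (cinner x (P x)) / M" using M(1) by (simp add: field_simps power2_eq_square)
  also have "\<dots> \<le> (norm x)\<^sup>2" using positive_op_ge[OF P, of x] M(1) by simp
  finally show ?thesis by (rule power2_le_imp_le) simp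
qed

text \<open>\<open>1 - (\<Sum>n. sqrt_coeff n * x ^ n)\<close> is the binomial series of \<open>sqrt (1 - x)\<close>.\<close>

fun sqrt_coeff :: "nat \<Rightarrow> real" where
  "sqrt_coeff n = (if n = 0 then 0 else if n = 1 then 1/2
     else (\<Sum>k\<in>{1..<n}. sqrt_coeff k * sqrt_coeff (n - k)) / 2)"

declare sqrt_coeff.simps [simp del]

lemma sqrt_coeff_nonneg: "0 \<le> sqrt_coeff n"
proof (induction n rule: less_induct)
  case (less n)
  have "0 \<le> (\<Sum>k\<in>{1..<n}. sqrt_coeff k * sqrt_coeff (n - k))"
    using less by (intro sum_nonneg mult_nonneg_nonneg) auto
  then show ?case by (subst sqrt_coeff.simps) simp
qed

text \<open>By the recursion, twice the partial sum up to \<open>Suc N\<close> is 1 plus products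
  \<open>sqrt_coeff k * sqrt_coeff l\<close> over distinct pairs of indices up to N, hence at most 1
  plus the square of the partial sum up to N. This gives absolute convergence of the series even at
  the endpoint.\<close>

lemma sum_sqrt_coeff_le: "(\<Sum>n\<le>N. sqrt_coeff n) \<le> 1"
proof (induction N)
  case 0 show ?case by (simp add: sqrt_coeff.simps)
next
  case (Suc N)
  let ?S = "\<Sum>n\<le>N. sqrt_coeff n"
  let ?D = "Sigma {2..Suc N} (\<lambda>n. {1..<n})"
  have eq: "2 * sqrt_coeff n = (if n = 1 then 1 else 0) +
      (if n \<in> {2..Suc N} then (\<Sum>k\<in>{1..<n}. sqrt_coeff k * sqrt_coeff (n - k)) else 0)"
    if "n \<le> Suc N" for n
    using that by (subst sqrt_coeff.simps) (auto simp: le_Suc_eq)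
  have "2 * (\<Sum>n\<le>Suc N. sqrt_coeff n) =
     1 + (\<Sum>n\<in>{2..Suc N}. \<Sum>k\<in>{1..<n}. sqrt_coeff k * sqrt_coeff (n - k))"
  proof -
    have "2 * (\<Sum>n\<le>Suc N. sqrt_coeff n) = (\<Sum>n\<in>{..Suc N}. (if n = 1 then 1 else 0) +
        (if n \<in> {2..Suc N} then (\<Sum>k\<in>{1..<n}. sqrt_coeff k * sqrt_coeff (n - k)) else 0))"
      unfolding sum_distrib_left by (intro sum.cong refl eq) simp
    also have "\<dots> = (\<Sum>n\<in>{..Suc N}. if n = 1 then 1 else 0) +
        (\<Sum>n\<in>{..Suc N} \<inter> {2..Suc N}. \<Sum>k\<in>{1..<n}. sqrt_coeff k * sqrt_coeff (n - k))"
      by (simp only: sum.distrib sum.inter_restrict[OF finite_atMost])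
    also have "{..Suc N} \<inter> {2..Suc N} = {2..Suc N}" by auto
    finally show ?thesis by (simp del: sum.atMost_Suc)
  qed
  also have "(\<Sum>n\<in>{2..Suc N}. \<Sum>k\<in>{1..<n}. sqrt_coeff k * sqrt_coeff (n - k)) =
     (\<Sum>(n, k)\<in>?D. sqrt_coeff k * sqrt_coeff (n - k))"
    by (rule sum.Sigma) auto
  also have "\<dots> = (\<Sum>(k, l)\<in>(\<lambda>(n, k). (k, n - k)) ` ?D. sqrt_coeff k * sqrt_coeff l)"
    by (subst sum.reindex) (auto simp: inj_on_def intro!: sum.cong)
  also have "\<dots> \<le> (\<Sum>(k, l)\<in>{..N} \<times> {..N}. sqrt_coeff k * sqrt_coeff l)"
    by (rule sum_mono2) (auto simp: sqrt_coeff_nonneg)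
  also have "\<dots> = ?S * ?S" by (simp add: sum_product sum.cartesian_product)
  also have "\<dots> \<le> 1 * 1"
    using Suc by (intro mult_mono sum_nonneg) (auto simp: sqrt_coeff_nonneg)
  finally show ?case by simp
qed

definition sqrt_series :: "nat \<Rightarrow> real" where
  "sqrt_series n = (if n = 0 then 1 else - sqrt_coeff n)"

text \<open>The square of the series is 1 - x: for n >= 2 the two end terms cancel the inner sum by
  the recursion.\<close>

lemma sqrt_series_convolution:
  "(\<Sum>k\<le>n. sqrt_series k * sqrt_series (n - k)) = (if n = 0 then 1 else if n = 1 then - 1 else 0)"
proof -
  consider "n = 0" | "n = 1" | "n \<ge> 2" by linarith
  then show ?thesis
  proof cases
    case 3
    have "{..n} = insert 0 (insert n {1..<n})" using 3 by auto
    then have "(\<Sum>k\<le>n. sqrt_series k * sqrt_series (n - k)) =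
        2 * sqrt_series n + (\<Sum>k\<in>{1..<n}. sqrt_series k * sqrt_series (n - k))"
      using 3 by (simp add: sqrt_series_def)
    also have "(\<Sum>k\<in>{1..<n}. sqrt_series k * sqrt_series (n - k)) =
        (\<Sum>k\<in>{1..<n}. sqrt_coeff k * sqrt_coeff (n - k))"
      by (intro sum.cong) (auto simp: sqrt_series_def)
    finally show ?thesis using 3 by (simp add: sqrt_series_def sqrt_coeff.simps[of n])
  qed (simp_all add: sqrt_series_def sqrt_coeff.simps)
qed

lemma summable_sqrt_coeff: "summable sqrt_coeff"
  by (rule bounded_imp_summable[where B = 1]) (use sqrt_coeff_nonneg sum_sqrt_coeff_le in auto)

lemma suminf_sqrt_coeff_le: "suminf sqrt_coeff \<le> 1"
proof (rule suminf_le_const[OF summable_sqrt_coeff])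
  fix n show "sum sqrt_coeff {..<n} \<le> 1"
    using sum_sqrt_coeff_le[of n] sqrt_coeff_nonneg[of n] by (simp add: lessThan_Suc_atMost[symmetric])
qed

lemma abs_sqrt_series: "\<bar>sqrt_series n\<bar> = (if n = 0 then 1 else 0) + sqrt_coeff n"
  by (simp add: sqrt_series_def sqrt_coeff_nonneg sqrt_coeff.simps[of 0])

lemma summable_abs_sqrt_series: "summable (\<lambda>n. \<bar>sqrt_series n\<bar>)"
  unfolding abs_sqrt_series
  by (intro summable_add summable_sqrt_coeff) (use summable_single[of 0 "\<lambda>_. 1::real"] in simp)

lemma contraction_funpow: "contraction X \<Longrightarrow> contraction (X ^^ n)"
proof (induction n)
  case 0 show ?case by (simp add: contraction_def bounded_clinear_ident id_def)
next
  case (Suc n)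
  show ?case using contraction_comp[OF Suc.prems Suc.IH[OF Suc.prems]] by (simp add: o_def)
qed

text \<open>R is sqrt M times the series of sqrt(1 - X) at the contraction X = 1 - P/M, so that R R
  = M (1 - X) = P.\<close>

lemma positive_sqrt_exists:
  assumes P: "positive_op P"
  obtains R where "positive_op R" "\<And>x. R (R x) = P x"
proof -
  have bl: "bounded_clinear P" using P by (rule positive_op_bounded)
  obtain M where M: "M > 0" "\<And>x. norm (P x) \<le> M * norm x" by (rule bounded_clinear_bound[OF bl]) blast
  define X where "X x = x - (1 / M) *\<^sub>R P x" for x
  have cX: "contraction X"
    unfolding contraction_def
  proof
    show "bounded_clinear X"
      by (rule bounded_clinearI[of _ 1])
         (use norm_positive_shift[OF P M] in \<open>auto simp: X_def bounded_clinear_simps[OF bl] algebra_simps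
            cscale_diff_right cscale_scaleR\<close>)
  qed (use norm_positive_shift[OF P M] in \<open>auto simp: X_def\<close>)
  let ?X = "\<lambda>n. X ^^ n"
  have blX: "bounded_clinear (?X n)" and nX: "norm (?X n x) \<le> norm x" for n x
    using contraction_funpow[OF cX, of n] by (auto simp: contraction_def)
  let ?d = sqrt_series
  have nd: "norm (?d n *\<^sub>R ?X n x) \<le> \<bar>?d n\<bar> * norm x" for n x
    using nX[of n x] by (simp add: mult_left_mono)
  have absd: "(\<lambda>n. \<bar>?d n\<bar>) summable_on UNIV"
    using summable_abs_sqrt_series by (simp add: summable_on_UNIV_nonneg_real_iff)
  have smX: "(\<lambda>n. ?d n *\<^sub>R ?X n x) summable_on UNIV" for x
  proof -
    have "summable (\<lambda>n. norm (?d n *\<^sub>R ?X n x))"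
      by (rule summable_comparison_test'[OF summable_mult2[OF summable_abs_sqrt_series, of "norm x"], of 0])
         (use nX in \<open>auto intro!: mult_left_mono\<close>)
    then show ?thesis by (rule norm_summable_imp_summable_on)
  qed
  have hsX: "(\<lambda>n. ?d n *\<^sub>R ?X n x) sums (\<Sum>\<^sub>\<infinity>n. ?d n *\<^sub>R ?X n x)" for x
    by (rule has_sum_imp_sums[OF has_sum_infsum[OF smX]])
  define R where "R x = (\<Sum>\<^sub>\<infinity>n. ?d n *\<^sub>R ?X n x)" for x
  have Rs: "(\<lambda>n. ?d n *\<^sub>R ?X n x) sums R x" for x using hsX by (simp add: R_def)
  have blR: "bounded_clinear R"
  proof (rule bounded_clinearI)
    show "R (x + y) = R x + R y" for x y
      by (rule sums_unique2[OF Rs]) (use sums_add[OF Rs[of x] Rs[of y]] in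
         \<open>simp add: bounded_clinear_simps[OF blX] scaleR_add_right\<close>)
    show "R (cscale c x) = cscale c (R x)" for c x
      by (rule sums_unique2[OF Rs]) (use bounded_linear.sums[OF bounded_linear_cscale Rs[of x], of c] in
         \<open>simp add: bounded_clinear_simps[OF blX] cscale_scaleR\<close>)
    show "norm (R x) \<le> (\<Sum>n. \<bar>?d n\<bar>) * norm x" for x
    proof -
      have "norm (\<Sum>n. ?d n *\<^sub>R ?X n x) \<le> (\<Sum>n. \<bar>?d n\<bar> * norm x)"
        by (rule norm_suminf_le[OF nd]) (intro summable_mult2 summable_abs_sqrt_series)
      then show ?thesis using suminf_mult2[OF summable_abs_sqrt_series, of "norm x"] Rs[of x]
        by (simp add: sums_iff)
    qed
  qed
  have RR: "R (R x) = (1 / M) *\<^sub>R P x" for x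
  proof -
    let ?f = "\<lambda>(j, k). (?d j * ?d k) *\<^sub>R ?X (j + k) x"
    have D0: "0 \<le> (\<Sum>\<^sub>\<infinity>k. \<bar>?d k\<bar>)" by (rule infsum_nonneg) simp
    have "(\<lambda>(j, k). \<bar>?d j\<bar> * \<bar>?d k\<bar>) abs_summable_on UNIV \<times> UNIV"
    proof (rule abs_summable_on_Sigma_iff[THEN iffD2], intro conjI ballI)
      show "(\<lambda>k. (case (j, k) of (j, k) \<Rightarrow> \<bar>?d j\<bar> * \<bar>?d k\<bar>)) abs_summable_on UNIV" for j
        using summable_on_cmult_right[OF absd, of "\<bar>?d j\<bar>"] by (simp add: abs_mult)
      show "(\<lambda>j. \<Sum>\<^sub>\<infinity>k. norm (case (j, k) of (j, k) \<Rightarrow> \<bar>?d j\<bar> * \<bar>?d k\<bar>)) abs_summable_on UNIV"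
        using summable_on_cmult_left[OF absd, of "\<Sum>\<^sub>\<infinity>k. \<bar>?d k\<bar>"] D0
        by (simp add: abs_mult infsum_cmult_right')
    qed
    from summable_on_cmult_left[OF this, of "norm x"]
    have dd: "(\<lambda>p. norm (case p of (j, k) \<Rightarrow> \<bar>?d j\<bar> * \<bar>?d k\<bar>) * norm x) summable_on UNIV \<times> UNIV" .
    \<comment> \<open>Absolute summability over pairs permits both the iterated summation and the
      regrouping.\<close>
    have "?f abs_summable_on UNIV \<times> UNIV"
      by (rule abs_summable_on_comparison_test'[OF dd])
         (auto simp: nX abs_mult intro!: mult_left_mono)
    then have sf: "?f summable_on UNIV \<times> UNIV" by (rule abs_summable_summable)
    \<comment> \<open>Pairs (j, k) are regrouped by j + k, so that the coefficient of X^n becomes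
      the convolution computed above.\<close>
    have bij: "bij_betw (\<lambda>(n, k). (k, n - k)) (Sigma UNIV (\<lambda>n. {..n})) (UNIV \<times> (UNIV :: nat set))"
      by (rule bij_betwI[where g = "\<lambda>(j, k). (j + k, j)"]) auto
    have XR: "?X j (R x) = (\<Sum>\<^sub>\<infinity>k. ?d k *\<^sub>R ?X (j + k) x)" for j
    proof -
      have "(\<Sum>\<^sub>\<infinity>k. ?X j (?d k *\<^sub>R ?X k x)) = ?X j (R x)"
        unfolding R_def
        by (rule infsumI[OF has_sum_bounded_linear[OF bounded_clinear_bl[OF blX] has_sum_infsum[OF smX]]])
      then show ?thesis by (simp add: bounded_clinear_simps[OF blX] funpow_add)
    qed
    have "R (R x) = (\<Sum>\<^sub>\<infinity>j. ?d j *\<^sub>R ?X j (R x))" by (simp add: R_def)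
    also have "\<dots> = (\<Sum>\<^sub>\<infinity>j. \<Sum>\<^sub>\<infinity>k. ?f (j, k))"
      unfolding XR by (simp add: infsum_scaleR_right[symmetric])
    also have "\<dots> = infsum ?f (UNIV \<times> UNIV)"
      by (rule infsum_Sigma_banach[OF sf])
    also have "\<dots> = infsum (\<lambda>p. ?f ((\<lambda>(n, k). (k, n - k)) p)) (Sigma UNIV (\<lambda>n. {..n}))"
      by (rule infsum_reindex_bij_betw[OF bij, symmetric])
    also have "\<dots> = (\<Sum>\<^sub>\<infinity>n. \<Sum>\<^sub>\<infinity>k\<in>{..n}. ?f (k, n - k))"
    proof -
      have "(\<lambda>p. ?f ((\<lambda>(n, k). (k, n - k)) p)) summable_on (Sigma UNIV (\<lambda>n. {..n}))"
        using sf unfolding summable_on_reindex_bij_betw[OF bij] .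
      from infsum_Sigma_banach[OF this] show ?thesis by simp
    qed
    also have "\<dots> = (\<Sum>\<^sub>\<infinity>n. (if n = 0 then 1 else if n = 1 then - 1 else 0) *\<^sub>R ?X n x)"
    proof (rule infsum_cong)
      fix n
      have "(\<Sum>\<^sub>\<infinity>k\<in>{..n}. ?f (k, n - k)) = (\<Sum>k\<le>n. (?d k * ?d (n - k)) *\<^sub>R ?X n x)"
        by (subst infsum_finite) (auto intro!: sum.cong)
      also have "\<dots> = (\<Sum>k\<le>n. ?d k * ?d (n - k)) *\<^sub>R ?X n x"
        by (simp add: scaleR_sum_left)
      finally show "(\<Sum>\<^sub>\<infinity>k\<in>{..n}. ?f (k, n - k)) = (if n = 0 then 1 else if n = 1 then - 1 else 0) *\<^sub>R ?X n x"
        unfolding sqrt_series_convolution .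
    qed
    also have "\<dots> = (\<Sum>\<^sub>\<infinity>n\<in>{0,1}. (if n = 0 then 1 else if n = 1 then - 1 else 0) *\<^sub>R ?X n x)"
      by (rule infsum_cong_neutral) auto
    also have "\<dots> = x - X x" by (subst infsum_finite) auto
    finally show ?thesis by (simp add: X_def)
  qed
  have Xq: "cinner x (?X n x) = of_real (Re (cinner x (?X n x)))" for n x
  proof -
    have saX: "cinner (X y) z = cinner y (X z)" for y z
      by (simp add: X_def cinner_diff_left cinner_diff_right positive_op_selfadj[OF P])
    have "cinner (?X n y) z = cinner y (?X n z)" for y z
      by (induction n arbitrary: y z) (simp_all add: saX funpow_swap1)
    from this[of x x] have "cnj (cinner x (?X n x)) = cinner x (?X n x)" by (simp add: cinner_cnj)
    then show ?thesis by (simp add: complex_eq_iff)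
  qed
  have Rq: "cinner x (R x) \<in> \<real>\<^sub>\<ge>\<^sub>0" for x
  proof -
    have s: "(\<lambda>n. of_real (?d n * Re (cinner x (?X n x)))) sums cinner x (R x)"
      using bounded_linear.sums[OF bounded_linear_cinner_right Rs[of x], of x]
      by (simp add: Xq[symmetric])
    have re: "(\<lambda>n. ?d n * Re (cinner x (?X n x))) sums Re (cinner x (R x))"
      using sums_Re[OF s] by simp
    have im: "Im (cinner x (R x)) = 0"
      using sums_Im[OF s] by (simp add: sums_iff)
    \<comment> \<open>Positivity of R: the constant term contributes |x|^2 and the others subtract
      at most \<open>sqrt_coeff n\<close> times |x|^2, with coefficients of sum at most 1. This is
      the minorant series.\<close>
    have lo: "(\<lambda>n. ((if n = 0 then 1 else 0) - sqrt_coeff n) * (norm x)\<^sup>2) sums ((1 - suminf sqrt_coeff) * (norm x)\<^sup>2)"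
      by (intro sums_mult2 sums_diff summable_sums[OF summable_sqrt_coeff]) (use sums_single[of 0 "\<lambda>_. 1::real"] in simp)
    have le: "((if n = 0 then 1 else 0) - sqrt_coeff n) * (norm x)\<^sup>2 \<le> ?d n * Re (cinner x (?X n x))" for n
    proof (cases "n = 0")
      case True then show ?thesis by (simp add: sqrt_series_def cinner_self sqrt_coeff.simps[of 0])
    next
      case False
      have "Re (cinner x (?X n x)) \<le> norm x * norm (?X n x)"
        using complex_Re_le_cmod order_trans cinner_cauchy_schwarz by blast
      also have "\<dots> \<le> norm x * norm x" by (intro mult_left_mono nX) auto
      finally show ?thesis using False sqrt_coeff_nonneg[of n]
        by (simp add: sqrt_series_def power2_eq_square mult_left_mono)
    qed
    have "(1 - suminf sqrt_coeff) * (norm x)\<^sup>2 \<le> Re (cinner x (R x))"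
      by (rule sums_le[OF le lo re])
    moreover have "0 \<le> (1 - suminf sqrt_coeff) * (norm x)\<^sup>2"
      using suminf_sqrt_coeff_le by (intro mult_nonneg_nonneg) auto
    ultimately have "0 \<le> Re (cinner x (R x))" by linarith
    then show ?thesis using im by (simp add: complex_nonneg_Reals_iff)
  qed
  let ?R = "\<lambda>x. cscale (of_real (sqrt M)) (R x)"
  have "positive_op ?R"
    unfolding positive_op_def
    using Rq bounded_clinear_cscale[OF blR] M(1) by (auto simp: complex_nonneg_Reals_iff)
  moreover have "?R (?R x) = P x" for x
    unfolding bounded_clinear_simps[OF blR] RR using M(1)
    by (simp add: cscale_of_real[symmetric] del: of_real_divide) (simp add: cscale_of_real of_real_mult[symmetric] del: of_real_mult)
  ultimately show ?thesis by (rule that)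
qed

section \<open>Shifts of positive operators and polar decomposition\<close>

lemma positive_shift_norm:
  assumes P: "positive_op P" and "\<epsilon> > 0"
  shows "norm (P z) \<le> norm (P z + \<epsilon> *\<^sub>R z)" "\<epsilon> * norm z \<le> norm (P z + \<epsilon> *\<^sub>R z)"
proof -
  \<comment> \<open>The cross term 2 \<epsilon> <z, P z> is nonnegative, so either square alone is a
    lower bound.\<close>
  have "(norm (P z + \<epsilon> *\<^sub>R z))\<^sup>2 = (norm (P z))\<^sup>2 + 2 * \<epsilon> * Re (cinner z (P z)) + (\<epsilon> * norm z)\<^sup>2"
    using norm_diff_scale_sq[of "P z" "- \<epsilon>" z] positive_op_selfadj[OF P, of z z]
    by (simp add: power_mult_distrib)
  moreover have "0 \<le> 2 * \<epsilon> * Re (cinner z (P z))"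
    using positive_op_ge[OF P, of z] \<open>\<epsilon> > 0\<close> by simp
  ultimately have "(norm (P z))\<^sup>2 \<le> (norm (P z + \<epsilon> *\<^sub>R z))\<^sup>2" "(\<epsilon> * norm z)\<^sup>2 \<le> (norm (P z + \<epsilon> *\<^sub>R z))\<^sup>2"
    using zero_le_power2[of "norm (P z)"] zero_le_power2[of "\<epsilon> * norm z"] by linarith+
  then show "norm (P z) \<le> norm (P z + \<epsilon> *\<^sub>R z)" "\<epsilon> * norm z \<le> norm (P z + \<epsilon> *\<^sub>R z)"
    by (auto intro: power2_le_imp_le)
qed

lemma positive_shift_surj:
  assumes P: "positive_op P" and e: "\<epsilon> > 0"
  shows "\<exists>z. P z + \<epsilon> *\<^sub>R z = y"
proof -
  have bl: "bounded_clinear P" using P by (rule positive_op_bounded)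
  obtain M where M: "M > 0" "\<And>x. norm (P x) \<le> M * norm x" by (rule bounded_clinear_bound[OF bl]) blast
  \<comment> \<open>With this step size the iteration has linear part c M (1 - P/M), hence Lipschitz
    constant M / (M + \<epsilon>) < 1.\<close>
  define c where "c = 1 / (M + \<epsilon>)"
  define g where "g x = x - c *\<^sub>R (P x + \<epsilon> *\<^sub>R x - y)" for x
  have pos: "M + \<epsilon> > 0" using M(1) e by simp
  have ce: "1 - c * \<epsilon> = c * M" using pos by (simp add: c_def field_simps)
  have "\<exists>!x. g x = x"
  proof (rule banach_fix_type[of "c * M"])
    show "0 \<le> c * M" "c * M < 1" using M(1) e pos by (auto simp: c_def field_simps)
    show "\<forall>x y. dist (g x) (g y) \<le> c * M * dist x y"
    proof (intro allI)
      fix x x' :: ell2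
      let ?z = "x - x'"
      have "g x - g x' = (1 - c * \<epsilon>) *\<^sub>R ?z - c *\<^sub>R P ?z"
        by (simp add: g_def bounded_clinear_simps[OF bl] algebra_simps)
      also have "\<dots> = (c * M) *\<^sub>R (?z - (1 / M) *\<^sub>R P ?z)"
        using M(1) by (simp add: ce scaleR_diff_right)
      finally have "norm (g x - g x') = c * M * norm (?z - (1 / M) *\<^sub>R P ?z)"
        using M(1) pos by (simp add: c_def)
      also have "\<dots> \<le> c * M * norm ?z"
        using M(1) pos by (intro mult_left_mono norm_positive_shift[OF P M]) (auto simp: c_def)
      finally show "dist (g x) (g x') \<le> c * M * dist x x'" by (simp add: dist_norm)
    qed
  qed
  then obtain x where "g x = x" by blast
  then have "c *\<^sub>R (P x + \<epsilon> *\<^sub>R x - y) = 0" by (simp add: g_def)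
  then show ?thesis using pos by (auto simp: c_def)
qed

text \<open>An approximate polar decomposition \<open>T = U (\<bar>T\<bar> + \<epsilon>)\<close>, with
  \<open>U = T (\<bar>T\<bar> + \<epsilon>)\<^sup>-\<^sup>1\<close>.\<close>

lemma approximate_polar_decomposition:
  assumes T: "bounded_clinear T" and abs: "is_abs_op T P" and e: "\<epsilon> > 0"
  obtains U where "contraction U" "\<And>x. T x = U (P x + \<epsilon> *\<^sub>R x)"
    "\<And>x. Re (cinner x (P x)) - \<epsilon> * (norm x)\<^sup>2 \<le> Re (cinner (U x) (T x))"
proof -
  have P: "positive_op P" using abs by (simp add: is_abs_op_def)
  have bl: "bounded_clinear P" using P by (rule positive_op_bounded)
  obtain V where V: "\<And>y. P (V y) + \<epsilon> *\<^sub>R V y = y" using positive_shift_surj[OF P e] by metis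
  have inj: "x = x'" if "P x + \<epsilon> *\<^sub>R x = P x' + \<epsilon> *\<^sub>R x'" for x x'
  proof -
    have "P (x - x') + \<epsilon> *\<^sub>R (x - x') = 0"
      using that by (simp add: bounded_clinear_simps[OF bl] algebra_simps)
    then have "\<epsilon> * norm (x - x') \<le> 0" using positive_shift_norm(2)[OF P e, of "x - x'"] by simp
    then show ?thesis using e by (simp add: mult_le_0_iff)
  qed
  have TP: "cinner (T x) (T y) = cinner (P x) (P y)" for x y
    using abs by (simp add: is_abs_op_def positive_op_selfadj[OF P])
  have nTP: "norm (T x) = norm (P x)" for x
  proof -
    have "(norm (T x))\<^sup>2 = (norm (P x))\<^sup>2" using TP[of x x] unfolding cinner_self by (metis of_real_eq_iff)
    then show ?thesis by (simp add: power2_eq_iff_nonneg)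
  qed
  have V1: "V (P x + \<epsilon> *\<^sub>R x) = x" for x by (rule inj) (rule V)
  have Vadd: "V (x + y) = V x + V y" for x y
    by (rule inj) (use V[of "x + y"] V[of x] V[of y] in \<open>simp add: bounded_clinear_simps[OF bl] algebra_simps\<close>)
  have Vsc: "V (cscale c x) = cscale c (V x)" for c x
    by (rule inj, simp only: V)
       (simp add: bounded_clinear_simps[OF bl] cscale_scaleR[symmetric] cscale_add_right[symmetric] V)
  define U where "U x = T (V x)" for x
  have nU: "norm (U x) \<le> norm x" for x
    using positive_shift_norm(1)[OF P e, of "V x"] by (simp add: U_def nTP V)
  have "contraction U"
    unfolding contraction_def
    by (auto intro!: bounded_clinearI[of _ 1] simp: nU) (auto simp: U_def Vadd Vsc bounded_clinear_simps[OF T])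
  moreover have "T x = U (P x + \<epsilon> *\<^sub>R x)" for x by (simp add: U_def V1)
  moreover have "Re (cinner x (P x)) - \<epsilon> * (norm x)\<^sup>2 \<le> Re (cinner (U x) (T x))" for x
  proof -
    \<comment> \<open>Since P V = 1 - \<epsilon> V, replacing <P V x, P x> by <x, P x> costs
      \<epsilon> <V x, P x> = \<epsilon> <P V x, x>, whose real part is at most \<epsilon>
      |x|^2.\<close>
    have PV: "P (V x) = x - \<epsilon> *\<^sub>R V x" using V[of x] by (simp add: algebra_simps)
    have "cinner (U x) (T x) = cinner (P (V x)) (P x)" by (simp add: U_def TP)
    also have "\<dots> = cinner x (P x) - of_real \<epsilon> * cinner (V x) (P x)"
      unfolding PV by (simp add: cinner_diff_left)
    also have "cinner (V x) (P x) = cinner (P (V x)) x" by (simp add: positive_op_selfadj[OF P])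
    finally have eq: "Re (cinner (U x) (T x)) = Re (cinner x (P x)) - \<epsilon> * Re (cinner (P (V x)) x)" by simp
    have "Re (cinner (P (V x)) x) \<le> norm (P (V x)) * norm x"
      using complex_Re_le_cmod order_trans cinner_cauchy_schwarz by blast
    also have "\<dots> \<le> norm x * norm x"
      using positive_shift_norm(1)[OF P e, of "V x"] unfolding V by (intro mult_right_mono) auto
    finally show ?thesis unfolding eq using e by (simp add: power2_eq_square)
  qed
  ultimately show ?thesis by (rule that)
qed

text \<open>The trace norm of \<open>T\<close> is the least \<open>K\<close> with \<open>trace_bound T K\<close>. In contrast to
  the definition by \<open>\<bar>T\<bar>\<close>, this is visibly subadditive.\<close>

definition trace_bound :: "(ell2 \<Rightarrow> ell2) \<Rightarrow> real \<Rightarrow> bool" where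
  "trace_bound T K \<longleftrightarrow>
     (\<forall>N b. contraction b \<longrightarrow> (\<Sum>i<N. cmod (Rep_ell2 (T (b (ell2_basis i))) i)) \<le> K)"

text \<open>The squares |R C e_i|^2 are expanded into matrix entries and summed in the other order.
  For each j the entries are those of C' R e_j, with C' the adjoint of C, which is again a
  contraction.\<close>

lemma sum_hilbert_schmidt_le:
  assumes R: "positive_op R" and C: "contraction C"
    and s: "summable (\<lambda>j. (norm (R (ell2_basis j)))\<^sup>2)"
  shows "(\<Sum>i<N. (norm (R (C (ell2_basis i))))\<^sup>2) \<le> (\<Sum>j. (norm (R (ell2_basis j)))\<^sup>2)"
proof -
  have blC: "bounded_clinear C" using C by (simp add: contraction_def)
  let ?v = "\<lambda>j. adj C (R (ell2_basis j))"
  have "Rep_ell2 (R (C (ell2_basis i))) j = cnj (Rep_ell2 (?v j) i)" for i j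
    using cinner_basis_left[of j "R (C (ell2_basis i))"] cinner_adj_left[OF blC, of "R (ell2_basis j)" "ell2_basis i"]
    by (simp add: positive_op_selfadj[OF R, symmetric])
  then have "(\<lambda>j. (cmod (Rep_ell2 (?v j) i))\<^sup>2) sums (norm (R (C (ell2_basis i))))\<^sup>2" for i
    using norm_ell2_sums[of "R (C (ell2_basis i))"] by simp
  then have 1: "(\<lambda>j. \<Sum>i<N. (cmod (Rep_ell2 (?v j) i))\<^sup>2) sums (\<Sum>i<N. (norm (R (C (ell2_basis i))))\<^sup>2)"
    by (intro sums_sum)
  show ?thesis
  proof (rule sums_le[OF _ 1 summable_sums[OF s]])
    fix j
    have "(\<Sum>i<N. (cmod (Rep_ell2 (?v j) i))\<^sup>2) \<le> (norm (?v j))\<^sup>2" by (rule sum_Rep_le) simp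
    also have "\<dots> \<le> (norm (R (ell2_basis j)))\<^sup>2"
      using contraction_adj[OF C] by (auto simp: contraction_def intro: power_mono)
    finally show "(\<Sum>i<N. (cmod (Rep_ell2 (?v j) i))\<^sup>2) \<le> (norm (R (ell2_basis j)))\<^sup>2" .
  qed
qed

text \<open>With |T| = R R and T = U (|T| + \<epsilon>), the i-th diagonal entry of T b is <R U'
  e_i, R b e_i> up to \<epsilon>, where U' is the adjoint of U. Both Hilbert-Schmidt sums are at
  most K, the trace of |T|.\<close>

lemma trace_class_imp_trace_bound:
  assumes "trace_class T"
  shows "\<exists>K. trace_bound T K"
proof -
  from assms obtain P where T: "bounded_clinear T" and abs: "is_abs_op T P"
    and sm: "summable (\<lambda>n. cinner (ell2_basis n) (P (ell2_basis n)))"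
    by (auto simp: trace_class_def)
  have P: "positive_op P" using abs by (simp add: is_abs_op_def)
  obtain R where R: "positive_op R" and RR: "\<And>x. R (R x) = P x"
    using positive_sqrt_exists[OF P] by blast
  have Rq: "cinner x (P y) = cinner (R x) (R y)" for x y
    by (simp add: RR[symmetric] positive_op_selfadj[OF R])
  have s: "summable (\<lambda>j. (norm (R (ell2_basis j)))\<^sup>2)"
    using summable_Re[OF sm] unfolding Rq by (simp add: cinner_self)
  define K where "K = (\<Sum>j. (norm (R (ell2_basis j)))\<^sup>2)"
  have "(\<Sum>i<N. cmod (Rep_ell2 (T (b (ell2_basis i))) i)) \<le> K" if b: "contraction b" for N b
  proof (rule field_le_epsilon)
    fix e :: real assume e: "e > 0"
    \<comment> \<open>The error \<epsilon> occurs once for each of the N diagonal entries.\<close>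
    define \<epsilon> where "\<epsilon> = e / (real N + 1)"
    have e': "\<epsilon> > 0" using e by (simp add: \<epsilon>_def)
    obtain U where U: "contraction U" "\<And>x. T x = U (P x + \<epsilon> *\<^sub>R x)"
      by (rule approximate_polar_decomposition[OF T abs e']) blast
    have blU: "bounded_clinear U" using U(1) by (simp add: contraction_def)
    let ?a = "\<lambda>i. R (adj U (ell2_basis i))" and ?b = "\<lambda>i. R (b (ell2_basis i))"
    have "cmod (Rep_ell2 (T (b (ell2_basis i))) i) \<le> ((norm (?a i))\<^sup>2 + (norm (?b i))\<^sup>2) / 2 + \<epsilon>" for i
    proof -
      have "Rep_ell2 (T (b (ell2_basis i))) i = cinner (?a i) (?b i) + of_real \<epsilon> * cinner (ell2_basis i) (U (b (ell2_basis i)))"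
        unfolding U(2) bounded_clinear_simps[OF blU]
        by (simp add: Rq[symmetric] cinner_adj_left[OF blU])
      also have "cmod \<dots> \<le> norm (?a i) * norm (?b i) + \<epsilon> * (norm (ell2_basis i) * norm (U (b (ell2_basis i))))"
      proof (intro order_trans[OF norm_triangle_ineq] add_mono cinner_cauchy_schwarz)
        show "cmod (of_real \<epsilon> * cinner (ell2_basis i) (U (b (ell2_basis i))))
            \<le> \<epsilon> * (norm (ell2_basis i) * norm (U (b (ell2_basis i))))"
          unfolding norm_mult using e' by (intro mult_mono cinner_cauchy_schwarz) auto
      qed
      also have "\<dots> \<le> ((norm (?a i))\<^sup>2 + (norm (?b i))\<^sup>2) / 2 + \<epsilon> * 1"
      proof (intro add_mono mult_left_mono)
        show "norm (?a i) * norm (?b i) \<le> ((norm (?a i))\<^sup>2 + (norm (?b i))\<^sup>2) / 2"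
          using sum_squares_bound[of "norm (?a i)" "norm (?b i)"] by simp
        have "norm (U (b (ell2_basis i))) \<le> norm (ell2_basis i)"
          using U(1) b unfolding contraction_def by (meson order_trans)
        then show "norm (ell2_basis i) * norm (U (b (ell2_basis i))) \<le> 1" by simp
      qed (use e' in auto)
      finally show ?thesis by simp
    qed
    then have "(\<Sum>i<N. cmod (Rep_ell2 (T (b (ell2_basis i))) i)) \<le> (\<Sum>i<N. ((norm (?a i))\<^sup>2 + (norm (?b i))\<^sup>2) / 2 + \<epsilon>)"
      by (intro sum_mono)
    also have "\<dots> = ((\<Sum>i<N. (norm (?a i))\<^sup>2) + (\<Sum>i<N. (norm (?b i))\<^sup>2)) / 2 + real N * \<epsilon>"
      by (simp add: sum.distrib sum_divide_distrib[symmetric])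
    also have "\<dots> \<le> (K + K) / 2 + e"
    proof (intro add_mono divide_right_mono)
      show "(\<Sum>i<N. (norm (?a i))\<^sup>2) \<le> K" "(\<Sum>i<N. (norm (?b i))\<^sup>2) \<le> K"
        unfolding K_def by (intro sum_hilbert_schmidt_le R s contraction_adj U(1) b)+
      show "real N * \<epsilon> \<le> e" using e by (simp add: \<epsilon>_def field_simps)
    qed simp
    finally show "(\<Sum>i<N. cmod (Rep_ell2 (T (b (ell2_basis i))) i)) \<le> K + e" by simp
  qed
  then show ?thesis unfolding trace_bound_def by blast
qed

text \<open>|T| is the square root of T' T, with T' the adjoint. Its partial traces are compared
  with traces of T b for a contraction b made from the approximate polar decomposition.\<close>

lemma trace_bound_imp_trace_class:
  assumes T: "bounded_clinear T" and K: "trace_bound T K"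
  shows "trace_class T"
proof -
  have "positive_op (\<lambda>x. adj T (T x))"
    unfolding positive_op_def using bounded_clinear_comp[OF bounded_clinear_adj[OF T] T]
    by (simp add: cinner_adj_right[OF T] cinner_self complex_nonneg_Reals_iff)
  then obtain P where P: "positive_op P" and PP: "\<And>x. P (P x) = adj T (T x)"
    by (rule positive_sqrt_exists) blast
  have abs: "is_abs_op T P"
    unfolding is_abs_op_def by (simp add: P PP cinner_adj_right[OF T])
  let ?q = "\<lambda>j. Re (cinner (ell2_basis j) (P (ell2_basis j)))"
  have le: "(\<Sum>j<n. ?q j) \<le> K" for n
  proof (rule field_le_epsilon)
    fix e :: real assume e: "e > 0"
    define \<epsilon> where "\<epsilon> = e / (real n + 1)"
    have e': "\<epsilon> > 0" using e by (simp add: \<epsilon>_def)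
    obtain U where U: "contraction U"
        "\<And>x. Re (cinner x (P x)) - \<epsilon> * (norm x)\<^sup>2 \<le> Re (cinner (U x) (T x))"
      by (rule approximate_polar_decomposition[OF T abs e']) blast
    have blU: "bounded_clinear U" using U(1) by (simp add: contraction_def)
    let ?d = "\<lambda>k. if k < n then 1 else 0 :: complex"
    \<comment> \<open>The adjoint of U followed by the projection to the first n coordinates; the
      trace of T b is then the sum of <U e_j, T e_j> over j < n.\<close>
    let ?b = "\<lambda>x. diag_op ?d (adj U x)"
    have d: "cmod (?d k) \<le> 1" for k by simp
    have b: "contraction ?b"
      by (rule contraction_comp[OF contraction_diag_op[of ?d, OF d] contraction_adj[OF U(1)]])
    have be: "?b (ell2_basis i) = (\<Sum>j<n. cscale (cnj (Rep_ell2 (U (ell2_basis j)) i)) (ell2_basis j))" for i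
    proof (rule ell2_eqI)
      fix k
      have "Rep_ell2 (adj U (ell2_basis i)) k = cnj (Rep_ell2 (U (ell2_basis k)) i)"
        using cinner_adj_right[OF blU, of "ell2_basis k" "ell2_basis i"] by simp
      then show "Rep_ell2 (?b (ell2_basis i)) k =
          Rep_ell2 (\<Sum>j<n. cscale (cnj (Rep_ell2 (U (ell2_basis j)) i)) (ell2_basis j)) k"
        by (simp add: Rep_diag_op[OF d] if_distrib[of "\<lambda>c. _ * c"] cong: if_cong)
    qed
    have "(\<lambda>i. \<Sum>j<n. cnj (Rep_ell2 (U (ell2_basis j)) i) * Rep_ell2 (T (ell2_basis j)) i) sums
        (\<Sum>j<n. cinner (U (ell2_basis j)) (T (ell2_basis j)))"
      by (intro sums_sum cinner_sums)
    then have "(\<lambda>i. Rep_ell2 (T (?b (ell2_basis i))) i) sums (\<Sum>j<n. cinner (U (ell2_basis j)) (T (ell2_basis j)))"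
      unfolding be bounded_clinear_simps[OF T] by simp
    then have lim: "(\<lambda>N. cmod (\<Sum>i<N. Rep_ell2 (T (?b (ell2_basis i))) i)) \<longlonglongrightarrow>
        cmod (\<Sum>j<n. cinner (U (ell2_basis j)) (T (ell2_basis j)))"
      unfolding sums_def by (rule tendsto_norm)
    have "cmod (\<Sum>j<n. cinner (U (ell2_basis j)) (T (ell2_basis j))) \<le> K"
    proof (rule LIMSEQ_le_const2[OF lim], intro exI allI impI)
      fix N
      show "cmod (\<Sum>i<N. Rep_ell2 (T (?b (ell2_basis i))) i) \<le> K"
        using K[unfolded trace_bound_def, rule_format, OF b, of N] by (rule order_trans[OF norm_sum])
    qed
    then have "Re (\<Sum>j<n. cinner (U (ell2_basis j)) (T (ell2_basis j))) \<le> K"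
      using complex_Re_le_cmod order_trans by blast
    moreover have "(\<Sum>j<n. ?q j - \<epsilon>) \<le> (\<Sum>j<n. Re (cinner (U (ell2_basis j)) (T (ell2_basis j))))"
      using U(2)[of "ell2_basis _"] by (intro sum_mono) simp
    moreover have "real n * \<epsilon> \<le> e" using e by (simp add: \<epsilon>_def field_simps)
    ultimately show "(\<Sum>j<n. ?q j) \<le> K + e" by (simp add: sum_subtractf del: cinner_basis_left)
  qed
  have "summable ?q"
    by (rule summableI_nonneg_bounded[OF _ le]) (use positive_op_ge[OF P] in blast)
  then have "summable (\<lambda>j. complex_of_real (?q j))" by (rule summable_of_real)
  then have "summable (\<lambda>j. cinner (ell2_basis j) (P (ell2_basis j)))"
    by (simp only: positive_op_Re[OF P, symmetric])
  then show ?thesis using T abs unfolding trace_class_def by blast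
qed

lemma trace_class_iff: "trace_class T \<longleftrightarrow> bounded_clinear T \<and> (\<exists>K. trace_bound T K)"
  using trace_class_imp_trace_bound trace_bound_imp_trace_class trace_class_def by blast

section \<open>The trace functionals\<close>

lemma trace_class_bounded: "trace_class T \<Longrightarrow> bounded_clinear T"
  by (simp add: trace_class_def)

lemma trace_bound_nonneg: "trace_bound T K \<Longrightarrow> 0 \<le> K"
  unfolding trace_bound_def
  by (drule spec[of _ 0], drule spec[of _ "\<lambda>x. x"]) (simp add: contraction_def bounded_clinear_ident)

lemma trace_bound_add:
  assumes "trace_bound S K" "trace_bound T L"
  shows "trace_bound (\<lambda>x. S x + T x) (K + L)"
  unfolding trace_bound_def
proof (intro allI impI)
  fix N b assume b: "contraction b"
  have "(\<Sum>i<N. cmod (Rep_ell2 (S (b (ell2_basis i)) + T (b (ell2_basis i))) i)) \<le>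
     (\<Sum>i<N. cmod (Rep_ell2 (S (b (ell2_basis i))) i)) + (\<Sum>i<N. cmod (Rep_ell2 (T (b (ell2_basis i))) i))"
    unfolding sum.distrib[symmetric] by (intro sum_mono) (simp add: norm_triangle_ineq)
  also have "\<dots> \<le> K + L" using assms b by (intro add_mono) (auto simp: trace_bound_def)
  finally show "(\<Sum>i<N. cmod (Rep_ell2 (S (b (ell2_basis i)) + T (b (ell2_basis i))) i)) \<le> K + L" .
qed

lemma trace_bound_scale:
  assumes "trace_bound T K" shows "trace_bound (\<lambda>x. cscale c (T x)) (cmod c * K)"
  using assms by (auto simp: trace_bound_def norm_mult sum_distrib_left[symmetric] intro: mult_left_mono)

lemma trace_class_add: "trace_class S \<Longrightarrow> trace_class T \<Longrightarrow> trace_class (\<lambda>x. S x + T x)"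
  and trace_class_scale: "trace_class T \<Longrightarrow> trace_class (\<lambda>x. cscale c (T x))"
  and trace_class_zero: "trace_class (\<lambda>_. 0)"
  unfolding trace_class_iff
  using bounded_clinear_add bounded_clinear_cscale bounded_clinear_zero trace_bound_add trace_bound_scale
  by (blast, blast) (auto simp: trace_bound_def intro: bounded_clinear_zero)

lemma trace_class_butterfly_basis:
  "trace_class (butterfly (ell2_basis l) (ell2_basis k))"
proof -
  have "trace_bound (butterfly (ell2_basis l) (ell2_basis k)) 1"
    unfolding trace_bound_def
  proof (intro allI impI)
    fix N b assume b: "contraction b"
    have "(\<Sum>i<N. cmod (Rep_ell2 (butterfly (ell2_basis l) (ell2_basis k) (b (ell2_basis i))) i)) =
       (\<Sum>i<N. if i = l then cmod (Rep_ell2 (b (ell2_basis l)) k) else 0)"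
      by (intro sum.cong) (auto simp: butterfly_def)
    also have "\<dots> \<le> cmod (Rep_ell2 (b (ell2_basis l)) k)" by simp
    also have "\<dots> \<le> norm (b (ell2_basis l))" by (rule norm_Rep_le)
    also have "\<dots> \<le> 1" using b unfolding contraction_def by (metis norm_basis)
    finally show "(\<Sum>i<N. cmod (Rep_ell2 (butterfly (ell2_basis l) (ell2_basis k) (b (ell2_basis i))) i)) \<le> 1" .
  qed
  then show ?thesis using trace_class_iff bounded_clinear_butterfly by blast
qed

lemma bounded_clinear_contraction_multiple:
  assumes "bounded_clinear b"
  obtains L c where "L > 0" "contraction c" "\<And>x. b x = cscale (of_real L) (c x)"
proof -
  obtain L where L: "L > 0" "\<And>x. norm (b x) \<le> L * norm x" by (rule bounded_clinear_bound[OF assms]) blast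
  have "contraction (\<lambda>x. cscale (of_real (1 / L)) (b x))"
    unfolding contraction_def using L bounded_clinear_cscale[OF assms]
    by (auto simp: norm_divide field_simps)
  then show ?thesis using L(1) by (intro that[of L "\<lambda>x. cscale (of_real (1 / L)) (b x)"]) auto
qed

section \<open>The trace pairing of trace-class and bounded operators\<close>

definition trace_pairing :: "(ell2 \<Rightarrow> ell2) \<Rightarrow> (ell2 \<Rightarrow> ell2) \<Rightarrow> complex" where
  "trace_pairing T b = op_trace (T \<circ> b)"

text \<open>Absolute convergence follows from the trace bound once b is scaled to a contraction. The
  trace is thus a genuine sum and not a default value of \<open>suminf\<close>.\<close>

lemma trace_pairing_sums:
  assumes T: "trace_class T" and b: "bounded_clinear b"
  shows "(\<lambda>n. Rep_ell2 (T (b (ell2_basis n))) n) sums trace_pairing T b"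
proof -
  obtain K where K: "trace_bound T K" using T trace_class_iff by blast
  obtain L c where c: "L > 0" "contraction c" "\<And>x. b x = cscale (of_real L) (c x)"
    by (rule bounded_clinear_contraction_multiple[OF b]) blast
  have "summable (\<lambda>n. cmod (Rep_ell2 (T (c (ell2_basis n))) n))"
    by (rule summableI_nonneg_bounded[of _ K]) (use K c(2) in \<open>auto simp: trace_bound_def\<close>)
  then have "summable (\<lambda>n. Rep_ell2 (T (c (ell2_basis n))) n)" by (rule summable_norm_cancel)
  then have "summable (\<lambda>n. of_real L * Rep_ell2 (T (c (ell2_basis n))) n)" by (rule summable_mult)
  then have "summable (\<lambda>n. Rep_ell2 (T (b (ell2_basis n))) n)"
    by (simp add: c(3) bounded_clinear_simps[OF trace_class_bounded[OF T]])
  then show ?thesis by (simp add: trace_pairing_def op_trace_def summable_sums)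
qed

lemma trace_pairing_add_left:
  assumes "trace_class S" "trace_class T" "bounded_clinear b"
  shows "trace_pairing (\<lambda>x. S x + T x) b = trace_pairing S b + trace_pairing T b"
  by (rule sums_unique2[OF trace_pairing_sums[OF trace_class_add]])
     (use assms sums_add[OF trace_pairing_sums[of S b] trace_pairing_sums[of T b]] in auto)

lemma trace_pairing_scale_left:
  assumes "trace_class T" "bounded_clinear b"
  shows "trace_pairing (\<lambda>x. cscale c (T x)) b = c * trace_pairing T b"
  by (rule sums_unique2[OF trace_pairing_sums[OF trace_class_scale]])
     (use assms sums_mult[OF trace_pairing_sums[of T b], of c] in auto)

lemma trace_pairing_zero_left [simp]: "trace_pairing (\<lambda>_. 0) b = 0"
  by (simp add: trace_pairing_def op_trace_def)

lemma trace_pairing_add_right: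
  assumes T: "trace_class T" and "bounded_clinear a" "bounded_clinear b"
  shows "trace_pairing T (\<lambda>x. a x + b x) = trace_pairing T a + trace_pairing T b"
  by (rule sums_unique2[OF trace_pairing_sums[OF T bounded_clinear_add]])
     (use assms sums_add[OF trace_pairing_sums[of T a] trace_pairing_sums[of T b]] in
       \<open>auto simp: bounded_clinear_simps[OF trace_class_bounded[OF T]]\<close>)

lemma trace_pairing_scale_right:
  assumes T: "trace_class T" and "bounded_clinear b"
  shows "trace_pairing T (\<lambda>x. cscale c (b x)) = c * trace_pairing T b"
  by (rule sums_unique2[OF trace_pairing_sums[OF T bounded_clinear_cscale]])
     (use assms sums_mult[OF trace_pairing_sums[of T b], of c] in
       \<open>auto simp: bounded_clinear_simps[OF trace_class_bounded[OF T]]\<close>)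

lemma trace_pairing_sum_right:
  assumes T: "trace_class T" and "\<And>i. i \<in> A \<Longrightarrow> bounded_clinear (b i)"
  shows "trace_pairing T (\<lambda>x. \<Sum>i\<in>A. b i x) = (\<Sum>i\<in>A. trace_pairing T (b i))"
  using assms(2)
proof (induction A rule: infinite_finite_induct)
  case (insert a A)
  then show ?case
    using trace_pairing_add_right[OF T, of "b a" "\<lambda>x. \<Sum>i\<in>A. b i x"] bounded_clinear_sum[of A b] by simp
qed (use trace_pairing_scale_right[OF T bounded_clinear_zero, of 0] in simp_all)

lemma trace_pairing_le:
  assumes T: "trace_class T" and K: "trace_bound T K" and b: "contraction b"
  shows "cmod (trace_pairing T b) \<le> K"
proof -
  have "(\<lambda>N. cmod (\<Sum>n<N. Rep_ell2 (T (b (ell2_basis n))) n)) \<longlonglongrightarrow> cmod (trace_pairing T b)"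
    using trace_pairing_sums[OF T, of b] b unfolding sums_def contraction_def by (auto intro: tendsto_norm)
  then show ?thesis
  proof (rule LIMSEQ_le_const2, intro exI allI impI)
    fix N
    show "cmod (\<Sum>n<N. Rep_ell2 (T (b (ell2_basis n))) n) \<le> K"
      using K[unfolded trace_bound_def, rule_format, OF b, of N] by (rule order_trans[OF norm_sum])
  qed
qed

text \<open>Composing with a diagonal operator of phases on finitely many coordinates turns the sum of
  absolute values into the value of the functional.\<close>

lemma trace_boundI_pairing:
  assumes T: "trace_class T" and le: "\<And>b. contraction b \<Longrightarrow> cmod (trace_pairing T b) \<le> K"
  shows "trace_bound T K"
  unfolding trace_bound_def
proof (intro allI impI)
  fix N b assume b: "contraction b"
  have bl: "bounded_clinear b" using b by (simp add: contraction_def)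
  let ?z = "\<lambda>n. Rep_ell2 (T (b (ell2_basis n))) n"
  define d where "d n = (if n < N then cnj (sgn (?z n)) else 0)" for n
  have d: "cmod (d n) \<le> 1" for n by (simp add: d_def norm_sgn)
  have c: "contraction (\<lambda>x. b (diag_op d x))"
    by (rule contraction_comp[OF b contraction_diag_op[of d, OF d]])
  have "Rep_ell2 (T (b (diag_op d (ell2_basis n)))) n = d n * ?z n" for n
    by (simp add: diag_op_basis[OF d] bounded_clinear_simps[OF bl] bounded_clinear_simps[OF trace_class_bounded[OF T]])
  moreover have "d n * ?z n = (if n \<in> {..<N} then of_real (cmod (?z n)) else 0)" for n
    by (auto simp: d_def sgn_eq complex_norm_square[symmetric] power2_eq_square field_simps)
  ultimately have "(\<lambda>n. if n \<in> {..<N} then complex_of_real (cmod (?z n)) else 0) sums trace_pairing T (\<lambda>x. b (diag_op d x))"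
    using trace_pairing_sums[OF T, of "\<lambda>x. b (diag_op d x)"] c by (simp add: contraction_def)
  then have "trace_pairing T (\<lambda>x. b (diag_op d x)) = (\<Sum>n<N. complex_of_real (cmod (?z n)))"
    using sums_If_finite_set[of "{..<N}" "\<lambda>n. complex_of_real (cmod (?z n))"] sums_unique2 by blast
  also have "\<dots> = of_real (\<Sum>n<N. cmod (?z n))" by simp
  finally have "\<bar>\<Sum>n<N. cmod (?z n)\<bar> \<le> K" using le[OF c] by (metis norm_of_real)
  then show "(\<Sum>n<N. cmod (?z n)) \<le> K" by linarith
qed

text \<open>The test contraction is |x><u| with u a normalised multiple of T x: the diagonal entries
  of T b then have modulus |(T x)_i|^2 / (|T x| |x|) and sum to |T x| / |x|.\<close>

lemma trace_bound_norm:
  assumes T: "bounded_clinear T" and K: "trace_bound T K"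
  shows "norm (T x) \<le> K * norm x"
proof (cases "T x = 0 \<or> x = 0")
  case True then show ?thesis using trace_bound_nonneg[OF K] by (auto simp: bounded_clinear_simps[OF T])
next
  case False
  define u where "u = (1 / (norm (T x) * norm x)) *\<^sub>R T x"
  have nu: "norm u * norm x = 1" using False by (simp add: u_def)
  have b: "contraction (butterfly x u)"
    unfolding contraction_def using bounded_clinear_butterfly norm_butterfly[of x u] nu
    by (simp add: mult.commute[of "norm x"])
  have "(\<Sum>i<N. (cmod (Rep_ell2 (T x) i))\<^sup>2) / (norm (T x) * norm x) \<le> K" for N
  proof -
    have "(\<Sum>i<N. cmod (Rep_ell2 (T (butterfly x u (ell2_basis i))) i)) \<le> K"
      using K b unfolding trace_bound_def by blast
    moreover have "cmod (Rep_ell2 (T (butterfly x u (ell2_basis i))) i) =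
       (cmod (Rep_ell2 (T x) i))\<^sup>2 / (norm (T x) * norm x)" for i
      by (simp add: butterfly_def bounded_clinear_simps[OF T] u_def norm_mult norm_divide power2_eq_square)
    ultimately show ?thesis by (simp add: sum_divide_distrib)
  qed
  then have "(\<Sum>i<N. (cmod (Rep_ell2 (T x) i))\<^sup>2) \<le> K * norm x * norm (T x)" for N
    using False by (simp add: field_simps)
  then have "(norm (T x))\<^sup>2 \<le> K * norm x * norm (T x)"
    using suminf_le_const[OF ell2_summable[of "T x"]] norm_ell2_sums[of "T x"] by (simp add: sums_iff)
  then show ?thesis using False by (simp add: power2_eq_square)
qed

lemma trace_pairing_basis_right:
  assumes "trace_class T"
  shows "trace_pairing T (butterfly (ell2_basis i) (ell2_basis j)) = Rep_ell2 (T (ell2_basis i)) j"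
proof -
  have "(\<lambda>n. Rep_ell2 (T (butterfly (ell2_basis i) (ell2_basis j) (ell2_basis n))) n) =
        (\<lambda>n. if n = j then Rep_ell2 (T (ell2_basis i)) n else 0)"
    by (auto simp: butterfly_def bounded_clinear_simps[OF trace_class_bounded[OF assms]])
  then show ?thesis
    using trace_pairing_sums[OF assms bounded_clinear_butterfly, of "ell2_basis i" "ell2_basis j"]
      sums_single[of j "Rep_ell2 (T (ell2_basis i))"] sums_unique2 by fastforce
qed

lemma trace_pairing_basis_left:
  assumes "bounded_clinear b"
  shows "trace_pairing (butterfly (ell2_basis l) (ell2_basis k)) b = Rep_ell2 (b (ell2_basis l)) k"
proof -
  have "(\<lambda>n. Rep_ell2 (butterfly (ell2_basis l) (ell2_basis k) (b (ell2_basis n))) n) =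
        (\<lambda>n. if n = l then Rep_ell2 (b (ell2_basis n)) k else 0)"
    by (auto simp: butterfly_def)
  then show ?thesis
    using trace_pairing_sums[OF trace_class_butterfly_basis assms, of l k]
      sums_single[of l "\<lambda>n. Rep_ell2 (b (ell2_basis n)) k"] sums_unique2 by fastforce
qed

section \<open>Norms of arrays of scalars\<close>

text \<open>Matrix norms are handled through arrays over arbitrary finite index sets, so that no
  index arithmetic is needed for matrices of matrices.\<close>

definition arr_bound :: "'i set \<Rightarrow> 'j set \<Rightarrow> ('i \<Rightarrow> 'j \<Rightarrow> complex) \<Rightarrow> real \<Rightarrow> bool" where
  "arr_bound I J A K \<longleftrightarrow>
     (\<forall>\<xi>. L2_set (\<lambda>i. cmod (\<Sum>j\<in>J. A i j * \<xi> j)) I \<le> K * L2_set (\<lambda>j. cmod (\<xi> j)) J)"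

lemma arr_boundD: "arr_bound I J A K \<Longrightarrow> L2_set (\<lambda>i. cmod (\<Sum>j\<in>J. A i j * \<xi> j)) I \<le> K * L2_set (\<lambda>j. cmod (\<xi> j)) J"
  by (simp add: arr_bound_def)

lemma L2_set_le_iff_sq:
  "0 \<le> K \<Longrightarrow> L2_set f I \<le> K * L2_set g J \<longleftrightarrow> (\<Sum>i\<in>I. (f i)\<^sup>2) \<le> K\<^sup>2 * (\<Sum>j\<in>J. (g j)\<^sup>2)"
proof -
  assume "0 \<le> K"
  then have "K * L2_set g J = sqrt (K\<^sup>2 * (\<Sum>j\<in>J. (g j)\<^sup>2))"
    by (simp add: L2_set_def real_sqrt_mult)
  then show ?thesis by (simp add: L2_set_def)
qed

lemma arr_bound_sq:
  "0 \<le> K \<Longrightarrow> arr_bound I J A K \<longleftrightarrow>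
     (\<forall>\<xi>. (\<Sum>i\<in>I. (cmod (\<Sum>j\<in>J. A i j * \<xi> j))\<^sup>2) \<le> K\<^sup>2 * (\<Sum>j\<in>J. (cmod (\<xi> j))\<^sup>2))"
  by (simp add: arr_bound_def L2_set_le_iff_sq)

lemma arr_bound_cong:
  "(\<And>i j. i \<in> I \<Longrightarrow> j \<in> J \<Longrightarrow> A i j = B i j) \<Longrightarrow> arr_bound I J A K \<longleftrightarrow> arr_bound I J B K"
  unfolding arr_bound_def by (simp cong: L2_set_cong sum.cong)

lemma arr_bound_zero: "arr_bound I J (\<lambda>_ _. 0) 0"
  by (simp add: arr_bound_def L2_set_def)

lemma arr_bound_add:
  assumes "arr_bound I J A K" "arr_bound I J B L"
  shows "arr_bound I J (\<lambda>i j. A i j + B i j) (K + L)"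
  unfolding arr_bound_def
proof
  fix \<xi>
  have "L2_set (\<lambda>i. cmod (\<Sum>j\<in>J. (A i j + B i j) * \<xi> j)) I \<le>
      L2_set (\<lambda>i. cmod (\<Sum>j\<in>J. A i j * \<xi> j) + cmod (\<Sum>j\<in>J. B i j * \<xi> j)) I"
    by (intro L2_set_mono) (auto simp: distrib_right sum.distrib norm_triangle_ineq)
  also have "\<dots> \<le> L2_set (\<lambda>i. cmod (\<Sum>j\<in>J. A i j * \<xi> j)) I + L2_set (\<lambda>i. cmod (\<Sum>j\<in>J. B i j * \<xi> j)) I"
    by (rule L2_set_triangle_ineq)
  also have "\<dots> \<le> K * L2_set (\<lambda>j. cmod (\<xi> j)) J + L * L2_set (\<lambda>j. cmod (\<xi> j)) J"
    by (intro add_mono arr_boundD assms)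
  finally show "L2_set (\<lambda>i. cmod (\<Sum>j\<in>J. (A i j + B i j) * \<xi> j)) I \<le> (K + L) * L2_set (\<lambda>j. cmod (\<xi> j)) J"
    by (simp add: distrib_right)
qed

lemma arr_bound_scale:
  assumes "arr_bound I J A K" shows "arr_bound I J (\<lambda>i j. c * A i j) (cmod c * K)"
  using assms unfolding arr_bound_def
  by (simp add: mult.assoc sum_distrib_left[symmetric] norm_mult L2_set_right_distrib[symmetric] mult_left_mono)

lemma arr_bound_mult:
  assumes A: "arr_bound I J A K" and B: "arr_bound J L B M" and K: "0 \<le> K"
  shows "arr_bound I L (\<lambda>i l. \<Sum>j\<in>J. A i j * B j l) (K * M)"
  unfolding arr_bound_def
proof
  fix \<xi>
  have "(\<Sum>l\<in>L. (\<Sum>j\<in>J. A i j * B j l) * \<xi> l) = (\<Sum>j\<in>J. A i j * (\<Sum>l\<in>L. B j l * \<xi> l))" for i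
    unfolding sum_distrib_left sum_distrib_right by (subst sum.swap) (simp add: mult.assoc)
  then have "L2_set (\<lambda>i. cmod (\<Sum>l\<in>L. (\<Sum>j\<in>J. A i j * B j l) * \<xi> l)) I
      \<le> K * L2_set (\<lambda>j. cmod (\<Sum>l\<in>L. B j l * \<xi> l)) J"
    using arr_boundD[OF A] by simp
  also have "\<dots> \<le> K * (M * L2_set (\<lambda>j. cmod (\<xi> j)) L)"
    by (intro mult_left_mono arr_boundD B K)
  finally show "L2_set (\<lambda>i. cmod (\<Sum>l\<in>L. (\<Sum>j\<in>J. A i j * B j l) * \<xi> l)) I \<le> K * M * L2_set (\<lambda>j. cmod (\<xi> j)) L"
    by simp
qed

lemma arr_bound_entry:
  assumes A: "arr_bound I J A K" and "finite I" "finite J" "i \<in> I" "j \<in> J"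
  shows "cmod (A i j) \<le> K"
proof -
  have "cmod (A i j) \<le> L2_set (\<lambda>i. cmod (\<Sum>j'\<in>J. A i j' * (if j' = j then 1 else 0))) I"
    using member_le_L2_set[OF \<open>finite I\<close> \<open>i \<in> I\<close>, of "\<lambda>i. cmod (A i j)"] assms
    by (simp add: if_distrib[of "\<lambda>c. _ * c"] cong: if_cong)
  also have "\<dots> \<le> K * L2_set (\<lambda>j'. cmod (if j' = j then 1 else 0)) J" by (rule arr_boundD[OF A])
  also have "L2_set (\<lambda>j'. cmod (if j' = j then 1 else 0)) J = 1"
    using assms by (simp add: L2_set_def if_distrib[of cmod] if_distrib[of "\<lambda>c. c\<^sup>2"] cong: if_cong)
  finally show ?thesis by simp
qed

lemma cmod_sum_le_L2:
  "cmod (\<Sum>i\<in>I. f i * g i) \<le> L2_set (\<lambda>i. cmod (f i)) I * L2_set (\<lambda>i. cmod (g i)) I"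
proof -
  have "cmod (\<Sum>i\<in>I. f i * g i) \<le> (\<Sum>i\<in>I. \<bar>cmod (f i)\<bar> * \<bar>cmod (g i)\<bar>)"
    by (rule order_trans[OF norm_sum]) (simp add: norm_mult)
  also have "\<dots> \<le> L2_set (\<lambda>i. cmod (f i)) I * L2_set (\<lambda>i. cmod (g i)) I" by (rule L2_set_mult_ineq)
  finally show ?thesis .
qed

lemma arr_bound_form:
  assumes "arr_bound I J A K"
  shows "cmod (\<Sum>i\<in>I. \<Sum>j\<in>J. \<eta> i * A i j * \<xi> j) \<le> K * L2_set (\<lambda>i. cmod (\<eta> i)) I * L2_set (\<lambda>j. cmod (\<xi> j)) J"
proof -
  have "cmod (\<Sum>i\<in>I. \<Sum>j\<in>J. \<eta> i * A i j * \<xi> j) = cmod (\<Sum>i\<in>I. \<eta> i * (\<Sum>j\<in>J. A i j * \<xi> j))"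
    by (simp add: sum_distrib_left mult.assoc)
  also have "\<dots> \<le> L2_set (\<lambda>i. cmod (\<eta> i)) I * L2_set (\<lambda>i. cmod (\<Sum>j\<in>J. A i j * \<xi> j)) I"
    by (rule cmod_sum_le_L2)
  also have "\<dots> \<le> L2_set (\<lambda>i. cmod (\<eta> i)) I * (K * L2_set (\<lambda>j. cmod (\<xi> j)) J)"
    by (intro mult_left_mono arr_boundD assms L2_set_nonneg)
  finally show ?thesis by (simp add: ac_simps)
qed

text \<open>The form is tested at the conjugate of u = A \<xi>, where it equals |u|^2; one factor
  |u| cancels.\<close>

lemma arr_boundI_form:
  assumes le: "\<And>\<eta> \<xi>. cmod (\<Sum>i\<in>I. \<Sum>j\<in>J. \<eta> i * A i j * \<xi> j) \<le>
      K * L2_set (\<lambda>i. cmod (\<eta> i)) I * L2_set (\<lambda>j. cmod (\<xi> j)) J" and K: "0 \<le> K"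
  shows "arr_bound I J A K"
  unfolding arr_bound_def
proof
  fix \<xi>
  define u where "u i = (\<Sum>j\<in>J. A i j * \<xi> j)" for i
  let ?n = "L2_set (\<lambda>i. cmod (u i)) I"
  have "(\<Sum>i\<in>I. \<Sum>j\<in>J. cnj (u i) * A i j * \<xi> j) = of_real (\<Sum>i\<in>I. (cmod (u i))\<^sup>2)"
    unfolding of_real_sum complex_norm_square
  proof (rule sum.cong[OF refl])
    fix i
    have "(\<Sum>j\<in>J. cnj (u i) * A i j * \<xi> j) = cnj (u i) * (\<Sum>j\<in>J. A i j * \<xi> j)"
      by (simp add: sum_distrib_left mult.assoc)
    also have "\<dots> = cnj (u i) * u i" by (simp only: u_def)
    also have "\<dots> = u i * cnj (u i)" by (rule mult.commute)
    finally show "(\<Sum>j\<in>J. cnj (u i) * A i j * \<xi> j) = u i * cnj (u i)" .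
  qed
  also have "(\<Sum>i\<in>I. (cmod (u i))\<^sup>2) = ?n * ?n"
    by (simp add: L2_set_def sum_nonneg)
  finally have "cmod (of_real (?n * ?n)) \<le> K * L2_set (\<lambda>i. cmod (cnj (u i))) I * L2_set (\<lambda>j. cmod (\<xi> j)) J"
    using le[of "\<lambda>i. cnj (u i)" \<xi>] by (simp only:)
  then have "?n * ?n \<le> K * ?n * L2_set (\<lambda>j. cmod (\<xi> j)) J"
    by (simp only: norm_of_real complex_mod_cnj abs_mult_self_eq)
  then have "?n * ?n \<le> ?n * (K * L2_set (\<lambda>j. cmod (\<xi> j)) J)" by (simp add: ac_simps)
  then have "?n \<le> K * L2_set (\<lambda>j. cmod (\<xi> j)) J \<or> ?n = 0"
    using L2_set_nonneg[of "\<lambda>i. cmod (u i)" I] by (metis mult_le_cancel_left_pos order_le_less)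
  then show "?n \<le> K * L2_set (\<lambda>j. cmod (\<xi> j)) J"
    using mult_nonneg_nonneg[OF K L2_set_nonneg[of "\<lambda>j. cmod (\<xi> j)" J]] by auto
qed

lemma arr_bound_reindex:
  fixes J :: "'j set"
  assumes f: "bij_betw f I I'" and g: "bij_betw g J J'"
  shows "arr_bound I J (\<lambda>i j. A (f i) (g j)) K \<longleftrightarrow> arr_bound I' J' A K"
proof -
  have s: "(\<Sum>j\<in>J. A i (g j) * \<xi> (g j)) = (\<Sum>j\<in>J'. A i j * \<xi> j)" for i \<xi>
    using sum.reindex_bij_betw[OF g, of "\<lambda>j. A i j * \<xi> j"] .
  have l: "L2_set (\<lambda>i. h (f i)) I = L2_set h I'" for h :: "_ \<Rightarrow> real"
    using sum.reindex_bij_betw[OF f, of "\<lambda>i. (h i)\<^sup>2"] by (simp add: L2_set_def)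
  have l': "L2_set (\<lambda>i. h (g i)) J = L2_set h J'" for h :: "_ \<Rightarrow> real"
    using sum.reindex_bij_betw[OF g, of "\<lambda>i. (h i)\<^sup>2"] by (simp add: L2_set_def)
  have eq: "L2_set (\<lambda>i. cmod (\<Sum>j\<in>J. A (f i) (g j) * \<xi> (g j))) I = L2_set (\<lambda>i. cmod (\<Sum>j\<in>J'. A i j * \<xi> j)) I'" for \<xi>
    unfolding s by (rule l)
  show ?thesis
  proof
    assume L: "arr_bound I J (\<lambda>i j. A (f i) (g j)) K"
    show "arr_bound I' J' A K" unfolding arr_bound_def
    proof
      fix \<xi>
      show "L2_set (\<lambda>i. cmod (\<Sum>j\<in>J'. A i j * \<xi> j)) I' \<le> K * L2_set (\<lambda>j. cmod (\<xi> j)) J'"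
        using arr_boundD[OF L, of "\<lambda>j. \<xi> (g j)"] unfolding eq l'[of "\<lambda>j. cmod (\<xi> j)"] .
    qed
  next
    assume R: "arr_bound I' J' A K"
    show "arr_bound I J (\<lambda>i j. A (f i) (g j)) K" unfolding arr_bound_def
    proof
      fix \<xi> :: "'j \<Rightarrow> complex"
      let ?\<xi> = "\<lambda>j. \<xi> (inv_into J g j)"
      have inv: "?\<xi> (g j) = \<xi> j" if "j \<in> J" for j
        using g that by (simp add: bij_betw_def)
      have "L2_set (\<lambda>i. cmod (\<Sum>j\<in>J. A (f i) (g j) * ?\<xi> (g j))) I \<le> K * L2_set (\<lambda>j. cmod (?\<xi> (g j))) J"
        using arr_boundD[OF R, of ?\<xi>] unfolding eq[of ?\<xi>] l'[of "\<lambda>j. cmod (?\<xi> j)"] .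
      then show "L2_set (\<lambda>i. cmod (\<Sum>j\<in>J. A (f i) (g j) * \<xi> j)) I \<le> K * L2_set (\<lambda>j. cmod (\<xi> j)) J"
        by (simp add: inv cong: L2_set_cong sum.cong)
    qed
  qed
qed

text \<open>After squaring, both sides split into the contributions of the two blocks. To pass from
  the union to one block, a vector is extended by zero.\<close>

lemma arr_bound_block:
  fixes J1 J2 :: "'j set"
  assumes fin: "finite I1" "finite I2" "finite J1" "finite J2"
    and disj: "I1 \<inter> I2 = {}" "J1 \<inter> J2 = {}"
    and z12: "\<And>i j. i \<in> I1 \<Longrightarrow> j \<in> J2 \<Longrightarrow> A i j = 0" and z21: "\<And>i j. i \<in> I2 \<Longrightarrow> j \<in> J1 \<Longrightarrow> A i j = 0"
    and K: "0 \<le> K"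
  shows "arr_bound (I1 \<union> I2) (J1 \<union> J2) A K \<longleftrightarrow> arr_bound I1 J1 A K \<and> arr_bound I2 J2 A K"
proof -
  let ?S = "\<lambda>I J \<xi>. \<Sum>i\<in>I. (cmod (\<Sum>j\<in>J. A i j * \<xi> j))\<^sup>2" and ?N = "\<lambda>J \<xi>. \<Sum>j\<in>J. (cmod (\<xi> j))\<^sup>2"
  have S: "?S (I1 \<union> I2) (J1 \<union> J2) \<xi> = ?S I1 J1 \<xi> + ?S I2 J2 \<xi>" for \<xi>
  proof -
    have "(\<Sum>j\<in>J1 \<union> J2. A i j * \<xi> j) = (\<Sum>j\<in>J1. A i j * \<xi> j)" if "i \<in> I1" for i
      using that z12 by (simp add: sum.union_disjoint fin disj)
    moreover have "(\<Sum>j\<in>J1 \<union> J2. A i j * \<xi> j) = (\<Sum>j\<in>J2. A i j * \<xi> j)" if "i \<in> I2" for i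
      using that z21 by (simp add: sum.union_disjoint fin disj)
    ultimately show ?thesis by (simp add: sum.union_disjoint[of I1 I2] fin disj)
  qed
  have N: "?N (J1 \<union> J2) \<xi> = ?N J1 \<xi> + ?N J2 \<xi>" for \<xi> :: "'j \<Rightarrow> complex"
    by (simp add: sum.union_disjoint fin disj)
  show ?thesis
    unfolding arr_bound_sq[OF K] S N
  proof safe
    fix \<xi> :: "'j \<Rightarrow> complex"
    assume a: "\<forall>\<xi>. ?S I1 J1 \<xi> + ?S I2 J2 \<xi> \<le> K\<^sup>2 * (?N J1 \<xi> + ?N J2 \<xi>)"
    have z: "j \<in> J2 \<Longrightarrow> j \<notin> J1" for j using disj by auto
    have "?S I2 J2 (\<lambda>j. if j \<in> J1 then \<xi> j else 0) \<ge> 0" by (intro sum_nonneg) auto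
    with a[rule_format, of "\<lambda>j. if j \<in> J1 then \<xi> j else 0"]
    show "?S I1 J1 \<xi> \<le> K\<^sup>2 * ?N J1 \<xi>" using z by (simp cong: sum.cong)
  next
    fix \<xi> :: "'j \<Rightarrow> complex"
    assume a: "\<forall>\<xi>. ?S I1 J1 \<xi> + ?S I2 J2 \<xi> \<le> K\<^sup>2 * (?N J1 \<xi> + ?N J2 \<xi>)"
    have z: "j \<in> J1 \<Longrightarrow> j \<notin> J2" for j using disj by auto
    have "?S I1 J1 (\<lambda>j. if j \<in> J2 then \<xi> j else 0) \<ge> 0" by (intro sum_nonneg) auto
    with a[rule_format, of "\<lambda>j. if j \<in> J2 then \<xi> j else 0"]
    show "?S I2 J2 \<xi> \<le> K\<^sup>2 * ?N J2 \<xi>" using z by (simp cong: sum.cong)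
  next
    fix \<xi> :: "'j \<Rightarrow> complex"
    assume "\<forall>\<xi>. ?S I1 J1 \<xi> \<le> K\<^sup>2 * ?N J1 \<xi>" "\<forall>\<xi>. ?S I2 J2 \<xi> \<le> K\<^sup>2 * ?N J2 \<xi>"
    then show "?S I1 J1 \<xi> + ?S I2 J2 \<xi> \<le> K\<^sup>2 * (?N J1 \<xi> + ?N J2 \<xi>)"
      unfolding distrib_left by (intro add_mono) blast+
  qed
qed

text \<open>The array is the Kronecker product of the identity on R with A, and squared norms add
  over R.\<close>

lemma arr_bound_amplify:
  fixes R :: "'r set" and J :: "'j set"
  assumes A: "arr_bound I J A K" and K: "0 \<le> K" and fin: "finite R"
  shows "arr_bound (R \<times> I) (R \<times> J) (\<lambda>(a, i) (b, j). if a = b then A i j else 0) K"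
  unfolding arr_bound_sq[OF K]
proof
  fix \<xi> :: "'r \<times> 'j \<Rightarrow> complex"
  have "(\<Sum>(b, j)\<in>R \<times> J. (if a = b then A i j else 0) * \<xi> (b, j)) = (\<Sum>j\<in>J. A i j * \<xi> (a, j))" if "a \<in> R" for a i
    unfolding sum.cartesian_product[symmetric]
    using that fin by (simp add: if_distrib[of "\<lambda>c. c * _"] sum.delta' sum.swap[of _ J R] cong: if_cong)
  then have "(\<Sum>p\<in>R \<times> I. (cmod (\<Sum>q\<in>R \<times> J. (case p of (a, i) \<Rightarrow> \<lambda>(b, j). if a = b then A i j else 0) q * \<xi> q))\<^sup>2)
     = (\<Sum>a\<in>R. \<Sum>i\<in>I. (cmod (\<Sum>j\<in>J. A i j * \<xi> (a, j)))\<^sup>2)"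
    unfolding sum.cartesian_product by (intro sum.cong refl) (auto simp: case_prod_unfold)
  also have "\<dots> \<le> (\<Sum>a\<in>R. K\<^sup>2 * (\<Sum>j\<in>J. (cmod (\<xi> (a, j)))\<^sup>2))"
    by (intro sum_mono A[unfolded arr_bound_sq[OF K], rule_format])
  also have "\<dots> = K\<^sup>2 * (\<Sum>q\<in>R \<times> J. (cmod (\<xi> q))\<^sup>2)"
    by (simp add: sum_distrib_left sum.cartesian_product case_prod_unfold)
  finally show "(\<Sum>p\<in>R \<times> I. (cmod (\<Sum>q\<in>R \<times> J. (case p of (a, i) \<Rightarrow> \<lambda>(b, j). if a = b then A i j else 0) q * \<xi> q))\<^sup>2)
     \<le> K\<^sup>2 * (\<Sum>q\<in>R \<times> J. (cmod (\<xi> q))\<^sup>2)" .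
qed

section \<open>Operator norms of matrices\<close>

text \<open>A supremum of reals carries information only for a set that is bounded above. On the
  unit ball each coordinate has norm at most 1, so the sum of bounds for the entries serves.\<close>

lemma op_mat_norm_bdd:
  fixes a :: "('h::real_normed_vector \<Rightarrow> 'h) mat"
  assumes bl: "\<And>i j. i < dim_row a \<Longrightarrow> j < dim_col a \<Longrightarrow> bounded_linear (a $$ (i, j))"
  shows "bdd_above {L2_set (\<lambda>i. norm (\<Sum>j<dim_col a. (a $$ (i, j)) (\<xi> j))) {..<dim_row a} | \<xi>.
            L2_set (\<lambda>j. norm (\<xi> j)) {..<dim_col a} \<le> 1}"
proof -
  have "\<forall>i j. \<exists>K. i < dim_row a \<longrightarrow> j < dim_col a \<longrightarrow> (\<forall>x. norm ((a $$ (i, j)) x) \<le> norm x * K) \<and> 0 \<le> K"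
    using bounded_linear.nonneg_bounded[OF bl] by metis
  then obtain K where K: "\<And>i j x. i < dim_row a \<Longrightarrow> j < dim_col a \<Longrightarrow> norm ((a $$ (i, j)) x) \<le> norm x * K i j"
      "\<And>i j. i < dim_row a \<Longrightarrow> j < dim_col a \<Longrightarrow> 0 \<le> K i j" by metis
  show ?thesis
  proof (rule bdd_aboveI, clarify)
    fix \<xi> :: "nat \<Rightarrow> 'h" assume \<xi>: "L2_set (\<lambda>j. norm (\<xi> j)) {..<dim_col a} \<le> 1"
    have n1: "norm (\<xi> j) \<le> 1" if "j < dim_col a" for j
      using member_le_L2_set[of "{..<dim_col a}" j "\<lambda>j. norm (\<xi> j)"] \<xi> that by auto
    have "L2_set (\<lambda>i. norm (\<Sum>j<dim_col a. (a $$ (i, j)) (\<xi> j))) {..<dim_row a} \<le>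
       (\<Sum>i<dim_row a. norm (\<Sum>j<dim_col a. (a $$ (i, j)) (\<xi> j)))"
      by (rule L2_set_le_sum) auto
    also have "\<dots> \<le> (\<Sum>i<dim_row a. \<Sum>j<dim_col a. K i j)"
    proof (intro sum_mono order_trans[OF norm_sum])
      fix i j assume ij: "i \<in> {..<dim_row a}" "j \<in> {..<dim_col a}"
      then show "norm ((a $$ (i, j)) (\<xi> j)) \<le> K i j"
        using K(1)[of i j "\<xi> j"] mult_right_mono[OF n1 K(2), of j i j] by auto
    qed
    finally show "L2_set (\<lambda>i. norm (\<Sum>j<dim_col a. (a $$ (i, j)) (\<xi> j))) {..<dim_row a} \<le>
      (\<Sum>i<dim_row a. \<Sum>j<dim_col a. K i j)" .
  qed
qed

text \<open>Rescaling turns the supremum over the unit ball into a homogeneous bound. A vector of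
  norm zero vanishes in each relevant coordinate and is treated by linearity.\<close>

lemma op_mat_norm_le_iff:
  fixes a :: "('h::real_normed_vector \<Rightarrow> 'h) mat"
  assumes bl: "\<And>i j. i < dim_row a \<Longrightarrow> j < dim_col a \<Longrightarrow> bounded_linear (a $$ (i, j))" and K: "0 \<le> K"
  shows "op_mat_norm a \<le> K \<longleftrightarrow>
     (\<forall>\<xi>. L2_set (\<lambda>i. norm (\<Sum>j<dim_col a. (a $$ (i, j)) (\<xi> j))) {..<dim_row a} \<le>
        K * L2_set (\<lambda>j. norm (\<xi> j)) {..<dim_col a})" (is "_ \<longleftrightarrow> (\<forall>\<xi>. ?L \<xi> \<le> K * ?N \<xi>)")
proof
  assume le: "op_mat_norm a \<le> K"
  show "\<forall>\<xi>. ?L \<xi> \<le> K * ?N \<xi>"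
  proof
    fix \<xi> :: "nat \<Rightarrow> 'h"
    show "?L \<xi> \<le> K * ?N \<xi>"
    proof (cases "?N \<xi> = 0")
      case True
      then have "\<xi> j = 0" if "j < dim_col a" for j using that by (simp add: L2_set_eq_0_iff)
      then have "(a $$ (i, j)) (\<xi> j) = 0" if "i < dim_row a" "j < dim_col a" for i j
        using that linear_0[OF bounded_linear.linear[OF bl]] by simp
      then have "?L \<xi> = 0" by (simp add: L2_set_def)
      then show ?thesis using True by simp
    next
      case False
      then have N: "?N \<xi> > 0" using L2_set_nonneg order_le_less by (metis (no_types))
      let ?\<xi> = "\<lambda>j. inverse (?N \<xi>) *\<^sub>R \<xi> j"
      have 1: "?N ?\<xi> \<le> 1" using N by (simp add: L2_set_right_distrib[symmetric])
      have "?L ?\<xi> \<le> K"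
        using cSup_upper[OF _ op_mat_norm_bdd[OF bl], of "?L ?\<xi>"] 1 le unfolding op_mat_norm_def by fastforce
      also have "?L ?\<xi> = L2_set (\<lambda>i. inverse (?N \<xi>) * norm (\<Sum>j<dim_col a. (a $$ (i, j)) (\<xi> j))) {..<dim_row a}"
      proof (rule L2_set_cong[OF refl])
        fix i assume i: "i \<in> {..<dim_row a}"
        have "(\<Sum>j<dim_col a. (a $$ (i, j)) (?\<xi> j)) = inverse (?N \<xi>) *\<^sub>R (\<Sum>j<dim_col a. (a $$ (i, j)) (\<xi> j))"
          unfolding scaleR_sum_right using i linear_scale[OF bounded_linear.linear[OF bl]] by (intro sum.cong) auto
        then show "norm (\<Sum>j<dim_col a. (a $$ (i, j)) (?\<xi> j)) = inverse (?N \<xi>) * norm (\<Sum>j<dim_col a. (a $$ (i, j)) (\<xi> j))"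
          using N by simp
      qed
      also have "\<dots> = inverse (?N \<xi>) * ?L \<xi>" using N by (simp add: L2_set_right_distrib[symmetric])
      finally show ?thesis using N by (simp add: field_simps)
    qed
  qed
next
  assume le: "\<forall>\<xi>. ?L \<xi> \<le> K * ?N \<xi>"
  show "op_mat_norm a \<le> K"
    unfolding op_mat_norm_def
  proof (rule cSup_least)
    show "{?L \<xi> |\<xi>. ?N \<xi> \<le> 1} \<noteq> {}" by (auto intro!: exI[of _ "\<lambda>_. 0"] simp: L2_set_def)
    fix v assume "v \<in> {?L \<xi> |\<xi>. ?N \<xi> \<le> 1}"
    then obtain \<xi> where v: "v = ?L \<xi>" "?N \<xi> \<le> 1" by blast
    have "?L \<xi> \<le> K * ?N \<xi>" using le by blast
    also have "\<dots> \<le> K * 1" using v(2) K by (intro mult_left_mono)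
    finally show "v \<le> K" using v by simp
  qed
qed

lemma op_mat_norm_nonneg:
  assumes bl: "\<And>i j. i < dim_row a \<Longrightarrow> j < dim_col a \<Longrightarrow> bounded_linear (a $$ (i, j))"
  shows "0 \<le> op_mat_norm a"
  unfolding op_mat_norm_def
proof (rule cSup_upper2[OF _ _ op_mat_norm_bdd[OF bl]])
  show "L2_set (\<lambda>i. norm (\<Sum>j<dim_col a. (a $$ (i, j)) 0)) {..<dim_row a} \<in>
    {L2_set (\<lambda>i. norm (\<Sum>j<dim_col a. (a $$ (i, j)) (\<xi> j))) {..<dim_row a} | \<xi>.
            L2_set (\<lambda>j. norm (\<xi> j)) {..<dim_col a} \<le> 1}"
    by (rule CollectI, rule exI[of _ "\<lambda>_. 0"]) (simp add: L2_set_def)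
qed (auto simp: L2_set_nonneg)

lemma cmat_norm_le_iff:
  assumes "0 \<le> K"
  shows "cmat_norm \<alpha> \<le> K \<longleftrightarrow> arr_bound {..<dim_row \<alpha>} {..<dim_col \<alpha>} (\<lambda>i j. \<alpha> $$ (i, j)) K"
proof -
  have L: "L2_set (\<lambda>i. cmod (\<Sum>j<dim_col \<alpha>. (map_mat (*) \<alpha> $$ (i, j)) (\<xi> j))) {..<dim_row \<alpha>} =
      L2_set (\<lambda>i. cmod (\<Sum>j<dim_col \<alpha>. \<alpha> $$ (i, j) * \<xi> j)) {..<dim_row \<alpha>}" for \<xi>
    by (intro L2_set_cong refl arg_cong[of _ _ cmod] sum.cong) auto
  have "bounded_linear (map_mat (*) \<alpha> $$ (i, j))" if "i < dim_row (map_mat (*) \<alpha>)" "j < dim_col (map_mat (*) \<alpha>)" for i j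
    using that by (simp add: bounded_linear_mult_right)
  from op_mat_norm_le_iff[of "map_mat (*) \<alpha>" K, OF this assms] show ?thesis
    unfolding cmat_norm_def arr_bound_def by (simp only: L index_map_mat)
qed

lemma cmat_norm_nonneg: "0 \<le> cmat_norm \<alpha>"
  unfolding cmat_norm_def by (rule op_mat_norm_nonneg) (auto simp: bounded_linear_mult_right)

lemma bij_betw_flatten: "0 < n \<Longrightarrow> bij_betw (\<lambda>(a, k). a * n + k) ({..<r} \<times> {..<n}) {..<r * n :: nat}"
proof (rule bij_betwI[where g = "\<lambda>s. (s div n, s mod n)"])
  have "a * n + k < r * n" if "a < r" "k < n" for a k
  proof -
    have "a * n + k < Suc a * n" using that by simp
    also have "\<dots> \<le> r * n" using that by (intro mult_le_mono1) simp
    finally show ?thesis .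
  qed
  then show "(\<lambda>(a, k). a * n + k) \<in> {..<r} \<times> {..<n} \<rightarrow> {..<r * n}" by auto
qed (auto simp: less_mult_imp_div_less)

text \<open>Pairs (a, k) correspond to indices a n + k, so flattening is only a change of index
  set.\<close>

lemma cmat_norm_flatten_le_iff:
  assumes "0 \<le> K" "0 < n" "dim_row x = r" "dim_col x = r"
  shows "cmat_norm (flatten_mat n x) \<le> K \<longleftrightarrow>
     arr_bound ({..<r} \<times> {..<n}) ({..<r} \<times> {..<n}) (\<lambda>(a, k) (b, l). (x $$ (a, b)) $$ (k, l)) K"
proof -
  have f: "bij_betw (\<lambda>(a, k). a * n + k) ({..<r} \<times> {..<n}) {..<r * n}"
    by (rule bij_betw_flatten) fact
  have "cmat_norm (flatten_mat n x) \<le> K \<longleftrightarrow>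
     arr_bound {..<r * n} {..<r * n} (\<lambda>s t. (x $$ (s div n, t div n)) $$ (s mod n, t mod n)) K"
    unfolding cmat_norm_le_iff[OF assms(1)] flatten_mat_def dim_row_mat dim_col_mat assms(3,4)
    by (rule arr_bound_cong) simp
  also have "\<dots> \<longleftrightarrow> arr_bound ({..<r} \<times> {..<n}) ({..<r} \<times> {..<n})
     (\<lambda>p q. (x $$ ((case p of (a, k) \<Rightarrow> a * n + k) div n, (case q of (a, k) \<Rightarrow> a * n + k) div n)) $$
        ((case p of (a, k) \<Rightarrow> a * n + k) mod n, (case q of (a, k) \<Rightarrow> a * n + k) mod n)) K"
    by (rule arr_bound_reindex[OF f f, symmetric])
  also have "\<dots> \<longleftrightarrow> arr_bound ({..<r} \<times> {..<n}) ({..<r} \<times> {..<n}) (\<lambda>(a, k) (b, l). (x $$ (a, b)) $$ (k, l)) K"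
    by (rule arr_bound_cong) auto
  finally show ?thesis .
qed

section \<open>$T(\ell_2)$ is an operator space\<close>

lemma sum_pair: "(\<Sum>p\<in>A \<times> B. f p) = (\<Sum>a\<in>A. \<Sum>b\<in>B. f (a, b))"
  by (simp add: sum.cartesian_product)

lemma MatsD:
  assumes "x \<in> Mats n X"
  shows "x \<in> carrier_mat n n" "dim_row x = n" "dim_col x = n"
    "i < n \<Longrightarrow> j < n \<Longrightarrow> x $$ (i, j) \<in> carrier X"
  using assms unfolding Mats_def by blast+

lemma MatsI:
  assumes "dim_row x = n" "dim_col x = n" "\<And>i j. i < n \<Longrightarrow> j < n \<Longrightarrow> x $$ (i, j) \<in> carrier X"
  shows "x \<in> Mats n X"
  unfolding Mats_def using assms by (auto dest!: elements_matD)

lemma B_ell2_simps [simp]: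
  "carrier B_ell2 = {T. bounded_clinear T}" "mnorm B_ell2 = op_mat_norm"
  by (simp_all add: B_ell2_def)

lemma T_ell2_simps [simp]:
  "carrier T_ell2 = {T. trace_class T}" "zero T_ell2 = (\<lambda>_. 0)"
  "add T_ell2 = (\<lambda>S T x. S x + T x)" "module.smult T_ell2 = (\<lambda>c T x. cscale c (T x))"
  by (simp_all add: T_ell2_def)

section \<open>The vector space of trace-class operators\<close>

lemma vectorspace_T_ell2: "vectorspace class_ring T_ell2"
proof -
  have "abelian_group T_ell2"
  proof (rule abelian_groupI)
    fix S assume "S \<in> carrier T_ell2"
    then show "\<exists>T\<in>carrier T_ell2. T \<oplus>\<^bsub>T_ell2\<^esub> S = \<zero>\<^bsub>T_ell2\<^esub>"
      using trace_class_scale[of S "-1"]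
      by (intro bexI[of _ "\<lambda>x. cscale (-1) (S x)"]) (auto intro!: ext ell2_eqI)
  qed (auto simp: trace_class_add trace_class_zero add.assoc add.commute)
  moreover have "cring (class_ring :: complex ring)"
    using class_field unfolding field_def domain_def by blast
  ultimately have "module class_ring T_ell2"
    by (intro moduleI) (auto simp: trace_class_scale trace_class_add cscale_add_left cscale_add_right)
  then show ?thesis by (intro vectorspace.intro class_field)
qed

lemma T_ell2_minus:
  assumes "trace_class S" "trace_class T"
  shows "S \<ominus>\<^bsub>T_ell2\<^esub> T = (\<lambda>x. S x - T x)"
proof -
  interpret vectorspace class_ring T_ell2 by (rule vectorspace_T_ell2)
  have "\<ominus>\<^bsub>T_ell2\<^esub> T = (\<lambda>x. cscale (-1) (T x))"
    using assms(2) trace_class_scale[of T "-1"]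
    by (intro minus_equality) (auto intro!: ext ell2_eqI)
  then show ?thesis by (auto simp: a_minus_def intro!: ext ell2_eqI)
qed

lemma T_ell2_finsum:
  assumes "finite A" "\<And>a. a \<in> A \<Longrightarrow> trace_class (f a)"
  shows "finsum T_ell2 f A = (\<lambda>v. \<Sum>a\<in>A. f a v)"
proof -
  interpret vectorspace class_ring T_ell2 by (rule vectorspace_T_ell2)
  show ?thesis using assms
  proof (induction A)
    case (insert a A)
    then show ?case by (subst finsum_insert) auto
  qed simp
qed

lemma trace_class_sum:
  "(\<And>a. a \<in> A \<Longrightarrow> trace_class (f a)) \<Longrightarrow> trace_class (\<lambda>v. \<Sum>a\<in>A. f a v)"
  by (induction A rule: infinite_finite_induct) (auto intro: trace_class_add trace_class_zero)

lemma trace_pairing_sum_left: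
  "(\<And>a. a \<in> A \<Longrightarrow> trace_class (f a)) \<Longrightarrow> bounded_clinear b \<Longrightarrow>
    trace_pairing (\<lambda>v. \<Sum>a\<in>A. f a v) b = (\<Sum>a\<in>A. trace_pairing (f a) b)"
  by (induction A rule: infinite_finite_induct) (auto simp: trace_pairing_add_left trace_class_sum)

section \<open>The unit ball of matrices over B(l2)\<close>

lemma Mats_B_unit:
  assumes x: "x \<in> Mats r B_ell2" and le: "op_mat_norm x \<le> 1"
  shows "L2_set (\<lambda>a. norm (\<Sum>b<r. (x $$ (a, b)) (\<xi> b))) {..<r} \<le> L2_set (\<lambda>b. norm (\<xi> b)) {..<r}"
proof -
  have "bounded_linear (x $$ (a, b))" if "a < dim_row x" "b < dim_col x" for a b
    using that MatsD[OF x] bounded_clinear_bl by auto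
  from op_mat_norm_le_iff[of x 1, OF this] le show ?thesis by (simp add: MatsD[OF x])
qed

lemma Mats_B_unitI:
  assumes x: "x \<in> Mats r B_ell2"
    and le: "\<And>\<xi>. L2_set (\<lambda>a. norm (\<Sum>b<r. (x $$ (a, b)) (\<xi> b))) {..<r} \<le> L2_set (\<lambda>b. norm (\<xi> b)) {..<r}"
  shows "op_mat_norm x \<le> 1"
proof -
  have "bounded_linear (x $$ (a, b))" if "a < dim_row x" "b < dim_col x" for a b
    using that MatsD[OF x] bounded_clinear_bl by auto
  from op_mat_norm_le_iff[of x 1, OF this] le show ?thesis by (simp add: MatsD[OF x])
qed

lemma Mats_B_single:
  assumes "contraction b"
  shows "Matrix.mat 1 1 (\<lambda>_. b) \<in> Mats 1 B_ell2" "op_mat_norm (Matrix.mat 1 1 (\<lambda>_. b)) \<le> 1"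
proof -
  show *: "Matrix.mat 1 1 (\<lambda>_. b) \<in> Mats 1 B_ell2"
    using assms by (intro MatsI) (auto simp: contraction_def)
  show "op_mat_norm (Matrix.mat 1 1 (\<lambda>_. b)) \<le> 1"
    by (rule Mats_B_unitI[OF *]) (use assms in \<open>simp add: contraction_def L2_set_def lessThan_Suc\<close>)
qed

text \<open>The map from B(l2) to M_n with entries b |-> tr(t_kl b) has completely bounded norm at
  most K. The norm axioms are checked on this predicate, free of suprema, and transferred by
  \<open>mnorm_T_le_iff\<close>.\<close>

definition cb_bound :: "nat \<Rightarrow> (ell2 \<Rightarrow> ell2) mat \<Rightarrow> real \<Rightarrow> bool" where
  "cb_bound n t K \<longleftrightarrow> (\<forall>r>0. \<forall>x\<in>Mats r B_ell2. op_mat_norm x \<le> 1 \<longrightarrow>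
     arr_bound ({..<r} \<times> {..<n}) ({..<r} \<times> {..<n}) (\<lambda>(a, k) (b, l). trace_pairing (t $$ (k, l)) (x $$ (a, b))) K)"

lemma cb_boundD:
  "cb_bound n t K \<Longrightarrow> r > 0 \<Longrightarrow> x \<in> Mats r B_ell2 \<Longrightarrow> op_mat_norm x \<le> 1 \<Longrightarrow>
     arr_bound ({..<r} \<times> {..<n}) ({..<r} \<times> {..<n}) (\<lambda>(a, k) (b, l). trace_pairing (t $$ (k, l)) (x $$ (a, b))) K"
  by (simp add: cb_bound_def)

lemma cb_norm_le_iff:
  assumes "0 \<le> K"
  shows "cb_norm X Y u \<le> ennreal K \<longleftrightarrow>
    (\<forall>n>0. \<forall>x\<in>Mats n X. mnorm X x \<le> 1 \<longrightarrow> mnorm Y (map_mat u x) \<le> K)"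
  unfolding cb_norm_def amp_norm_def SUP_le_iff by (auto simp: ennreal_le_iff[OF assms])

lemma trace_pairing_le_mult:
  assumes T: "trace_class T" and K: "trace_bound T K" and c: "bounded_clinear c"
    and M: "\<And>v. norm (c v) \<le> M * norm v"
  shows "cmod (trace_pairing T c) \<le> K * M"
proof (cases "M = 0")
  case True
  then have "c = (\<lambda>_. 0)" using M by auto
  then show ?thesis using trace_pairing_scale_right[OF T bounded_clinear_zero, of 0] True by simp
next
  case False
  have "0 \<le> M" using order_trans[OF norm_ge_zero M[of "ell2_basis 0"]] by simp
  then have M0: "M > 0" using False by simp
  have d: "contraction (\<lambda>v. cscale (of_real (1 / M)) (c v))"
    unfolding contraction_def using M M0 bounded_clinear_cscale[OF c] by (auto simp: norm_divide field_simps)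
  have "cmod (of_real (1 / M) * trace_pairing T c) \<le> K"
    using trace_pairing_le[OF T K d] trace_pairing_scale_right[OF T c] by simp
  then show ?thesis using M0 by (simp add: norm_mult norm_divide field_simps)
qed

text \<open>A functional is completely bounded: the form \<open>\<eta>\<^sup>T [\<phi>(x\<^sub>a\<^sub>b)] \<xi>\<close> is \<open>\<phi>\<close>
  applied to a compression of \<open>x\<close>.\<close>

lemma trace_pairing_amplification:
  assumes T: "trace_class T" and K: "trace_bound T K" and x: "x \<in> Mats r B_ell2" and le: "op_mat_norm x \<le> 1"
  shows "cmod (\<Sum>a<r. \<Sum>b<r. \<eta> a * trace_pairing T (x $$ (a, b)) * \<xi> b) \<le>
    K * (L2_set (\<lambda>a. cmod (\<eta> a)) {..<r} * L2_set (\<lambda>b. cmod (\<xi> b)) {..<r})"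
proof -
  have bl: "bounded_clinear (x $$ (a, b))" if "a < r" "b < r" for a b using MatsD(4)[OF x that] by simp
  let ?c = "\<lambda>v. \<Sum>a<r. \<Sum>b<r. cscale (\<eta> a * \<xi> b) ((x $$ (a, b)) v)"
  have c: "bounded_clinear ?c" by (intro bounded_clinear_sum bounded_clinear_cscale bl) auto
  have "norm (?c v) \<le> (L2_set (\<lambda>a. cmod (\<eta> a)) {..<r} * L2_set (\<lambda>b. cmod (\<xi> b)) {..<r}) * norm v" for v
  proof -
    \<comment> \<open>The compression is the row \<eta> applied to the image under x of the vector
      \<xi> tensor v, so Cauchy-Schwarz in a leaves the norm of x, which is at most 1.\<close>
    let ?y = "\<lambda>a. \<Sum>b<r. (x $$ (a, b)) (cscale (\<xi> b) v)"
    have "?c v = (\<Sum>a<r. cscale (\<eta> a) (?y a))"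
      by (simp add: cscale_sum_right bounded_clinear_simps(7)[OF bl])
    then have "norm (?c v) \<le> (\<Sum>a<r. \<bar>cmod (\<eta> a)\<bar> * \<bar>norm (?y a)\<bar>)"
      by (simp only:) (rule order_trans[OF norm_sum], simp)
    also have "\<dots> \<le> L2_set (\<lambda>a. cmod (\<eta> a)) {..<r} * L2_set (\<lambda>a. norm (?y a)) {..<r}"
      by (rule L2_set_mult_ineq)
    also have "\<dots> \<le> L2_set (\<lambda>a. cmod (\<eta> a)) {..<r} * L2_set (\<lambda>b. norm (cscale (\<xi> b) v)) {..<r}"
      by (intro mult_left_mono Mats_B_unit[OF x le] L2_set_nonneg)
    also have "L2_set (\<lambda>b. norm (cscale (\<xi> b) v)) {..<r} = L2_set (\<lambda>b. cmod (\<xi> b)) {..<r} * norm v"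
      by (simp add: L2_set_left_distrib)
    finally show ?thesis by (simp only: mult.assoc)
  qed
  note le = trace_pairing_le_mult[OF T K c this]
  have "trace_pairing T ?c = (\<Sum>a<r. trace_pairing T (\<lambda>v. \<Sum>b<r. cscale (\<eta> a * \<xi> b) ((x $$ (a, b)) v)))"
    by (intro trace_pairing_sum_right[OF T] bounded_clinear_sum bounded_clinear_cscale bl) auto
  also have "\<dots> = (\<Sum>a<r. \<Sum>b<r. trace_pairing T (\<lambda>v. cscale (\<eta> a * \<xi> b) ((x $$ (a, b)) v)))"
    by (intro sum.cong refl trace_pairing_sum_right[OF T] bounded_clinear_cscale bl) auto
  also have "\<dots> = (\<Sum>a<r. \<Sum>b<r. \<eta> a * trace_pairing T (x $$ (a, b)) * \<xi> b)"
    by (intro sum.cong refl) (simp add: trace_pairing_scale_right[OF T bl])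
  finally show ?thesis using le by simp
qed

text \<open>\<open>dual_space\<close> converts its norm by \<open>enn2real\<close>, which sends
  infinity to 0, so finiteness must be known before this norm can be compared with a bound. The
  trace bounds of the entries add up to a finite one.\<close>

lemma cb_bound_exists:
  assumes t: "t \<in> Mats n T_ell2"
  shows "\<exists>K\<ge>0. cb_bound n t K"
proof -
  have tc: "trace_class (t $$ (k, l))" if "k < n" "l < n" for k l using MatsD(4)[OF t that] by simp
  then have "\<forall>k l. \<exists>K. k < n \<longrightarrow> l < n \<longrightarrow> trace_bound (t $$ (k, l)) K" using trace_class_iff by blast
  then obtain K where K: "\<And>k l. k < n \<Longrightarrow> l < n \<Longrightarrow> trace_bound (t $$ (k, l)) (K k l)" by metis
  let ?K = "\<Sum>k<n. \<Sum>l<n. K k l"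
  have K0: "0 \<le> K k l" if "k < n" "l < n" for k l using trace_bound_nonneg[OF K[OF that]] .
  have K0': "0 \<le> ?K" using K0 by (intro sum_nonneg) auto
  have "cb_bound n t ?K"
    unfolding cb_bound_def
  proof (intro allI impI ballI)
    fix r x assume r: "r > 0" and x: "x \<in> Mats r B_ell2" and le: "op_mat_norm x \<le> 1"
    show "arr_bound ({..<r} \<times> {..<n}) ({..<r} \<times> {..<n})
       (\<lambda>(a, k) (b, l). trace_pairing (t $$ (k, l)) (x $$ (a, b))) ?K"
    proof (rule arr_boundI_form[OF _ K0'])
      fix \<eta> \<xi> :: "nat \<times> nat \<Rightarrow> complex"
      let ?E = "L2_set (\<lambda>p. cmod (\<eta> p)) ({..<r} \<times> {..<n})" and ?X = "L2_set (\<lambda>p. cmod (\<xi> p)) ({..<r} \<times> {..<n})"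
      have sub: "L2_set (\<lambda>a. cmod (\<zeta> (a, k))) {..<r} \<le> L2_set (\<lambda>p. cmod (\<zeta> p)) ({..<r} \<times> {..<n})"
        if "k < n" for \<zeta> :: "nat \<times> nat \<Rightarrow> complex" and k
      proof -
        have "(\<Sum>a<r. (cmod (\<zeta> (a, k)))\<^sup>2) = (\<Sum>p\<in>(\<lambda>a. (a, k)) ` {..<r}. (cmod (\<zeta> p))\<^sup>2)"
          by (subst sum.reindex) (auto simp: inj_on_def)
        also have "\<dots> \<le> (\<Sum>p\<in>{..<r} \<times> {..<n}. (cmod (\<zeta> p))\<^sup>2)"
          using that by (intro sum_mono2) auto
        finally show ?thesis by (simp add: L2_set_def)
      qed
      have "(\<Sum>p\<in>{..<r} \<times> {..<n}. \<Sum>q\<in>{..<r} \<times> {..<n}. \<eta> p *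
         (case p of (a, k) \<Rightarrow> \<lambda>(b, l). trace_pairing (t $$ (k, l)) (x $$ (a, b))) q * \<xi> q) =
         (\<Sum>a<r. \<Sum>k<n. \<Sum>b<r. \<Sum>l<n. \<eta> (a, k) * trace_pairing (t $$ (k, l)) (x $$ (a, b)) * \<xi> (b, l))"
        by (simp add: sum_pair)
      also have "\<dots> = (\<Sum>k<n. \<Sum>l<n. \<Sum>a<r. \<Sum>b<r. \<eta> (a, k) * trace_pairing (t $$ (k, l)) (x $$ (a, b)) * \<xi> (b, l))"
        by (subst sum.swap, rule sum.cong[OF refl], subst (2) sum.swap, subst sum.swap) (rule refl)
      finally have eq: "(\<Sum>p\<in>{..<r} \<times> {..<n}. \<Sum>q\<in>{..<r} \<times> {..<n}. \<eta> p *
         (case p of (a, k) \<Rightarrow> \<lambda>(b, l). trace_pairing (t $$ (k, l)) (x $$ (a, b))) q * \<xi> q) = \<dots>" .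
      have "cmod (\<Sum>k<n. \<Sum>l<n. \<Sum>a<r. \<Sum>b<r. \<eta> (a, k) * trace_pairing (t $$ (k, l)) (x $$ (a, b)) * \<xi> (b, l))
         \<le> (\<Sum>k<n. \<Sum>l<n. K k l * (?E * ?X))"
      proof (rule order_trans[OF norm_sum], rule sum_mono, rule order_trans[OF norm_sum], rule sum_mono)
        fix k l assume kl: "k \<in> {..<n}" "l \<in> {..<n}"
        have "cmod (\<Sum>a<r. \<Sum>b<r. \<eta> (a, k) * trace_pairing (t $$ (k, l)) (x $$ (a, b)) * \<xi> (b, l))
          \<le> K k l * (L2_set (\<lambda>a. cmod (\<eta> (a, k))) {..<r} * L2_set (\<lambda>b. cmod (\<xi> (b, l))) {..<r})"
          using trace_pairing_amplification[OF tc K x le, of k l "\<lambda>a. \<eta> (a, k)" "\<lambda>b. \<xi> (b, l)"] kl by simp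
        also have "\<dots> \<le> K k l * (?E * ?X)"
          using kl K0 by (intro mult_left_mono mult_mono sub L2_set_nonneg) auto
        finally show "cmod (\<Sum>a<r. \<Sum>b<r. \<eta> (a, k) * trace_pairing (t $$ (k, l)) (x $$ (a, b)) * \<xi> (b, l)) \<le> K k l * (?E * ?X)" .
      qed
      also have "\<dots> = ?K * ?E * ?X" by (simp add: sum_distrib_right mult.assoc)
      finally show "cmod (\<Sum>p\<in>{..<r} \<times> {..<n}. \<Sum>q\<in>{..<r} \<times> {..<n}. \<eta> p *
         (case p of (a, k) \<Rightarrow> \<lambda>(b, l). trace_pairing (t $$ (k, l)) (x $$ (a, b))) q * \<xi> q) \<le> ?K * ?E * ?X"
        by (simp only: eq)
    qed
  qed
  then show ?thesis using K0' by blast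
qed

text \<open>The dual norm is unfolded at normal functionals; as it is finite,
  \<open>enn2real\<close> loses nothing.\<close>

lemma mnorm_T_le_iff:
  assumes n: "n > 0" and t: "t \<in> Mats n T_ell2" and K: "0 \<le> K"
  shows "mnorm T_ell2 t \<le> K \<longleftrightarrow> cb_bound n t K"
proof -
  let ?u = "\<lambda>b. map_mat (\<lambda>f. f b) (map_mat normal_functional t)"
  let ?c = "cb_norm B_ell2 (matrix_space n) ?u"
  have iff: "?c \<le> ennreal K \<longleftrightarrow> cb_bound n t K" if "0 \<le> K" for K
  proof -
    have "mnorm (matrix_space n) (map_mat ?u x) \<le> K \<longleftrightarrow>
       arr_bound ({..<r} \<times> {..<n}) ({..<r} \<times> {..<n}) (\<lambda>(a, k) (b, l). trace_pairing (t $$ (k, l)) (x $$ (a, b))) K"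
      if x: "x \<in> Mats r B_ell2" for r x
    proof -
      have "mnorm (matrix_space n) (map_mat ?u x) \<le> K \<longleftrightarrow>
         arr_bound ({..<r} \<times> {..<n}) ({..<r} \<times> {..<n}) (\<lambda>(a, k) (b, l). (map_mat ?u x $$ (a, b)) $$ (k, l)) K"
        using cmat_norm_flatten_le_iff[OF \<open>0 \<le> K\<close> n, of "map_mat ?u x" r] MatsD[OF x]
        by (simp add: matrix_space_def)
      also have "\<dots> \<longleftrightarrow> arr_bound ({..<r} \<times> {..<n}) ({..<r} \<times> {..<n})
          (\<lambda>(a, k) (b, l). trace_pairing (t $$ (k, l)) (x $$ (a, b))) K"
        using MatsD[OF x] MatsD[OF t]
        by (intro arr_bound_cong) (auto simp: normal_functional_def trace_pairing_def)
      finally show ?thesis .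
    qed
    then show ?thesis
      unfolding cb_norm_le_iff[OF that] cb_bound_def by auto
  qed
  obtain K0 where "0 \<le> K0" "cb_bound n t K0" using cb_bound_exists[OF t] by blast
  then have "?c \<le> ennreal K0" using iff by blast
  then have "?c < (Orderings.top :: ennreal)" using ennreal_less_top order_le_less_trans by blast
  then have c: "ennreal (enn2real ?c) = ?c" by simp
  have "mnorm T_ell2 t = enn2real ?c"
    by (simp add: T_ell2_def dual_space_def MatsD[OF t])
  then have "mnorm T_ell2 t \<le> K \<longleftrightarrow> ?c \<le> ennreal K"
    using c ennreal_le_iff[OF K] by metis
  then show ?thesis using iff[OF K] by simp
qed

lemma mnorm_T_nonneg: "0 \<le> mnorm T_ell2 t"
  by (simp add: T_ell2_def dual_space_def)

lemma cb_bound_mnorm: "n > 0 \<Longrightarrow> t \<in> Mats n T_ell2 \<Longrightarrow> cb_bound n t (mnorm T_ell2 t)"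
  using mnorm_T_le_iff mnorm_T_nonneg by blast

section \<open>Triangle inequality, homogeneity and faithfulness of the norms\<close>

lemma cb_bound_add:
  assumes t: "t \<in> Mats n T_ell2" "cb_bound n t K" and s: "s \<in> Mats n T_ell2" "cb_bound n s L"
  shows "cb_bound n (mat_plus T_ell2 t s) (K + L)"
  unfolding cb_bound_def
proof (intro allI impI ballI)
  fix r x assume r: "r > 0" and x: "x \<in> Mats r B_ell2" and le: "op_mat_norm x \<le> 1"
  show "arr_bound ({..<r} \<times> {..<n}) ({..<r} \<times> {..<n})
       (\<lambda>(a, k) (b, l). trace_pairing (mat_plus T_ell2 t s $$ (k, l)) (x $$ (a, b))) (K + L)"
    by (rule arr_bound_cong[THEN iffD1, OF _ arr_bound_add[OF cb_boundD[OF t(2) r x le] cb_boundD[OF s(2) r x le]]])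
       (use MatsD[OF x] MatsD[OF t(1)] MatsD[OF s(1)] in \<open>auto simp: mat_plus_def trace_pairing_add_left\<close>)
qed

lemma cb_bound_scale:
  assumes t: "t \<in> Mats n T_ell2" "cb_bound n t K"
  shows "cb_bound n (mat_scale T_ell2 c t) (cmod c * K)"
  unfolding cb_bound_def
proof (intro allI impI ballI)
  fix r x assume r: "r > 0" and x: "x \<in> Mats r B_ell2" and le: "op_mat_norm x \<le> 1"
  show "arr_bound ({..<r} \<times> {..<n}) ({..<r} \<times> {..<n})
       (\<lambda>(a, k) (b, l). trace_pairing (mat_scale T_ell2 c t $$ (k, l)) (x $$ (a, b))) (cmod c * K)"
    by (rule arr_bound_cong[THEN iffD1, OF _ arr_bound_scale[OF cb_boundD[OF t(2) r x le]]])
       (use MatsD[OF x] MatsD[OF t(1)] in \<open>auto simp: mat_scale_def trace_pairing_scale_left\<close>)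
qed

lemma cb_bound_entry:
  assumes t: "t \<in> Mats n T_ell2" "cb_bound n t K" and b: "contraction b" and kl: "k < n" "l < n"
  shows "cmod (trace_pairing (t $$ (k, l)) b) \<le> K"
  using arr_bound_entry[OF cb_boundD[OF t(2) _ Mats_B_single[OF b]], of "(0, k)" "(0, l)"] kl by simp

text \<open>\<open>adj T\<close> is built from the values of T on basis vectors, so it vanishes, and
  with it T.\<close>

lemma bounded_clinear_zeroI:
  assumes T: "bounded_clinear T" and "\<And>n. T (ell2_basis n) = 0"
  shows "T = (\<lambda>_. 0)"
proof
  fix x
  have "adj T y = 0" for y
    unfolding adj_def assms(2) cinner_zero by (simp only: zero_ell2_def)
  then show "T x = 0" using cinner_adj_left[OF T] by (intro cinner_ext) simp
qed

text \<open>The operators |e_i><e_j| are contractions, and pairing with them recovers all matrix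
  entries of each t_kl.\<close>

lemma cb_bound_0:
  assumes n: "n > 0" and t: "t \<in> Mats n T_ell2"
  shows "cb_bound n t 0 \<longleftrightarrow> t = mat_zero T_ell2 n n"
proof
  assume 0: "cb_bound n t 0"
  have "t $$ (k, l) = (\<lambda>_. 0)" if kl: "k < n" "l < n" for k l
  proof (rule bounded_clinear_zeroI)
    have tc: "trace_class (t $$ (k, l))" using MatsD(4)[OF t kl] by simp
    then show "bounded_clinear (t $$ (k, l))" by (rule trace_class_bounded)
    fix i show "(t $$ (k, l)) (ell2_basis i) = 0"
    proof (rule ell2_eqI)
      fix j
      have "contraction (butterfly (ell2_basis i) (ell2_basis j))"
        unfolding contraction_def using bounded_clinear_butterfly norm_butterfly[of "ell2_basis i" "ell2_basis j"] by simp
      from cb_bound_entry[OF t 0 this kl] show "Rep_ell2 ((t $$ (k, l)) (ell2_basis i)) j = Rep_ell2 0 j"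
        by (simp add: trace_pairing_basis_right[OF tc])
    qed
  qed
  then show "t = mat_zero T_ell2 n n"
    using MatsD[OF t] by (intro eq_matI) (auto simp: mat_zero_def)
next
  assume t0: "t = mat_zero T_ell2 n n"
  show "cb_bound n t 0"
    unfolding cb_bound_def
    by (intro allI impI ballI arr_bound_cong[THEN iffD1, OF _ arr_bound_zero]) (auto simp: t0 mat_zero_def)
qed

text \<open>Together with \<open>vnorm_T_le\<close> this identifies the first-level norm as the
  least trace bound, so that completeness becomes a statement about
  \<open>trace_bound\<close>.\<close>

lemma trace_bound_vnorm:
  assumes T: "trace_class T"
  shows "trace_bound T (vnorm T_ell2 T)"
proof (rule trace_boundI_pairing[OF T])
  fix b assume b: "contraction b"
  let ?t = "Matrix.mat 1 1 (\<lambda>_. T)"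
  have t: "?t \<in> Mats 1 T_ell2" using T by (intro MatsI) auto
  show "cmod (trace_pairing T b) \<le> vnorm T_ell2 T"
    using cb_bound_entry[OF t cb_bound_mnorm[OF _ t] b, of 0 0] by (simp add: vnorm_def)
qed

lemma vnorm_T_le:
  assumes T: "trace_class T" and K: "trace_bound T K"
  shows "vnorm T_ell2 T \<le> K"
proof -
  let ?t = "Matrix.mat 1 1 (\<lambda>_. T)"
  have t: "?t \<in> Mats 1 T_ell2" using T by (intro MatsI) auto
  have "cb_bound 1 ?t K"
    unfolding cb_bound_def
  proof (intro allI impI ballI)
    fix r x assume r: "r > 0" and x: "x \<in> Mats r B_ell2" and le: "op_mat_norm x \<le> 1"
    have bij: "bij_betw (\<lambda>a. (a, 0)) {..<r} ({..<r} \<times> {..<1::nat})" by (auto simp: bij_betw_def inj_on_def)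
    have "arr_bound {..<r} {..<r} (\<lambda>a b. trace_pairing T (x $$ (a, b))) K"
      by (rule arr_boundI_form[OF _ trace_bound_nonneg[OF K]])
         (use trace_pairing_amplification[OF T K x le] in \<open>simp add: mult.assoc\<close>)
    then show "arr_bound ({..<r} \<times> {..<1}) ({..<r} \<times> {..<1})
       (\<lambda>(a, k) (b, l). trace_pairing (?t $$ (k, l)) (x $$ (a, b))) K"
      by (subst arr_bound_reindex[OF bij bij, symmetric]) simp
  qed
  then show ?thesis unfolding vnorm_def using mnorm_T_le_iff[OF _ t trace_bound_nonneg[OF K]] by simp
qed

text \<open>Trace bounds dominate operator norms, so a Cauchy sequence converges pointwise. A trace
  bound concerns finite sums of entries and survives pointwise limits, which shows that the limit is
  of trace class and that the convergence is in trace norm.\<close>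

lemma T_ell2_complete:
  assumes s: "range s \<subseteq> carrier T_ell2"
    and cauchy: "\<forall>\<epsilon>>0. \<exists>N. \<forall>i\<ge>N. \<forall>j\<ge>N. vnorm T_ell2 (s i \<ominus>\<^bsub>T_ell2\<^esub> s j) < \<epsilon>"
  shows "\<exists>a\<in>carrier T_ell2. (\<lambda>i. vnorm T_ell2 (s i \<ominus>\<^bsub>T_ell2\<^esub> a)) \<longlonglongrightarrow> 0"
proof -
  have tc: "trace_class (s i)" for i using s by auto
  have bl: "bounded_clinear (s i)" for i using trace_class_bounded[OF tc] .
  have diff: "trace_class (\<lambda>x. S x - T x)" if "trace_class S" "trace_class T" for S T
  proof -
    interpret vectorspace class_ring T_ell2 by (rule vectorspace_T_ell2)
    show ?thesis using M.minus_closed[of S T] that by (simp add: T_ell2_minus)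
  qed
  have C: "\<exists>N. \<forall>i\<ge>N. \<forall>j\<ge>N. trace_bound (\<lambda>x. s i x - s j x) \<epsilon>" if e: "\<epsilon> > 0" for \<epsilon>
  proof -
    obtain N where "\<forall>i\<ge>N. \<forall>j\<ge>N. vnorm T_ell2 (s i \<ominus>\<^bsub>T_ell2\<^esub> s j) < \<epsilon>"
      using cauchy e by blast
    then have N: "vnorm T_ell2 (s i \<ominus>\<^bsub>T_ell2\<^esub> s j) < \<epsilon>" if "i \<ge> N" "j \<ge> N" for i j using that by blast
    have "trace_bound (\<lambda>x. s i x - s j x) \<epsilon>" if "i \<ge> N" "j \<ge> N" for i j
      using trace_bound_vnorm[OF diff[OF tc tc], of i j] N[OF that]
      by (simp add: T_ell2_minus[OF tc tc] trace_bound_def) (meson less_imp_le order_trans)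
    then show ?thesis by blast
  qed
  have "Cauchy (\<lambda>i. s i x)" for x
  proof (rule metric_CauchyI)
    fix e :: real assume e: "e > 0"
    define \<epsilon> where "\<epsilon> = e / (norm x + 1)"
    have e': "\<epsilon> > 0" using e by (simp add: \<epsilon>_def add_nonneg_pos)
    obtain N where N: "\<And>i j. i \<ge> N \<Longrightarrow> j \<ge> N \<Longrightarrow> trace_bound (\<lambda>x. s i x - s j x) \<epsilon>"
      using C[OF e'] by auto
    have "dist (s i x) (s j x) < e" if "i \<ge> N" "j \<ge> N" for i j
    proof -
      have "norm (s i x - s j x) \<le> \<epsilon> * norm x"
        by (rule trace_bound_norm[OF trace_class_bounded[OF diff[OF tc tc]] N[OF that]])
      also have "\<dots> < \<epsilon> * (norm x + 1)" using e' by (intro mult_strict_left_mono) auto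
      also have "\<dots> = e" by (simp add: \<epsilon>_def) (smt (verit) norm_ge_zero)
      finally show ?thesis by (simp add: dist_norm)
    qed
    then show "\<exists>N. \<forall>i\<ge>N. \<forall>j\<ge>N. dist (s i x) (s j x) < e" by blast
  qed
  then have "\<forall>x. \<exists>l. (\<lambda>i. s i x) \<longlonglongrightarrow> l" by (simp add: Cauchy_convergent_iff convergent_def)
  then obtain T where T: "\<And>x. (\<lambda>i. s i x) \<longlonglongrightarrow> T x" by metis
  have lim: "trace_bound (\<lambda>x. T x - s j x) \<epsilon>"
    if N: "\<And>i. i \<ge> N \<Longrightarrow> trace_bound (\<lambda>x. s i x - s j x) \<epsilon>" for N j \<epsilon>
    unfolding trace_bound_def
  proof (intro allI impI)
    fix M b assume b: "contraction b"
    have "(\<lambda>i. \<Sum>m<M. cmod (Rep_ell2 (s i (b (ell2_basis m)) - s j (b (ell2_basis m))) m)) \<longlonglongrightarrow>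
        (\<Sum>m<M. cmod (Rep_ell2 (T (b (ell2_basis m)) - s j (b (ell2_basis m))) m))"
      by (intro tendsto_sum tendsto_norm Rep_ell2_tendsto tendsto_diff T tendsto_const)
    then show "(\<Sum>m<M. cmod (Rep_ell2 (T (b (ell2_basis m)) - s j (b (ell2_basis m))) m)) \<le> \<epsilon>"
      by (rule LIMSEQ_le_const2) (use N b in \<open>auto simp: trace_bound_def\<close>)
  qed
  obtain N1 where N1: "\<And>i j. i \<ge> N1 \<Longrightarrow> j \<ge> N1 \<Longrightarrow> trace_bound (\<lambda>x. s i x - s j x) 1"
    using C[of 1] by auto
  obtain K1 where K1: "K1 > 0" "\<And>x. norm (s N1 x) \<le> K1 * norm x" by (rule bounded_clinear_bound[OF bl]) blast
  have blT: "bounded_clinear T"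
  proof (rule bounded_clinearI)
    show "T (x + y) = T x + T y" for x y
      by (rule LIMSEQ_unique[OF T]) (use tendsto_add[OF T T] in \<open>simp add: bounded_clinear_simps[OF bl]\<close>)
    show "T (cscale c x) = cscale c (T x)" for c x
      by (rule LIMSEQ_unique[OF T])
         (use bounded_linear.tendsto[OF bounded_linear_cscale T] in \<open>simp add: bounded_clinear_simps[OF bl]\<close>)
    show "norm (T x) \<le> (K1 + 1) * norm x" for x
    proof (rule LIMSEQ_le_const2[OF tendsto_norm[OF T]], intro exI[of _ N1] allI impI)
      fix i assume i: "i \<ge> N1"
      have "norm (s i x - s N1 x) \<le> 1 * norm x"
        by (rule trace_bound_norm[OF trace_class_bounded[OF diff[OF tc tc]] N1[OF i]]) simp
      then show "norm (s i x) \<le> (K1 + 1) * norm x"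
        using K1(2)[of x] norm_triangle_ineq[of "s i x - s N1 x" "s N1 x"] by (simp add: distrib_right)
    qed
  qed
  have "trace_bound (\<lambda>x. T x - s N1 x) 1" by (rule lim[of N1]) (use N1 in auto)
  moreover obtain L where "trace_bound (s N1) L" using tc trace_class_iff by blast
  ultimately have "trace_bound (\<lambda>x. (T x - s N1 x) + s N1 x) (1 + L)" by (rule trace_bound_add)
  then have tcT: "trace_class T" using blT by (auto intro: trace_bound_imp_trace_class)
  have sym: "trace_bound (\<lambda>x. s j x - T x) \<epsilon>" if "trace_bound (\<lambda>x. T x - s j x) \<epsilon>" for j \<epsilon>
    using that by (simp add: trace_bound_def norm_minus_commute)
  have "(\<lambda>i. vnorm T_ell2 (s i \<ominus>\<^bsub>T_ell2\<^esub> T)) \<longlonglongrightarrow> 0"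
  proof (rule LIMSEQ_I)
    fix e :: real assume e: "e > 0"
    obtain N where N: "\<And>i j. i \<ge> N \<Longrightarrow> j \<ge> N \<Longrightarrow> trace_bound (\<lambda>x. s i x - s j x) (e/2)"
      using C[of "e/2"] e by auto
    have "vnorm T_ell2 (s j \<ominus>\<^bsub>T_ell2\<^esub> T) \<le> e/2" if "j \<ge> N" for j
      unfolding T_ell2_minus[OF tc tcT]
      by (rule vnorm_T_le[OF diff[OF tc tcT] sym[OF lim[of N]]]) (use N that in auto)
    then show "\<exists>N. \<forall>i\<ge>N. norm (vnorm T_ell2 (s i \<ominus>\<^bsub>T_ell2\<^esub> T) - 0) < e"
      using e mnorm_T_nonneg by (intro exI[of _ N]) (fastforce simp: vnorm_def)
  qed
  then show ?thesis using tcT by auto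
qed

section \<open>Direct sums and two-sided multiplication by scalar matrices\<close>

lemma Mats_T_closed:
  assumes t: "t \<in> Mats n T_ell2"
  shows "s \<in> Mats n T_ell2 \<Longrightarrow> mat_plus T_ell2 t s \<in> Mats n T_ell2"
    and "mat_scale T_ell2 c t \<in> Mats n T_ell2"
    and "s \<in> Mats m T_ell2 \<Longrightarrow> mat_dsum T_ell2 t s \<in> Mats (n + m) T_ell2"
proof -
  show "mat_plus T_ell2 t s \<in> Mats n T_ell2" if s: "s \<in> Mats n T_ell2"
    by (rule MatsI) (use MatsD[OF t] MatsD[OF s] in \<open>auto simp: mat_plus_def intro!: trace_class_add\<close>)
  show "mat_scale T_ell2 c t \<in> Mats n T_ell2"
    by (rule MatsI) (use MatsD[OF t] in \<open>auto simp: mat_scale_def intro!: trace_class_scale\<close>)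
  show "mat_dsum T_ell2 t s \<in> Mats (n + m) T_ell2" if s: "s \<in> Mats m T_ell2"
    by (rule MatsI) (use MatsD[OF t] MatsD[OF s] in \<open>auto simp: mat_dsum_def mat_zero_def trace_class_zero\<close>)
qed

text \<open>The index set splits into two rectangles between which the array vanishes; the second is
  the index set of s shifted by m.\<close>

lemma cb_bound_dsum:
  assumes m: "m > 0" and n: "n > 0" and t: "t \<in> Mats m T_ell2" and s: "s \<in> Mats n T_ell2" and K: "0 \<le> K"
  shows "cb_bound (m + n) (mat_dsum T_ell2 t s) K \<longleftrightarrow> cb_bound m t K \<and> cb_bound n s K"
proof -
  have "arr_bound ({..<r} \<times> {..<m + n}) ({..<r} \<times> {..<m + n})
       (\<lambda>(a, k) (b, l). trace_pairing (mat_dsum T_ell2 t s $$ (k, l)) (x $$ (a, b))) K \<longleftrightarrow>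
     arr_bound ({..<r} \<times> {..<m}) ({..<r} \<times> {..<m}) (\<lambda>(a, k) (b, l). trace_pairing (t $$ (k, l)) (x $$ (a, b))) K \<and>
     arr_bound ({..<r} \<times> {..<n}) ({..<r} \<times> {..<n}) (\<lambda>(a, k) (b, l). trace_pairing (s $$ (k, l)) (x $$ (a, b))) K"
     (is "arr_bound ?I ?I ?A K \<longleftrightarrow> arr_bound ?I1 ?I1 ?A1 K \<and> arr_bound ?I3 ?I3 ?A3 K") for r x
  proof -
    let ?I2 = "{..<r} \<times> {m..<m + n}"
    have I: "?I = ?I1 \<union> ?I2" by auto
    have bij: "bij_betw (\<lambda>(a, k). (a, m + k)) ?I3 ?I2"
      by (rule bij_betwI[where g = "\<lambda>(a, k). (a, k - m)"]) auto
    have "arr_bound ?I ?I ?A K \<longleftrightarrow> arr_bound ?I1 ?I1 ?A K \<and> arr_bound ?I2 ?I2 ?A K"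
      unfolding I using MatsD[OF t] MatsD[OF s]
      by (intro arr_bound_block K) (auto simp: mat_dsum_def mat_zero_def)
    also have "arr_bound ?I1 ?I1 ?A K \<longleftrightarrow> arr_bound ?I1 ?I1 ?A1 K"
      using MatsD[OF t] MatsD[OF s] by (intro arr_bound_cong) (auto simp: mat_dsum_def mat_zero_def)
    also have "arr_bound ?I2 ?I2 ?A K \<longleftrightarrow> arr_bound ?I3 ?I3 ?A3 K"
      unfolding arr_bound_reindex[OF bij bij, symmetric]
      using MatsD[OF t] MatsD[OF s] by (intro arr_bound_cong) (auto simp: mat_dsum_def mat_zero_def)
    finally show ?thesis .
  qed
  then show ?thesis unfolding cb_bound_def by blast
qed

lemma mat_sandwich_T:
  assumes t: "t \<in> Mats m T_ell2" and \<alpha>: "\<alpha> \<in> carrier_mat m m" and \<beta>: "\<beta> \<in> carrier_mat m m"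
  shows "mat_sandwich T_ell2 \<alpha> t \<beta> \<in> Mats m T_ell2"
    "i < m \<Longrightarrow> j < m \<Longrightarrow> bounded_clinear b \<Longrightarrow> trace_pairing (mat_sandwich T_ell2 \<alpha> t \<beta> $$ (i, j)) b =
       (\<Sum>k<m. \<Sum>l<m. (\<alpha> $$ (i, k) * \<beta> $$ (l, j)) * trace_pairing (t $$ (k, l)) b)"
proof -
  have tc: "trace_class (t $$ (k, l))" if "k < m" "l < m" for k l using MatsD(4)[OF t that] by simp
  have e: "mat_sandwich T_ell2 \<alpha> t \<beta> $$ (i, j) =
      (\<lambda>v. \<Sum>k<m. \<Sum>l<m. cscale (\<alpha> $$ (i, k) * \<beta> $$ (l, j)) ((t $$ (k, l)) v))" if "i < m" "j < m" for i j
  proof -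
    have "(finsum T_ell2 (\<lambda>l v. cscale (\<alpha> $$ (i, k) * \<beta> $$ (l, j)) ((t $$ (k, l)) v)) {..<m}) =
       (\<lambda>v. \<Sum>l<m. cscale (\<alpha> $$ (i, k) * \<beta> $$ (l, j)) ((t $$ (k, l)) v))" if "k < m" for k
      using that by (intro T_ell2_finsum trace_class_scale tc) auto
    then have "finsum T_ell2 (\<lambda>k. finsum T_ell2 (\<lambda>l v. cscale (\<alpha> $$ (i, k) * \<beta> $$ (l, j)) ((t $$ (k, l)) v)) {..<m}) {..<m} =
       (\<lambda>v. \<Sum>k<m. finsum T_ell2 (\<lambda>l v. cscale (\<alpha> $$ (i, k) * \<beta> $$ (l, j)) ((t $$ (k, l)) v)) {..<m} v)"
      by (intro T_ell2_finsum) (auto intro!: trace_class_sum trace_class_scale tc)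
    also have "\<dots> = (\<lambda>v. \<Sum>k<m. \<Sum>l<m. cscale (\<alpha> $$ (i, k) * \<beta> $$ (l, j)) ((t $$ (k, l)) v))"
      using \<open>\<And>k. k < m \<Longrightarrow> _\<close> by (intro ext sum.cong) auto
    finally show ?thesis using that \<alpha> \<beta> by (simp add: mat_sandwich_def MatsD[OF t])
  qed
  show "mat_sandwich T_ell2 \<alpha> t \<beta> \<in> Mats m T_ell2"
  proof (rule MatsI)
    show "mat_sandwich T_ell2 \<alpha> t \<beta> $$ (i, j) \<in> carrier T_ell2" if "i < m" "j < m" for i j
      unfolding e[OF that] T_ell2_simps mem_Collect_eq by (intro trace_class_sum trace_class_scale tc) auto
  qed (use \<alpha> \<beta> in \<open>auto simp: mat_sandwich_def\<close>)
  show "trace_pairing (mat_sandwich T_ell2 \<alpha> t \<beta> $$ (i, j)) b =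
       (\<Sum>k<m. \<Sum>l<m. (\<alpha> $$ (i, k) * \<beta> $$ (l, j)) * trace_pairing (t $$ (k, l)) b)"
    if "i < m" "j < m" "bounded_clinear b"
  proof -
    have "trace_pairing (mat_sandwich T_ell2 \<alpha> t \<beta> $$ (i, j)) b = (\<Sum>k<m. trace_pairing (\<lambda>v. \<Sum>l<m.
        cscale (\<alpha> $$ (i, k) * \<beta> $$ (l, j)) ((t $$ (k, l)) v)) b)"
      unfolding e[OF that(1,2)]
      by (intro trace_pairing_sum_left trace_class_sum trace_class_scale tc that) auto
    also have "\<dots> = (\<Sum>k<m. \<Sum>l<m. trace_pairing (\<lambda>v. cscale (\<alpha> $$ (i, k) * \<beta> $$ (l, j)) ((t $$ (k, l)) v)) b)"
      by (intro sum.cong refl trace_pairing_sum_left trace_class_scale tc that) auto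
    finally show ?thesis
      by (simp add: trace_pairing_scale_left[OF tc that(3)])
  qed
qed

text \<open>In array form the sandwich is a product of three factors: the amplification of \<alpha>,
  the array of t at x, and the amplification of \<beta>.\<close>

lemma cb_bound_sandwich:
  assumes m: "m > 0" and t: "t \<in> Mats m T_ell2" "cb_bound m t K" and K: "0 \<le> K"
    and \<alpha>: "\<alpha> \<in> carrier_mat m m" and \<beta>: "\<beta> \<in> carrier_mat m m"
  shows "cb_bound m (mat_sandwich T_ell2 \<alpha> t \<beta>) (cmat_norm \<alpha> * K * cmat_norm \<beta>)"
  unfolding cb_bound_def
proof (intro allI impI ballI)
  fix r x assume r: "r > 0" and x: "x \<in> Mats r B_ell2" and le: "op_mat_norm x \<le> 1"
  let ?I = "{..<r} \<times> {..<m}"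
  have scal: "arr_bound ?I ?I (\<lambda>(a, i) (b, j). if a = b then \<gamma> $$ (i, j) else 0) (cmat_norm \<gamma>)"
    if "\<gamma> \<in> carrier_mat m m" for \<gamma>
    using cmat_norm_le_iff[OF cmat_norm_nonneg, of \<gamma> \<gamma>] that
    by (intro arr_bound_amplify cmat_norm_nonneg) auto
  show "arr_bound ?I ?I
       (\<lambda>(a, k) (b, l). trace_pairing (mat_sandwich T_ell2 \<alpha> t \<beta> $$ (k, l)) (x $$ (a, b)))
       (cmat_norm \<alpha> * K * cmat_norm \<beta>)"
  proof (rule arr_bound_cong[THEN iffD1, OF _ arr_bound_mult[OF arr_bound_mult[OF scal[OF \<alpha>]
        cb_boundD[OF t(2) r x le] cmat_norm_nonneg] scal[OF \<beta>] mult_nonneg_nonneg[OF cmat_norm_nonneg K]]])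
    fix p q assume "p \<in> ?I" "q \<in> ?I"
    then obtain a i b j where p: "p = (a, i)" "a < r" "i < m" and q: "q = (b, j)" "b < r" "j < m" by auto
    let ?T = "\<lambda>k l a b. trace_pairing (t $$ (k, l)) (x $$ (a, b))"
    have 1: "(\<Sum>s\<in>?I. (case p of (a, i) \<Rightarrow> \<lambda>(b, j). if a = b then \<alpha> $$ (i, j) else 0) s *
        (case s of (a, k) \<Rightarrow> \<lambda>(b, l). ?T k l a b) (b', l)) = (\<Sum>k<m. \<alpha> $$ (i, k) * ?T k l a b')" for b' l
      unfolding sum_pair by (subst sum.swap) (use p in \<open>simp add: if_distrib[of "\<lambda>c. c * _"] cong: if_cong\<close>)
    have "(\<Sum>s\<in>?I. (\<Sum>s'\<in>?I. (case p of (a, i) \<Rightarrow> \<lambda>(b, j). if a = b then \<alpha> $$ (i, j) else 0) s' *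
        (case s' of (a, k) \<Rightarrow> \<lambda>(b, l). ?T k l a b) s) *
        (case s of (a, i) \<Rightarrow> \<lambda>(b, j). if a = b then \<beta> $$ (i, j) else 0) q) =
        (\<Sum>b'<r. \<Sum>l<m. (\<Sum>k<m. \<alpha> $$ (i, k) * ?T k l a b') * (if b' = b then \<beta> $$ (l, j) else 0))"
      unfolding sum_pair[of _ "{..<r}" "{..<m}"] q(1) using 1[unfolded sum_pair] by (intro sum.cong refl) auto
    also have "\<dots> = (\<Sum>l<m. (\<Sum>k<m. \<alpha> $$ (i, k) * ?T k l a b) * \<beta> $$ (l, j))"
      using q by (subst sum.swap) (simp add: if_distrib[of "\<lambda>c. _ * c"] cong: if_cong)
    also have "\<dots> = (\<Sum>k<m. \<Sum>l<m. (\<alpha> $$ (i, k) * \<beta> $$ (l, j)) * ?T k l a b)"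
      unfolding sum_distrib_right by (subst sum.swap) (simp add: ac_simps)
    also have "\<dots> = (case p of (a, k) \<Rightarrow> \<lambda>(b, l). trace_pairing (mat_sandwich T_ell2 \<alpha> t \<beta> $$ (k, l)) (x $$ (a, b))) q"
      using p q MatsD(4)[OF x, of a b] mat_sandwich_T(2)[OF t(1) \<alpha> \<beta>, of i j "x $$ (a, b)"] by simp
    finally show "(\<Sum>s\<in>?I. (\<Sum>s'\<in>?I. (case p of (a, i) \<Rightarrow> \<lambda>(b, j). if a = b then \<alpha> $$ (i, j) else 0) s' *
        (case s' of (a, k) \<Rightarrow> \<lambda>(b, l). ?T k l a b) s) *
        (case s of (a, i) \<Rightarrow> \<lambda>(b, j). if a = b then \<beta> $$ (i, j) else 0) q) =
        (case p of (a, k) \<Rightarrow> \<lambda>(b, l). trace_pairing (mat_sandwich T_ell2 \<alpha> t \<beta> $$ (k, l)) (x $$ (a, b))) q" .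
  qed
qed

theorem operator_space_T_ell2: "operator_space T_ell2"
proof -
  interpret vectorspace class_ring T_ell2 by (rule vectorspace_T_ell2)
  show ?thesis
  proof
    show "mnorm T_ell2 x \<ge> 0" for x by (rule mnorm_T_nonneg)
    show "mnorm T_ell2 x = 0 \<longleftrightarrow> x = mat_zero T_ell2 n n" if "n > 0" "x \<in> Mats n T_ell2" for n x
      using mnorm_T_le_iff[OF that, of 0] cb_bound_0[OF that] mnorm_T_nonneg[of x] by auto
    have sc: "mnorm T_ell2 (mat_scale T_ell2 c x) \<le> cmod c * mnorm T_ell2 x" if "n > 0" "x \<in> Mats n T_ell2" for n c x
      using mnorm_T_le_iff[OF that(1) Mats_T_closed(2)[OF that(2)]] cb_bound_scale[OF that(2) cb_bound_mnorm[OF that]]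
        mnorm_T_nonneg by simp
    show "mnorm T_ell2 (mat_scale T_ell2 c x) = cmod c * mnorm T_ell2 x" if nx: "n > 0" "x \<in> Mats n T_ell2" for n c x
    proof (rule antisym[OF sc[OF nx]])
      \<comment> \<open>The reverse inequality is the first one for the inverse scalar.\<close>
      show "cmod c * mnorm T_ell2 x \<le> mnorm T_ell2 (mat_scale T_ell2 c x)"
      proof (cases "c = 0")
        case False
        have "mat_scale T_ell2 (inverse c) (mat_scale T_ell2 c x) = x"
          using False by (intro eq_matI) (auto simp: mat_scale_def)
        then have "mnorm T_ell2 x \<le> cmod (inverse c) * mnorm T_ell2 (mat_scale T_ell2 c x)"
          using sc[OF nx(1) Mats_T_closed(2)[OF nx(2)], of "inverse c" c] by simp
        then show ?thesis using False by (simp add: norm_divide field_simps)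
      qed (simp add: mnorm_T_nonneg)
    qed
    show "mnorm T_ell2 (mat_plus T_ell2 x y) \<le> mnorm T_ell2 x + mnorm T_ell2 y"
      if "n > 0" "x \<in> Mats n T_ell2" "y \<in> Mats n T_ell2" for n x y
      using mnorm_T_le_iff[OF that(1) Mats_T_closed(1)[OF that(2,3)]] cb_bound_mnorm[OF that(1,2)]
        cb_bound_mnorm[OF that(1,3)] cb_bound_add that by (simp add: mnorm_T_nonneg)
    show "\<exists>a\<in>carrier T_ell2. (\<lambda>i. vnorm T_ell2 (s i \<ominus>\<^bsub>T_ell2\<^esub> a)) \<longlonglongrightarrow> 0"
      if "range s \<subseteq> carrier T_ell2"
        "\<forall>\<epsilon>>0. \<exists>N. \<forall>i\<ge>N. \<forall>j\<ge>N. vnorm T_ell2 (s i \<ominus>\<^bsub>T_ell2\<^esub> s j) < \<epsilon>" for s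
      by (rule T_ell2_complete[OF that])
    show "mnorm T_ell2 (mat_dsum T_ell2 x y) = max (mnorm T_ell2 x) (mnorm T_ell2 y)"
      if mn: "m > 0" "n > 0" and xy: "x \<in> Mats m T_ell2" "y \<in> Mats n T_ell2" for m n x y
    proof -
      have "mnorm T_ell2 (mat_dsum T_ell2 x y) \<le> K \<longleftrightarrow> max (mnorm T_ell2 x) (mnorm T_ell2 y) \<le> K" if "0 \<le> K" for K
        using mnorm_T_le_iff[OF _ Mats_T_closed(3)[OF xy] that] mnorm_T_le_iff[OF mn(1) xy(1) that]
          mnorm_T_le_iff[OF mn(2) xy(2) that] cb_bound_dsum[OF mn xy that] mn by simp
      then show ?thesis by (meson antisym max.coboundedI1 mnorm_T_nonneg order_refl)
    qed
    show "mnorm T_ell2 (mat_sandwich T_ell2 \<alpha> x \<beta>) \<le> cmat_norm \<alpha> * mnorm T_ell2 x * cmat_norm \<beta>"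
      if "m > 0" "x \<in> Mats m T_ell2" "\<alpha> \<in> carrier_mat m m" "\<beta> \<in> carrier_mat m m" for m x \<alpha> \<beta>
      using mnorm_T_le_iff[OF that(1) mat_sandwich_T(1)[OF that(2-4)]]
        cb_bound_sandwich[OF that(1,2) cb_bound_mnorm[OF that(1,2)] mnorm_T_nonneg that(3,4)]
      by (simp add: mnorm_T_nonneg cmat_norm_nonneg)
  qed
qed

section \<open>Separation from a convex cone\<close>

text \<open>A minimising sequence is Cauchy by the parallelogram law, since midpoints stay in S and
  have distance at least d from z.\<close>

lemma closest_point_exists:
  fixes S :: "'a::{real_inner, complete_space} set"
  assumes ne: "S \<noteq> {}" and cv: "convex S"
  shows "\<exists>y\<in>closure S. \<forall>x\<in>closure S. dist z y \<le> dist z x"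
proof -
  define d where "d = infdist z S"
  have d: "d \<le> dist z x" if "x \<in> S" for x unfolding d_def by (rule infdist_le[OF that])
  have d0: "0 \<le> d" by (simp add: d_def infdist_nonneg)
  have "\<exists>x\<in>S. dist z x < d + inverse (of_nat (Suc k))" for k
  proof (rule ccontr)
    assume "\<not> ?thesis"
    then have "d + inverse (of_nat (Suc k)) \<le> infdist z S"
      using ne unfolding infdist_def by (auto intro!: cINF_greatest simp: not_less)
    then show False by (simp add: d_def)
  qed
  then obtain s where s: "\<And>k. s k \<in> S" "\<And>k. dist z (s k) < d + inverse (of_nat (Suc k))" by metis
  have lim: "(\<lambda>k. dist z (s k)) \<longlonglongrightarrow> d"
  proof (rule tendsto_sandwich[where f = "\<lambda>_. d" and h = "\<lambda>k. d + inverse (of_nat (Suc k))"])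
    show "(\<lambda>k. d + inverse (of_nat (Suc k))) \<longlonglongrightarrow> d"
      using tendsto_add[OF tendsto_const LIMSEQ_inverse_real_of_nat, of d] by simp
  qed (use d s(1) less_imp_le[OF s(2)] in \<open>auto intro!: always_eventually\<close>)
  have par: "(dist (s i) (s j))\<^sup>2 \<le> 2 * ((dist z (s i))\<^sup>2 - d\<^sup>2) + 2 * ((dist z (s j))\<^sup>2 - d\<^sup>2)" for i j
  proof -
    let ?m = "(1/2) *\<^sub>R s i + (1/2) *\<^sub>R s j"
    have "?m \<in> S" using s(1) by (intro convexD[OF cv]) auto
    then have "d\<^sup>2 \<le> (norm (z - ?m))\<^sup>2" using d[of ?m] d0 by (simp add: dist_norm power_mono)
    moreover have "(norm (s i - s j))\<^sup>2 = 2 * (norm (z - s i))\<^sup>2 + 2 * (norm (z - s j))\<^sup>2 - 4 * (norm (z - ?m))\<^sup>2"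
      unfolding power2_norm_eq_inner inner_diff_left inner_diff_right inner_add_left inner_add_right
        inner_scaleR_left inner_scaleR_right inner_commute[of "s j" "s i"] inner_commute[of "s i" z] inner_commute[of "s j" z]
      by (simp add: field_simps)
    ultimately show ?thesis by (simp add: dist_norm)
  qed
  have "Cauchy s"
  proof (rule metric_CauchyI)
    fix e :: real assume e: "e > 0"
    have "(\<lambda>k. (dist z (s k))\<^sup>2 - d\<^sup>2) \<longlonglongrightarrow> d\<^sup>2 - d\<^sup>2" by (intro tendsto_intros lim)
    then have "\<forall>\<^sub>F k in sequentially. (dist z (s k))\<^sup>2 - d\<^sup>2 < e\<^sup>2 / 4"
      by (rule order_tendstoD) (use e in simp)
    then obtain N where N: "\<And>k. k \<ge> N \<Longrightarrow> (dist z (s k))\<^sup>2 - d\<^sup>2 < e\<^sup>2 / 4"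
      unfolding eventually_sequentially by blast
    have "dist (s i) (s j) < e" if "i \<ge> N" "j \<ge> N" for i j
    proof -
      have "2 * ((dist z (s i))\<^sup>2 - d\<^sup>2) + 2 * ((dist z (s j))\<^sup>2 - d\<^sup>2) < 2 * (e\<^sup>2 / 4) + 2 * (e\<^sup>2 / 4)"
        by (intro add_strict_mono mult_strict_left_mono N that) auto
      then have "(dist (s i) (s j))\<^sup>2 < e\<^sup>2" using par[of i j] by simp
      then show ?thesis using e by (simp add: power2_less_imp_less)
    qed
    then show "\<exists>N. \<forall>i\<ge>N. \<forall>j\<ge>N. dist (s i) (s j) < e" by blast
  qed
  then obtain y where y: "s \<longlonglongrightarrow> y" using Cauchy_convergent_iff convergent_def by blast
  have "dist z y = d"
    using LIMSEQ_unique[OF tendsto_dist[OF tendsto_const y] lim] .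
  moreover have "y \<in> closure S" using y s(1) closure_sequential by blast
  moreover have "d \<le> dist z x" if x: "x \<in> closure S" for x
  proof -
    obtain f where f: "\<And>n. f n \<in> S" "f \<longlonglongrightarrow> x" using x unfolding closure_sequential by auto
    show ?thesis
      by (rule LIMSEQ_le_const[OF tendsto_dist[OF tendsto_const f(2)]]) (use d f(1) in blast)
  qed
  ultimately show ?thesis by auto
qed

text \<open>Let y be the point of the closure nearest to z and a = y - z. Moving from y in a
  direction x of the cone gives <a, x> >= 0, and shrinking y towards 0 gives <a, y> <= 0, so <a, z>
  = <a, y> - |a|^2 < 0.\<close>

lemma cone_separation:
  fixes S :: "'a::{real_inner, complete_space} set"
  assumes S0: "0 \<in> S" and add: "\<And>x y. x \<in> S \<Longrightarrow> y \<in> S \<Longrightarrow> x + y \<in> S"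
    and scale: "\<And>r x. 0 \<le> r \<Longrightarrow> x \<in> S \<Longrightarrow> r *\<^sub>R x \<in> S" and z: "z \<notin> closure S"
  shows "\<exists>a. (\<forall>x\<in>S. 0 \<le> inner a x) \<and> inner a z < 0"
proof -
  have "convex S" unfolding convex_def using add scale by auto
  then obtain y where y: "y \<in> closure S" "\<And>x. x \<in> closure S \<Longrightarrow> dist z y \<le> dist z x"
    using closest_point_exists[of S z] S0 by blast
  define a where "a = y - z"
  have a0: "a \<noteq> 0" using y(1) z by (auto simp: a_def)
  have cl: "y + t *\<^sub>R x \<in> closure S" if x: "x \<in> closure S" "0 \<le> t" for t x
  proof -
    obtain f g where fg: "\<And>n. f n \<in> S" "f \<longlonglongrightarrow> y" "\<And>n. g n \<in> S" "g \<longlonglongrightarrow> x"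
      using y(1) x(1) unfolding closure_sequential by auto
    have "(\<lambda>n. f n + t *\<^sub>R g n) \<longlonglongrightarrow> y + t *\<^sub>R x" by (intro tendsto_intros fg)
    moreover have "f n + t *\<^sub>R g n \<in> S" for n using fg(1,3) by (intro add scale x(2))
    ultimately show ?thesis
      unfolding closure_sequential by (intro exI[of _ "\<lambda>n. f n + t *\<^sub>R g n"]) simp
  qed
  \<comment> \<open>The first-order condition at the nearest point, kept as a quadratic inequality
    in t.\<close>
  have quad: "0 \<le> 2 * t * inner a x + t\<^sup>2 * (norm x)\<^sup>2" if "y + t *\<^sub>R x \<in> closure S" for t x
  proof -
    have "(norm a)\<^sup>2 \<le> (norm (a + t *\<^sub>R x))\<^sup>2"
      using y(2)[OF that] unfolding a_def by (intro power_mono) (auto simp: dist_norm norm_minus_commute algebra_simps)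
    also have "\<dots> = (norm a)\<^sup>2 + (2 * t * inner a x + t\<^sup>2 * (norm x)\<^sup>2)"
      unfolding power2_norm_eq_inner inner_add_left inner_add_right inner_scaleR_left inner_scaleR_right
        inner_commute[of x a] by (simp add: power2_eq_square algebra_simps)
    finally show ?thesis by simp
  qed
  have lim: "0 \<le> inner a x" if "\<And>t. 0 < t \<Longrightarrow> t < 1 \<Longrightarrow> 0 \<le> 2 * inner a x + t * (norm x)\<^sup>2" for x
  proof (rule ccontr)
    assume neg: "\<not> 0 \<le> inner a x"
    \<comment> \<open>For this t the quadratic term t |x|^2 is at most -<a, x>, which leaves a sum
      of at most <a, x> < 0.\<close>
    define t where "t = min (1/2) (- inner a x / ((norm x)\<^sup>2 + 1))"
    have "t > 0" using neg by (auto simp: t_def divide_less_0_iff add_nonneg_pos intro!: divide_pos_pos)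
    moreover have "t < 1" by (auto simp: t_def)
    moreover have "t * (norm x)\<^sup>2 \<le> - inner a x"
    proof -
      have "t * (norm x)\<^sup>2 \<le> (- inner a x / ((norm x)\<^sup>2 + 1)) * ((norm x)\<^sup>2 + 1)"
        using neg by (intro mult_mono) (auto simp: t_def divide_nonpos_pos add_nonneg_pos)
      also have "\<dots> = - inner a x" by (simp add: add_nonneg_eq_0_iff)
      finally show ?thesis .
    qed
    ultimately show False using that[of t] neg by simp
  qed
  have pos: "0 \<le> inner a x" if "x \<in> S" for x
  proof (rule lim)
    fix t :: real assume t: "0 < t" "t < 1"
    have "0 \<le> t * (2 * inner a x + t * (norm x)\<^sup>2)"
      using quad[OF cl[of x t]] closure_subset that t by (auto simp: power2_eq_square algebra_simps)
    then show "0 \<le> 2 * inner a x + t * (norm x)\<^sup>2" using t by (simp add: zero_le_mult_iff)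
  qed
  have "0 \<le> inner a (- y)"
  proof (rule lim)
    fix t :: real assume t: "0 < t" "t < 1"
    obtain f where f: "\<And>n. f n \<in> S" "f \<longlonglongrightarrow> y" using y(1) unfolding closure_sequential by auto
    have "(\<lambda>n. (1 - t) *\<^sub>R f n) \<longlonglongrightarrow> (1 - t) *\<^sub>R y" by (intro tendsto_intros f)
    moreover have "(1 - t) *\<^sub>R f n \<in> S" for n using f(1) t by (intro scale) auto
    ultimately have "(1 - t) *\<^sub>R y \<in> closure S"
      unfolding closure_sequential by (intro exI[of _ "\<lambda>n. (1 - t) *\<^sub>R f n"]) simp
    then have "y + t *\<^sub>R (- y) \<in> closure S" by (simp add: algebra_simps)
    from quad[OF this] have "0 \<le> t * (2 * inner a (- y) + t * (norm (- y))\<^sup>2)"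
      by (simp add: power2_eq_square algebra_simps)
    then show "0 \<le> 2 * inner a (- y) + t * (norm (- y))\<^sup>2" using t by (simp only: zero_le_mult_iff) linarith
  qed
  moreover have "inner a z = inner a y - (norm a)\<^sup>2"
    by (simp add: a_def power2_norm_eq_inner inner_diff_right[symmetric])
  ultimately have "inner a z < 0" using a0 by (simp add: power2_eq_square) (smt (verit) zero_less_norm_iff mult_pos_pos)
  then show ?thesis using pos by blast
qed

text \<open>The index set is enumerated into coordinates of \<open>ell2\<close>, which serves as the
  Hilbert space. A coordinate is bounded by the norm, so an entrywise distance e keeps z out of the
  closure.\<close>

lemma cone_separation_fun:
  fixes I :: "'i::countable set" and C :: "('i \<Rightarrow> complex) set"
  assumes fin: "finite I" and C0: "(\<lambda>_. 0) \<in> C" and add: "\<And>f g. f \<in> C \<Longrightarrow> g \<in> C \<Longrightarrow> (\<lambda>i. f i + g i) \<in> C"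
    and scale: "\<And>r f. 0 \<le> r \<Longrightarrow> f \<in> C \<Longrightarrow> (\<lambda>i. of_real r * f i) \<in> C"
    and e: "e > 0" and far: "\<And>c. c \<in> C \<Longrightarrow> \<exists>i\<in>I. e \<le> cmod (c i - z i)"
  shows "\<exists>a. (\<forall>c\<in>C. 0 \<le> Re (\<Sum>i\<in>I. a i * c i)) \<and> Re (\<Sum>i\<in>I. a i * z i) < 0"
proof -
  define E where "E f = (\<Sum>i\<in>I. cscale (f i) (ell2_basis (to_nat i)))" for f :: "'i \<Rightarrow> complex"
  have rep: "Rep_ell2 (E f) (to_nat i) = f i" if "i \<in> I" for f i
    using that fin by (simp add: E_def if_distrib[of "\<lambda>c. _ * c"] cong: if_cong)
  have inn: "inner a (E f) = Re (\<Sum>i\<in>I. cnj (Rep_ell2 a (to_nat i)) * f i)" for a f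
    by (simp add: inner_ell2_def E_def cinner_sum_right mult.commute)
  have "E z \<notin> closure (E ` C)"
  proof
    assume "E z \<in> closure (E ` C)"
    then obtain c where c: "c \<in> C" "dist (E c) (E z) < e" using e unfolding closure_approachable by blast
    obtain i where i: "i \<in> I" "e \<le> cmod (c i - z i)" using far[OF c(1)] by blast
    have "cmod (c i - z i) \<le> norm (E c - E z)"
      using norm_Rep_le[of "E c - E z" "to_nat i"] i(1) by (simp add: rep)
    then show False using i c by (simp add: dist_norm)
  qed
  moreover have "0 \<in> E ` C" using C0 by (rule rev_image_eqI) (simp add: E_def)
  moreover have "x + y \<in> E ` C" if xy: "x \<in> E ` C" "y \<in> E ` C" for x y
  proof -
    from xy obtain f g where "x = E f" "f \<in> C" "y = E g" "g \<in> C" by blast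
    then show ?thesis using add[of f g] by (intro rev_image_eqI[of "\<lambda>i. f i + g i"])
        (auto simp: E_def cscale_add_left sum.distrib)
  qed
  moreover have "r *\<^sub>R x \<in> E ` C" if rx: "0 \<le> r" "x \<in> E ` C" for r x
  proof -
    from rx obtain f where "x = E f" "f \<in> C" by blast
    then show ?thesis using scale[OF rx(1), of f] by (intro rev_image_eqI[of "\<lambda>i. of_real r * f i"])
        (auto simp: E_def cscale_sum_right cscale_of_real[symmetric])
  qed
  ultimately obtain a where "\<forall>x\<in>E ` C. 0 \<le> inner a x" "inner a (E z) < 0"
    using cone_separation[of "E ` C" "E z"] by blast
  then show ?thesis by (intro exI[of _ "\<lambda>i. cnj (Rep_ell2 a (to_nat i))"]) (simp add: inn)
qed

section \<open>The Cholesky decomposition\<close>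

text \<open>Induction by Schur complements: the last diagonal entry is positive, and eliminating it
  leaves a positive definite form of size p. The inverse G is constructed along with R, as it is the
  change of variables wanted later.\<close>

lemma cholesky:
  fixes h :: "nat \<Rightarrow> nat \<Rightarrow> complex"
  assumes "\<And>k k'. k < p \<Longrightarrow> k' < p \<Longrightarrow> h k' k = cnj (h k k')"
    and "\<And>u. \<exists>k<p. u k \<noteq> 0 \<Longrightarrow> 0 < Re (\<Sum>k<p. \<Sum>k'<p. h k k' * u k * cnj (u k'))"
  shows "\<exists>R G. (\<forall>k<p. \<forall>k'<p. h k k' = (\<Sum>a<p. R a k * cnj (R a k'))) \<and>
     (\<forall>a<p. \<forall>b<p. (\<Sum>k<p. R a k * G k b) = (if a = b then 1 else 0)) \<and>
     (\<forall>k<p. \<forall>k'<p. (\<Sum>a<p. G k a * R a k') = (if k = k' then 1 else 0))"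
  using assms
proof (induction p arbitrary: h)
  case 0 show ?case by simp
next
  case (Suc p)
  note herm = Suc.prems(1) and pd = Suc.prems(2)
  define r where "r = Re (h p p)"
  have hpp: "h p p = of_real r" using herm[of p p] by (simp add: r_def complex_eq_iff)
  have r: "r > 0"
  proof -
    have "(\<Sum>k<Suc p. \<Sum>k'<Suc p. h k k' * (if k = p then 1 else 0) * cnj (if k' = p then 1 else 0)) = h p p"
      by (simp add: if_distrib[of cnj] if_distrib[of "\<lambda>c. _ * c"] cong: if_cong)
    then show ?thesis using pd[of "\<lambda>k. if k = p then 1 else 0"] by (auto simp: r_def simp del: sum.lessThan_Suc)
  qed
  have hk: "h p k = cnj (h k p)" if "k < p" for k using herm[of k p] that by simp
  define h' where "h' k k' = h k k' - h k p * h p k' / of_real r" for k k'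
  have "\<exists>R G. (\<forall>k<p. \<forall>k'<p. h' k k' = (\<Sum>a<p. R a k * cnj (R a k'))) \<and>
     (\<forall>a<p. \<forall>b<p. (\<Sum>k<p. R a k * G k b) = (if a = b then 1 else 0)) \<and>
     (\<forall>k<p. \<forall>k'<p. (\<Sum>a<p. G k a * R a k') = (if k = k' then 1 else 0))"
  proof (rule Suc.IH)
    show "h' k' k = cnj (h' k k')" if "k < p" "k' < p" for k k'
      using that herm[of k k'] by (simp add: h'_def hk)
    fix u :: "nat \<Rightarrow> complex" assume u: "\<exists>k<p. u k \<noteq> 0"
    define w where "w = (\<Sum>k<p. h k p * u k)"
    \<comment> \<open>The last coordinate minimises the form while the others are u; the minimum is
      the form of the Schur complement.\<close>
    define v where "v k = (if k < p then u k else - w / of_real r)" for k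
    have vu: "\<exists>k<Suc p. v k \<noteq> 0" using u by (force simp: v_def)
    have cw: "(\<Sum>k<p. h p k * cnj (u k)) = cnj w" by (simp add: w_def hk)
    have "(\<Sum>k<Suc p. \<Sum>k'<Suc p. h k k' * v k * cnj (v k')) =
       (\<Sum>k<p. \<Sum>k'<p. h k k' * u k * cnj (u k')) + (\<Sum>k<p. h k p * u k) * cnj (v p)
        + v p * (\<Sum>k'<p. h p k' * cnj (u k')) + of_real r * v p * cnj (v p)"
      by (simp add: sum.distrib sum_subtractf sum_negf sum_distrib_left sum_distrib_right v_def hpp ac_simps)
    also have "\<dots> = (\<Sum>k<p. \<Sum>k'<p. h k k' * u k * cnj (u k')) - w * cnj w / of_real r"
      unfolding w_def[symmetric] cw using r by (simp add: v_def[of p] field_simps)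
    also have "\<dots> = (\<Sum>k<p. \<Sum>k'<p. h' k k' * u k * cnj (u k'))"
    proof -
      have "w * cnj w = (\<Sum>k<p. \<Sum>k'<p. (h k p * u k) * (h p k' * cnj (u k')))"
        unfolding cw[symmetric] by (simp add: w_def sum_product)
      then have "w * cnj w / of_real r = (\<Sum>k<p. \<Sum>k'<p. h k p * h p k' / of_real r * u k * cnj (u k'))"
        by (simp add: sum_divide_distrib ac_simps)
      then show ?thesis by (simp add: h'_def left_diff_distrib sum_subtractf)
    qed
    finally show "0 < Re (\<Sum>k<p. \<Sum>k'<p. h' k k' * u k * cnj (u k'))" using pd[OF vu] by (simp only:)
  qed
  then obtain R' G' where
    RG: "(\<forall>k<p. \<forall>k'<p. h' k k' = (\<Sum>a<p. R' a k * cnj (R' a k'))) \<and>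
     (\<forall>a<p. \<forall>b<p. (\<Sum>k<p. R' a k * G' k b) = (if a = b then 1 else 0)) \<and>
     (\<forall>k<p. \<forall>k'<p. (\<Sum>a<p. G' k a * R' a k') = (if k = k' then 1 else 0))"
    by (elim exE) (rule that)
  note RR' = RG[THEN conjunct1, rule_format] and RG' = RG[THEN conjunct2, THEN conjunct1, rule_format]
    and GR' = RG[THEN conjunct2, THEN conjunct2, rule_format]
  define q :: complex where "q = of_real (sqrt r)"
  have q: "q * q = of_real r" "q \<noteq> 0" "cnj q = q" using r by (auto simp: q_def of_real_mult[symmetric] simp del: of_real_mult)
  define R where "R a k = (if a < p then (if k < p then R' a k else 0) else h k p / q)" for a k
  \<comment> \<open>The last row of the triangular inverse, determined by the vanishing of R G at
    the positions (p, b) with b < p.\<close>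
  define g where "g b = - (\<Sum>k<p. h k p / q * G' k b) / q" for b
  define G where "G k b = (if k < p then (if b < p then G' k b else 0) else if b < p then g b else 1 / q)" for k b
  have 1: "h k k' = (\<Sum>a<Suc p. R a k * cnj (R a k'))" if kk: "k < Suc p" "k' < Suc p" for k k'
  proof -
    have hh: "h k p * cnj (h k' p) / of_real r = R p k * cnj (R p k')"
      using q by (simp add: R_def)
    consider "k < p" "k' < p" | "k = p" | "k' = p" using kk unfolding less_Suc_eq by auto
    then show ?thesis
    proof cases
      case 1
      then have "h k k' = h' k k' + h k p * cnj (h k' p) / of_real r" by (simp add: h'_def hk)
      then show ?thesis using 1 by (simp add: RR' hh) (simp add: R_def)
    next
      case 2
      have "h p k' = cnj (h k' p)" by (rule herm) (use kk in auto)
      moreover have "R p k * cnj (R p k') = cnj (h k' p)" unfolding hh[symmetric] using 2 r by (simp add: hpp)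
      moreover have "(\<Sum>a<p. R a k * cnj (R a k')) = 0" using 2 by (simp add: R_def)
      ultimately show ?thesis using 2 by simp
    next
      case 3
      have "R p k * cnj (R p k') = h k p" unfolding hh[symmetric] using 3 r by (simp add: hpp)
      moreover have "(\<Sum>a<p. R a k * cnj (R a k')) = 0" using 3 by (simp add: R_def)
      ultimately show ?thesis using 3 by simp
    qed
  qed
  have 2: "(\<Sum>k<Suc p. R a k * G k b) = (if a = b then 1 else 0)" if kk: "a < Suc p" "b < Suc p" for a b
  proof -
    consider "a < p" "b < p" | "a < p" "b = p" | "a = p" "b < p" | "a = p" "b = p" using kk unfolding less_Suc_eq by auto
    then show ?thesis
    proof cases
      case 3
      then show ?thesis using q r by (simp add: R_def G_def g_def hpp)
    qed (use q r in \<open>simp_all add: R_def G_def RG' hpp\<close>)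
  qed
  have 3: "(\<Sum>a<Suc p. G k a * R a k') = (if k = k' then 1 else 0)" if kk: "k < Suc p" "k' < Suc p" for k k'
  proof -
    consider "k < p" "k' < p" | "k < p" "k' = p" | "k = p" "k' < p" | "k = p" "k' = p" using kk unfolding less_Suc_eq by auto
    then show ?thesis
    proof cases
      case 3
      have "(\<Sum>a<p. g a * R' a k') = - (\<Sum>k<p. h k p / q * (\<Sum>a<p. G' k a * R' a k')) / q"
        unfolding g_def sum_distrib_left sum_distrib_right sum_divide_distrib sum_negf[symmetric]
        by (subst sum.swap) (simp add: sum_divide_distrib sum_negf sum_distrib_right mult.assoc)
      also have "\<dots> = - (h k' p / q) / q" using 3 by (simp add: GR' if_distrib[of "\<lambda>c. _ * c"] cong: if_cong)
      finally show ?thesis using 3 q by (simp add: R_def G_def)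
    qed (use q r in \<open>simp_all add: R_def G_def GR' hpp\<close>)
  qed
  show ?case by (intro exI[of _ R] exI[of _ G] conjI allI impI 1 2 3)
qed

section \<open>Decomposition of completely contractive maps between matrix algebras\<close>

text \<open>Entry (k, k') of \<alpha> times its adjoint. The right factors \<beta> are stored
  transposed, with first index l, so that their column condition is also a condition on
  \<open>gram\<close>.\<close>

definition gram :: "nat \<Rightarrow> (nat \<Rightarrow> nat \<Rightarrow> complex) \<Rightarrow> nat \<Rightarrow> nat \<Rightarrow> complex" where
  "gram n \<alpha> k k' = (\<Sum>i<n. \<alpha> k i * cnj (\<alpha> k' i))"

text \<open>The squared norm of the row \<eta> \<alpha>. A bound C |\<eta>|^2 for a sum of these
  says that the sum of the Gram matrices has norm at most C.\<close>

definition row_sq :: "nat \<Rightarrow> nat \<Rightarrow> (nat \<Rightarrow> nat \<Rightarrow> complex) \<Rightarrow> (nat \<Rightarrow> complex) \<Rightarrow> real" where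
  "row_sq p n \<alpha> \<eta> = (\<Sum>i<n. (cmod (\<Sum>k<p. \<eta> k * \<alpha> k i))\<^sup>2)"

lemma complex_sum_square:
  "complex_of_real ((cmod (\<Sum>k<p. f k))\<^sup>2) = (\<Sum>k<p. \<Sum>k'<p. f k * cnj (f k'))"
  by (simp only: complex_norm_square cnj_sum sum_product)

lemma row_sq_gram: "complex_of_real (row_sq p n \<alpha> \<eta>) = (\<Sum>k<p. \<Sum>k'<p. \<eta> k * cnj (\<eta> k') * gram n \<alpha> k k')"
proof -
  have "complex_of_real (row_sq p n \<alpha> \<eta>) = (\<Sum>i<n. \<Sum>k<p. \<Sum>k'<p. \<eta> k * \<alpha> k i * cnj (\<eta> k' * \<alpha> k' i))"
    unfolding row_sq_def of_real_sum complex_sum_square ..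
  also have "\<dots> = (\<Sum>k<p. \<Sum>k'<p. \<Sum>i<n. \<eta> k * \<alpha> k i * cnj (\<eta> k' * \<alpha> k' i))"
    by (subst sum.swap, rule sum.cong[OF refl], rule sum.swap)
  also have "\<dots> = (\<Sum>k<p. \<Sum>k'<p. \<eta> k * cnj (\<eta> k') * gram n \<alpha> k k')"
    unfolding gram_def sum_distrib_left by (intro sum.cong refl) simp
  finally show ?thesis .
qed

text \<open>Only the Hermitian part of \<rho> enters the real part of its form. Adding \<delta>
  makes it positive definite, so that the Cholesky factor R is invertible.\<close>

lemma psd_factorization:
  assumes psd: "\<And>u. 0 \<le> Re (\<Sum>k<p. \<Sum>k'<p. \<rho> k k' * u k * cnj (u k'))" and d: "\<delta> > 0"
  obtains R G where
    "\<And>u. Re (\<Sum>k<p. \<Sum>k'<p. \<rho> k k' * u k * cnj (u k')) + \<delta> * (\<Sum>k<p. (cmod (u k))\<^sup>2) = (\<Sum>a<p. (cmod (\<Sum>k<p. R a k * u k))\<^sup>2)"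
    "(\<Sum>a<p. \<Sum>k<p. (cmod (R a k))\<^sup>2) = Re (\<Sum>k<p. \<rho> k k) + \<delta> * real p"
    "\<And>a b. a < p \<Longrightarrow> b < p \<Longrightarrow> (\<Sum>k<p. R a k * G k b) = (if a = b then 1 else 0)"
    "\<And>k k'. k < p \<Longrightarrow> k' < p \<Longrightarrow> (\<Sum>a<p. G k a * R a k') = (if k = k' then 1 else (0::complex))"
proof -
  define h where "h k k' = (\<rho> k k' + cnj (\<rho> k' k)) / 2 + (if k = k' then of_real \<delta> else 0)" for k k'
  have h: "(\<Sum>k<p. \<Sum>k'<p. h k k' * u k * cnj (u k')) =
     of_real (Re (\<Sum>k<p. \<Sum>k'<p. \<rho> k k' * u k * cnj (u k')) + \<delta> * (\<Sum>k<p. (cmod (u k))\<^sup>2))" for u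
  proof -
    let ?Q = "\<Sum>k<p. \<Sum>k'<p. \<rho> k k' * u k * cnj (u k')"
    have "cnj ?Q = (\<Sum>k'<p. \<Sum>k<p. cnj (\<rho> k k') * cnj (u k) * u k')"
      unfolding cnj_sum by (subst sum.swap) simp
    moreover have "(\<Sum>k<p. \<Sum>k'<p. (\<rho> k k' + cnj (\<rho> k' k)) / 2 * u k * cnj (u k')) =
       (\<Sum>k<p. \<Sum>k'<p. (\<rho> k k' * u k * cnj (u k') + cnj (\<rho> k' k) * cnj (u k') * u k) / 2)"
      by (intro sum.cong refl) (simp add: field_simps)
    ultimately have "(\<Sum>k<p. \<Sum>k'<p. (\<rho> k k' + cnj (\<rho> k' k)) / 2 * u k * cnj (u k')) = (?Q + cnj ?Q) / 2"
      by (simp only: sum_divide_distrib[symmetric] sum.distrib)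
    moreover have "(\<Sum>k<p. \<Sum>k'<p. (if k = k' then of_real \<delta> else 0) * u k * cnj (u k')) = of_real (\<delta> * (\<Sum>k<p. (cmod (u k))\<^sup>2))"
      unfolding of_real_mult of_real_sum complex_norm_square sum_distrib_left
      by (simp add: if_distrib[of "\<lambda>c. c * _"] mult.assoc cong: if_cong)
    moreover have "(z + cnj z) / 2 = of_real (Re z)" for z by (simp add: complex_eq_iff)
    ultimately show ?thesis by (simp only: h_def distrib_right sum.distrib of_real_add)
  qed
  have "\<exists>R G. (\<forall>k<p. \<forall>k'<p. h k k' = (\<Sum>a<p. R a k * cnj (R a k'))) \<and>
     (\<forall>a<p. \<forall>b<p. (\<Sum>k<p. R a k * G k b) = (if a = b then 1 else 0)) \<and>
     (\<forall>k<p. \<forall>k'<p. (\<Sum>a<p. G k a * R a k') = (if k = k' then 1 else 0))"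
  proof (rule cholesky)
    show "h k' k = cnj (h k k')" for k k' by (simp add: h_def add.commute)
    fix u :: "nat \<Rightarrow> complex" assume "\<exists>k<p. u k \<noteq> 0"
    then obtain k where k: "k < p" "u k \<noteq> 0" by blast
    have "0 < (cmod (u k))\<^sup>2" using k by simp
    also have "\<dots> \<le> (\<Sum>k<p. (cmod (u k))\<^sup>2)" using k by (intro member_le_sum) auto
    finally have "0 < \<delta> * (\<Sum>k<p. (cmod (u k))\<^sup>2)" using d by simp
    then show "0 < Re (\<Sum>k<p. \<Sum>k'<p. h k k' * u k * cnj (u k'))"
      unfolding h Re_complex_of_real using psd[of u] by linarith
  qed
  then obtain R G where RG: "(\<forall>k<p. \<forall>k'<p. h k k' = (\<Sum>a<p. R a k * cnj (R a k'))) \<and>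
     (\<forall>a<p. \<forall>b<p. (\<Sum>k<p. R a k * G k b) = (if a = b then 1 else 0)) \<and>
     (\<forall>k<p. \<forall>k'<p. (\<Sum>a<p. G k a * R a k') = (if k = k' then 1 else 0))"
    by (elim exE) (rule that)
  have 1: "Re (\<Sum>k<p. \<Sum>k'<p. \<rho> k k' * u k * cnj (u k')) + \<delta> * (\<Sum>k<p. (cmod (u k))\<^sup>2) = (\<Sum>a<p. (cmod (\<Sum>k<p. R a k * u k))\<^sup>2)" for u
  proof -
    have "complex_of_real (\<Sum>a<p. (cmod (\<Sum>k<p. R a k * u k))\<^sup>2) = (\<Sum>a<p. \<Sum>k<p. \<Sum>k'<p. R a k * u k * cnj (R a k' * u k'))"
      unfolding of_real_sum complex_sum_square ..
    also have "\<dots> = (\<Sum>k<p. \<Sum>k'<p. \<Sum>a<p. R a k * u k * cnj (R a k' * u k'))"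
      by (subst sum.swap, rule sum.cong[OF refl], rule sum.swap)
    also have "\<dots> = (\<Sum>k<p. \<Sum>k'<p. h k k' * u k * cnj (u k'))"
    proof (intro sum.cong refl)
      fix k k' assume "k \<in> {..<p}" "k' \<in> {..<p}"
      then have hR: "h k k' = (\<Sum>a<p. R a k * cnj (R a k'))" using RG by blast
      show "(\<Sum>a<p. R a k * u k * cnj (R a k' * u k')) = h k k' * u k * cnj (u k')"
        unfolding hR sum_distrib_right by (intro sum.cong refl) (simp add: ac_simps)
    qed
    finally show ?thesis unfolding h of_real_eq_iff by simp
  qed
  have 2: "(\<Sum>a<p. \<Sum>k<p. (cmod (R a k))\<^sup>2) = Re (\<Sum>k<p. \<rho> k k) + \<delta> * real p"
  proof -
    \<comment> \<open>The identity of the two forms, evaluated at the m-th unit vector.\<close>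
    have "(\<Sum>a<p. (cmod (R a m))\<^sup>2) = Re (\<rho> m m) + \<delta>" if m: "m < p" for m
    proof -
      have "(\<Sum>k<p. \<Sum>k'<p. \<rho> k k' * (if k = m then 1 else 0) * cnj (if k' = m then 1 else 0)) = \<rho> m m"
        using m by (simp add: if_distrib[of cnj] if_distrib[of "\<lambda>c. _ * c"] cong: if_cong)
      moreover have "(\<Sum>k<p. R a k * (if k = m then 1 else 0)) = R a m" for a
        using m by (simp add: if_distrib[of "\<lambda>c. _ * c"] cong: if_cong)
      moreover have "(\<Sum>k<p. (cmod (if k = m then 1 else 0))\<^sup>2) = 1"
        using m by (simp add: if_distrib[of cmod] if_distrib[of "\<lambda>c. c\<^sup>2"] cong: if_cong)
      ultimately show ?thesis using 1[of "\<lambda>k. if k = m then 1 else 0"] by simp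
    qed
    then show ?thesis by (subst sum.swap) (simp add: sum.distrib)
  qed
  show ?thesis by (rule that[of R G]) (use 1 2 RG in blast)+
qed

text \<open>As G R is the identity, T G R = T for a row T.\<close>

lemma biorthogonal_expansion:
  fixes R G :: "nat \<Rightarrow> nat \<Rightarrow> complex"
  assumes GR: "\<And>k k'. k < p \<Longrightarrow> k' < p \<Longrightarrow> (\<Sum>a<p. G k a * R a k') = (if k = k' then 1 else 0)" and k: "k < p"
  shows "(\<Sum>a<p. R a k * (\<Sum>k'<p. T k' * G k' a)) = T k"
proof -
  have "(\<Sum>a<p. R a k * (\<Sum>k'<p. T k' * G k' a)) = (\<Sum>k'<p. T k' * (\<Sum>a<p. G k' a * R a k))"
    unfolding sum_distrib_left by (subst sum.swap) (simp add: ac_simps)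
  also have "\<dots> = T k" using k by (simp add: GR if_distrib[of "\<lambda>c. _ * c"] cong: if_cong)
  finally show ?thesis .
qed

lemma cnj_sgn_mult: "cnj (sgn z) * z = complex_of_real (cmod z)"
proof (cases "z = 0")
  case False
  have "cnj z * z = of_real (cmod z) * of_real (cmod z)"
    using complex_norm_square[of z] by (simp add: power2_eq_square mult.commute)
  then show ?thesis using False by (simp add: sgn_eq)
qed simp

text \<open>Rotate and rescale \<open>U\<close> and \<open>V\<close>.\<close>

lemma arr_bound_of_quadratic:
  assumes fin: "finite I" "finite J"
    and quad: "\<And>U V. 0 \<le> (\<Sum>i\<in>I. (cmod (U i))\<^sup>2) + (\<Sum>j\<in>J. (cmod (V j))\<^sup>2) + 2 * Re (\<Sum>i\<in>I. \<Sum>j\<in>J. U i * c i j * V j)"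
  shows "arr_bound I J c 1"
proof (rule arr_boundI_form)
  fix \<eta> \<xi>
  let ?Q = "\<Sum>i\<in>I. \<Sum>j\<in>J. \<eta> i * c i j * \<xi> j"
  let ?E = "L2_set (\<lambda>i. cmod (\<eta> i)) I" and ?X = "L2_set (\<lambda>j. cmod (\<xi> j)) J"
  have E: "?E\<^sup>2 = (\<Sum>i\<in>I. (cmod (\<eta> i))\<^sup>2)" and X: "?X\<^sup>2 = (\<Sum>j\<in>J. (cmod (\<xi> j))\<^sup>2)"
    by (simp_all add: L2_set_def sum_nonneg)
  define w where "w = cnj (sgn ?Q)"
  have wQ: "w * ?Q = of_real (cmod ?Q)"
    unfolding w_def by (rule cnj_sgn_mult)
  have w: "cmod w \<le> 1" by (simp add: w_def norm_sgn)
  \<comment> \<open>The choice U = -s w \<eta> and V = t \<xi> turns the mixed term into -2 s t |Q|,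
    with s and t still free.\<close>
  have main: "2 * s * t * cmod ?Q \<le> s\<^sup>2 * ?E\<^sup>2 + t\<^sup>2 * ?X\<^sup>2" for s t
  proof -
    have "(\<Sum>i\<in>I. \<Sum>j\<in>J. (- of_real s * w * \<eta> i) * c i j * (of_real t * \<xi> j)) = - of_real (s * t) * (w * ?Q)"
      by (simp add: sum_distrib_left ac_simps)
    then have re: "Re (\<Sum>i\<in>I. \<Sum>j\<in>J. (- of_real s * w * \<eta> i) * c i j * (of_real t * \<xi> j)) = - (s * t * cmod ?Q)"
      unfolding wQ by simp
    have "(\<Sum>i\<in>I. (cmod (- of_real s * w * \<eta> i))\<^sup>2) = s\<^sup>2 * (cmod w)\<^sup>2 * ?E\<^sup>2"
      unfolding E sum_distrib_left by (simp add: norm_mult power_mult_distrib)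
    also have "\<dots> \<le> s\<^sup>2 * 1 * ?E\<^sup>2"
      using w by (intro mult_right_mono mult_left_mono power_le_one) auto
    finally have "(\<Sum>i\<in>I. (cmod (- of_real s * w * \<eta> i))\<^sup>2) \<le> s\<^sup>2 * ?E\<^sup>2" by simp
    moreover have "(\<Sum>j\<in>J. (cmod (of_real t * \<xi> j))\<^sup>2) = t\<^sup>2 * ?X\<^sup>2"
      unfolding X sum_distrib_left by (simp add: norm_mult power_mult_distrib)
    ultimately show ?thesis using quad[of "\<lambda>i. - of_real s * w * \<eta> i" "\<lambda>j. of_real t * \<xi> j"] unfolding re by linarith
  qed
  show "cmod ?Q \<le> 1 * ?E * ?X"
  proof (cases "?E = 0 \<or> ?X = 0")
    case True
    then have "?Q = 0"
    proof
      assume "?E = 0"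
      then have "\<eta> i = 0" if "i \<in> I" for i using that fin by (simp add: L2_set_eq_0_iff)
      then show ?thesis by simp
    next
      assume "?X = 0"
      then have "\<xi> j = 0" if "j \<in> J" for j using that fin by (simp add: L2_set_eq_0_iff)
      then show ?thesis by simp
    qed
    then show ?thesis by (simp add: L2_set_nonneg)
  next
    case False
    then have "?E > 0" "?X > 0"
      using L2_set_nonneg[of "\<lambda>i. cmod (\<eta> i)" I] L2_set_nonneg[of "\<lambda>j. cmod (\<xi> j)" J] by linarith+
    then have "?E * ?X > 0" by (rule mult_pos_pos)
    \<comment> \<open>Here s is the norm of \<xi> and t that of \<eta>, which makes the two square
      terms equal.\<close>
    moreover have "(?E * ?X) * cmod ?Q \<le> (?E * ?X) * (?E * ?X)"
      using main[of ?X ?E] by (simp add: power2_eq_square ac_simps)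
    ultimately have "cmod ?Q \<le> ?E * ?X" by (rule mult_left_le_imp_le[rotated])
    then show ?thesis by (simp only: mult_1)
  qed
qed simp

text \<open>The hypothesis says that the map \<open>\<Phi> : M\<^sub>n \<rightarrow> M\<^sub>p\<close> with matrix entries
  \<open>\<Phi>(E\<^sub>i\<^sub>j)\<^sub>k\<^sub>l = \<Phi> i j k l\<close> does not increase the norm of contractions in
  \<open>M\<^sub>p(M\<^sub>n)\<close>.\<close>

definition matrix_cc :: "nat \<Rightarrow> nat \<Rightarrow> (nat \<Rightarrow> nat \<Rightarrow> nat \<Rightarrow> nat \<Rightarrow> complex) \<Rightarrow> bool" where
  "matrix_cc n p \<Phi> \<longleftrightarrow> (\<forall>c. arr_bound ({..<p} \<times> {..<n}) ({..<p} \<times> {..<n}) c 1 \<longrightarrow>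
     arr_bound ({..<p} \<times> {..<p}) ({..<p} \<times> {..<p}) (\<lambda>(a, k) (b, l). \<Sum>i<n. \<Sum>j<n. c (a, i) (b, j) * \<Phi> i j k l) 1)"

text \<open>A linear functional that separates \<open>\<Phi>\<close> from the maps of the form \<open>\<Sum> \<alpha> \<cdot> \<beta>\<close>
  cannot exist: after normalising its two positive parts it becomes a contraction \<open>c\<close> in
  \<open>M\<^sub>p(M\<^sub>n)\<close> whose image under \<open>\<Phi>\<close> has norm greater than one.\<close>

lemma no_separating_functional:
  assumes cc: "matrix_cc n p \<Phi>" and n: "n > 0"
    and H: "\<And>\<alpha> \<beta>. 0 \<le> Re ((\<Sum>k<p. \<Sum>k'<p. \<rho> k k' * gram n \<alpha> k k') + (\<Sum>l<p. \<Sum>l'<p. \<sigma> l l' * gram n \<beta> l l')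
       + (\<Sum>i<n. \<Sum>j<n. \<Sum>k<p. \<Sum>l<p. F i j k l * (\<alpha> k i * \<beta> l j)))"
  shows "0 \<le> Re ((\<Sum>k<p. \<rho> k k) + (\<Sum>l<p. \<sigma> l l) + (\<Sum>i<n. \<Sum>j<n. \<Sum>k<p. \<Sum>l<p. F i j k l * \<Phi> i j k l))"
proof (rule ccontr)
  let ?N = "Re ((\<Sum>k<p. \<rho> k k) + (\<Sum>l<p. \<sigma> l l) + (\<Sum>i<n. \<Sum>j<n. \<Sum>k<p. \<Sum>l<p. F i j k l * \<Phi> i j k l))"
  assume "\<not> 0 \<le> ?N"
  then have N: "?N < 0" by simp
  \<comment> \<open>Small enough that adding \<delta> to both forms, which raises the two traces by
    2 p \<delta> in total, does not use up the gap -N.\<close>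
  define \<delta> where "\<delta> = - ?N / (2 * real p + 1)"
  have d: "\<delta> > 0" and d2: "2 * real p * \<delta> < - ?N"
    using N by (simp_all add: \<delta>_def field_simps del: sum.lessThan_Suc)
  have form: "(\<Sum>k<p. \<Sum>k'<p. \<rho> k k' * gram n \<alpha> k k') = (\<Sum>i<n. \<Sum>k<p. \<Sum>k'<p. \<rho> k k' * \<alpha> k i * cnj (\<alpha> k' i))" for \<rho> \<alpha>
  proof -
    have "(\<Sum>i<n. \<Sum>k<p. \<Sum>k'<p. \<rho> k k' * \<alpha> k i * cnj (\<alpha> k' i)) = (\<Sum>k<p. \<Sum>k'<p. \<Sum>i<n. \<rho> k k' * \<alpha> k i * cnj (\<alpha> k' i))"
      by (subst sum.swap, rule sum.cong[OF refl], rule sum.swap)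
    then show ?thesis by (simp add: gram_def sum_distrib_left mult.assoc)
  qed
  have g0: "gram n (\<lambda>_ _. 0) k k' = 0" for k k' by (simp add: gram_def)
  \<comment> \<open>A matrix whose only nonzero column is u isolates the form of \<rho> or \<sigma>;
    here n > 0 enters.\<close>
  have one: "(\<Sum>k<p. \<Sum>k'<p. \<rho> k k' * gram n (\<lambda>k i. if i = 0 then u k else 0) k k') = (\<Sum>k<p. \<Sum>k'<p. \<rho> k k' * u k * cnj (u k'))" for \<rho> u
    using n by (simp add: gram_def if_distrib[of cnj] if_distrib[of "\<lambda>c. _ * c"] mult.assoc cong: if_cong)
  have psd1: "0 \<le> Re (\<Sum>k<p. \<Sum>k'<p. \<rho> k k' * u k * cnj (u k'))" for u
    using H[of "\<lambda>k i. if i = 0 then u k else 0" "\<lambda>_ _. 0"] unfolding one g0 by simp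
  have psd2: "0 \<le> Re (\<Sum>k<p. \<Sum>k'<p. \<sigma> k k' * u k * cnj (u k'))" for u
    using H[of "\<lambda>_ _. 0" "\<lambda>k i. if i = 0 then u k else 0"] unfolding one g0 by simp
  obtain R G where R: "\<And>u. Re (\<Sum>k<p. \<Sum>k'<p. \<rho> k k' * u k * cnj (u k')) + \<delta> * (\<Sum>k<p. (cmod (u k))\<^sup>2) = (\<Sum>a<p. (cmod (\<Sum>k<p. R a k * u k))\<^sup>2)"
    and Rtr: "(\<Sum>a<p. \<Sum>k<p. (cmod (R a k))\<^sup>2) = Re (\<Sum>k<p. \<rho> k k) + \<delta> * real p"
    and RG: "\<And>a b. a < p \<Longrightarrow> b < p \<Longrightarrow> (\<Sum>k<p. R a k * G k b) = (if a = b then 1 else 0)"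
    and GR: "\<And>k k'. k < p \<Longrightarrow> k' < p \<Longrightarrow> (\<Sum>a<p. G k a * R a k') = (if k = k' then 1 else 0)"
    by (rule psd_factorization[OF psd1 d]) (rule that)
  obtain S K where S: "\<And>u. Re (\<Sum>k<p. \<Sum>k'<p. \<sigma> k k' * u k * cnj (u k')) + \<delta> * (\<Sum>k<p. (cmod (u k))\<^sup>2) = (\<Sum>a<p. (cmod (\<Sum>k<p. S a k * u k))\<^sup>2)"
    and Str: "(\<Sum>a<p. \<Sum>k<p. (cmod (S a k))\<^sup>2) = Re (\<Sum>k<p. \<sigma> k k) + \<delta> * real p"
    and SK: "\<And>a b. a < p \<Longrightarrow> b < p \<Longrightarrow> (\<Sum>k<p. S a k * K k b) = (if a = b then 1 else 0)"
    and KS: "\<And>k k'. k < p \<Longrightarrow> k' < p \<Longrightarrow> (\<Sum>a<p. K k a * S a k') = (if k = k' then 1 else 0)"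
    by (rule psd_factorization[OF psd2 d]) (rule that)
  \<comment> \<open>F in the coordinates in which both positive parts are dominated by the identity
    form. The factor 1/2 adapts the mixed term, which has coefficient 1 in the hypothesis and 2 in
    the criterion for contractions.\<close>
  define c where "c = (\<lambda>(a, i) (b, j). (\<Sum>k<p. (\<Sum>l<p. F i j k l * K l b) * G k a) / 2)"
  have "arr_bound ({..<p} \<times> {..<n}) ({..<p} \<times> {..<n}) c 1"
  proof (rule arr_bound_of_quadratic)
    fix U V :: "nat \<times> nat \<Rightarrow> complex"
    \<comment> \<open>Then R \<alpha> = U and S \<beta> = V, so the forms of \<rho> and \<sigma> at
      \<alpha> and \<beta> are at most the squared norms of U and V.\<close>
    define \<alpha> where "\<alpha> k i = (\<Sum>a<p. G k a * U (a, i))" for k i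
    define \<beta> where "\<beta> l j = (\<Sum>b<p. K l b * V (b, j))" for l j
    have R\<alpha>: "(\<Sum>k<p. R a k * \<alpha> k i) = U (a, i)" if "a < p" for a i
    proof -
      have "(\<Sum>k<p. R a k * \<alpha> k i) = (\<Sum>b<p. (\<Sum>k<p. R a k * G k b) * U (b, i))"
        unfolding \<alpha>_def sum_distrib_left sum_distrib_right by (subst sum.swap) (simp add: mult.assoc)
      then show ?thesis using that by (simp add: RG if_distrib[of "\<lambda>c. c * _"] cong: if_cong)
    qed
    have S\<beta>: "(\<Sum>k<p. S a k * \<beta> k i) = V (a, i)" if "a < p" for a i
    proof -
      have "(\<Sum>k<p. S a k * \<beta> k i) = (\<Sum>b<p. (\<Sum>k<p. S a k * K k b) * V (b, i))"
        unfolding \<beta>_def sum_distrib_left sum_distrib_right by (subst sum.swap) (simp add: mult.assoc)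
      then show ?thesis using that by (simp add: SK if_distrib[of "\<lambda>c. c * _"] cong: if_cong)
    qed
    have le1: "Re (\<Sum>k<p. \<Sum>k'<p. \<rho> k k' * gram n \<alpha> k k') \<le> (\<Sum>x\<in>{..<p} \<times> {..<n}. (cmod (U x))\<^sup>2)"
    proof -
      have "Re (\<Sum>k<p. \<Sum>k'<p. \<rho> k k' * \<alpha> k i * cnj (\<alpha> k' i)) \<le> (\<Sum>a<p. (cmod (U (a, i)))\<^sup>2)" for i
        using R[of "\<lambda>k. \<alpha> k i"] d by (simp add: R\<alpha>) (smt (verit) mult_nonneg_nonneg sum_nonneg zero_le_power2)
      then show ?thesis unfolding form Re_sum[of _ "{..<n}"] sum_pair by (subst sum.swap) (intro sum_mono)
    qed
    have le2: "Re (\<Sum>k<p. \<Sum>k'<p. \<sigma> k k' * gram n \<beta> k k') \<le> (\<Sum>x\<in>{..<p} \<times> {..<n}. (cmod (V x))\<^sup>2)"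
    proof -
      have "Re (\<Sum>k<p. \<Sum>k'<p. \<sigma> k k' * \<beta> k i * cnj (\<beta> k' i)) \<le> (\<Sum>a<p. (cmod (V (a, i)))\<^sup>2)" for i
        using S[of "\<lambda>k. \<beta> k i"] d by (simp add: S\<beta>) (smt (verit) mult_nonneg_nonneg sum_nonneg zero_le_power2)
      then show ?thesis unfolding form Re_sum[of _ "{..<n}"] sum_pair by (subst sum.swap) (intro sum_mono)
    qed
    have "(\<Sum>i<n. \<Sum>j<n. \<Sum>k<p. \<Sum>l<p. F i j k l * (\<alpha> k i * \<beta> l j)) =
        (\<Sum>i<n. \<Sum>j<n. \<Sum>k<p. \<Sum>l<p. \<Sum>a<p. \<Sum>b<p. U (a, i) * (F i j k l * K l b * G k a) * V (b, j))"
      unfolding \<alpha>_def \<beta>_def sum_product unfolding sum_distrib_left by (intro sum.cong refl) (simp add: ac_simps)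
    also have "\<dots> = (\<Sum>a<p. \<Sum>i<n. \<Sum>b<p. \<Sum>j<n. \<Sum>k<p. \<Sum>l<p. U (a, i) * (F i j k l * K l b * G k a) * V (b, j))"
    proof -
      have "(\<Sum>(i, j, k, l, a, b)\<in>{..<n} \<times> {..<n} \<times> {..<p} \<times> {..<p} \<times> {..<p} \<times> {..<p}. U (a, i) * (F i j k l * K l b * G k a) * V (b, j)) =
         (\<Sum>(a, i, b, j, k, l)\<in>{..<p} \<times> {..<n} \<times> {..<p} \<times> {..<n} \<times> {..<p} \<times> {..<p}. U (a, i) * (F i j k l * K l b * G k a) * V (b, j))"
        by (rule sum.reindex_bij_witness[of _ "\<lambda>(a, i, b, j, k, l). (i, j, k, l, a, b)" "\<lambda>(i, j, k, l, a, b). (a, i, b, j, k, l)"]) auto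
      then show ?thesis by (simp add: sum_pair)
    qed
    also have "\<dots> = 2 * (\<Sum>x\<in>{..<p} \<times> {..<n}. \<Sum>y\<in>{..<p} \<times> {..<n}. U x * c x y * V y)"
      by (simp add: sum_pair c_def sum_distrib_left sum_distrib_right sum_divide_distrib mult.assoc)
    finally have "Re (\<Sum>i<n. \<Sum>j<n. \<Sum>k<p. \<Sum>l<p. F i j k l * (\<alpha> k i * \<beta> l j)) =
       2 * Re (\<Sum>x\<in>{..<p} \<times> {..<n}. \<Sum>y\<in>{..<p} \<times> {..<n}. U x * c x y * V y)" by simp
    then show "0 \<le> (\<Sum>x\<in>{..<p} \<times> {..<n}. (cmod (U x))\<^sup>2) + (\<Sum>x\<in>{..<p} \<times> {..<n}. (cmod (V x))\<^sup>2) +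
        2 * Re (\<Sum>x\<in>{..<p} \<times> {..<n}. \<Sum>y\<in>{..<p} \<times> {..<n}. U x * c x y * V y)"
      using H[of \<alpha> \<beta>] le1 le2 by (simp only: plus_complex.sel)
  qed auto
  then have Y: "arr_bound ({..<p} \<times> {..<p}) ({..<p} \<times> {..<p}) (\<lambda>(a, k) (b, l). \<Sum>i<n. \<Sum>j<n. c (a, i) (b, j) * \<Phi> i j k l) 1"
    using cc unfolding matrix_cc_def by blast
  \<comment> \<open>R and S are used as vectors indexed by pairs. Pairing the image of c with them
    undoes the change of coordinates and leaves half the value of F at \<Phi>.\<close>
  let ?Z = "\<Sum>x\<in>{..<p} \<times> {..<p}. \<Sum>y\<in>{..<p} \<times> {..<p}. (case x of (a, k) \<Rightarrow> R a k) *
      (case x of (a, k) \<Rightarrow> \<lambda>(b, l). \<Sum>i<n. \<Sum>j<n. c (a, i) (b, j) * \<Phi> i j k l) y * (case y of (b, l) \<Rightarrow> S b l)"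
  have "?Z = (\<Sum>a<p. \<Sum>k<p. \<Sum>b<p. \<Sum>l<p. \<Sum>i<n. \<Sum>j<n. R a k * (c (a, i) (b, j) * \<Phi> i j k l) * S b l)"
    by (simp add: sum_pair sum_distrib_left sum_distrib_right)
  also have "\<dots> = (\<Sum>i<n. \<Sum>j<n. \<Sum>k<p. \<Sum>l<p. \<Sum>a<p. \<Sum>b<p. R a k * (c (a, i) (b, j) * \<Phi> i j k l) * S b l)"
  proof -
    have "(\<Sum>(a, k, b, l, i, j)\<in>{..<p} \<times> {..<p} \<times> {..<p} \<times> {..<p} \<times> {..<n} \<times> {..<n}. R a k * (c (a, i) (b, j) * \<Phi> i j k l) * S b l) =
       (\<Sum>(i, j, k, l, a, b)\<in>{..<n} \<times> {..<n} \<times> {..<p} \<times> {..<p} \<times> {..<p} \<times> {..<p}. R a k * (c (a, i) (b, j) * \<Phi> i j k l) * S b l)"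
      by (rule sum.reindex_bij_witness[of _ "\<lambda>(i, j, k, l, a, b). (a, k, b, l, i, j)" "\<lambda>(a, k, b, l, i, j). (i, j, k, l, a, b)"]) auto
    then show ?thesis by (simp add: sum_pair)
  qed
  also have "\<dots> = (\<Sum>i<n. \<Sum>j<n. \<Sum>k<p. \<Sum>l<p. F i j k l * \<Phi> i j k l / 2)"
  proof (intro sum.cong refl)
    fix i j k l assume "k \<in> {..<p}" "l \<in> {..<p}"
    then have k: "k < p" and l: "l < p" by auto
    have "(\<Sum>a<p. \<Sum>b<p. R a k * (c (a, i) (b, j) * \<Phi> i j k l) * S b l) =
       (\<Sum>b<p. S b l * (\<Sum>a<p. R a k * (\<Sum>k'<p. (\<Sum>l'<p. F i j k' l' * K l' b) * G k' a))) * \<Phi> i j k l / 2"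
      by (subst sum.swap) (simp add: c_def sum_distrib_left sum_distrib_right sum_divide_distrib ac_simps)
    also have "\<dots> = (\<Sum>b<p. S b l * (\<Sum>l'<p. F i j k l' * K l' b)) * \<Phi> i j k l / 2"
      by (simp only: biorthogonal_expansion[OF GR k])
    also have "\<dots> = F i j k l * \<Phi> i j k l / 2" by (simp only: biorthogonal_expansion[OF KS l])
    finally show "(\<Sum>a<p. \<Sum>b<p. R a k * (c (a, i) (b, j) * \<Phi> i j k l) * S b l) = F i j k l * \<Phi> i j k l / 2" .
  qed
  finally have "?Z = (\<Sum>i<n. \<Sum>j<n. \<Sum>k<p. \<Sum>l<p. F i j k l * \<Phi> i j k l) / 2"
    by (simp only: sum_divide_distrib)
  moreover have "z = w / 2 \<Longrightarrow> w = 2 * z" for z w :: complex by (auto simp: mult.commute)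
  ultimately have Z: "(\<Sum>i<n. \<Sum>j<n. \<Sum>k<p. \<Sum>l<p. F i j k l * \<Phi> i j k l) = 2 * ?Z" by blast
  let ?r = "L2_set (\<lambda>x. cmod (case x of (a, k) \<Rightarrow> R a k)) ({..<p} \<times> {..<p})"
    and ?s = "L2_set (\<lambda>x. cmod (case x of (a, k) \<Rightarrow> S a k)) ({..<p} \<times> {..<p})"
  have r2: "?r\<^sup>2 = Re (\<Sum>k<p. \<rho> k k) + \<delta> * real p"
    unfolding Rtr[symmetric] by (simp add: L2_set_def sum_nonneg sum_pair)
  have s2: "?s\<^sup>2 = Re (\<Sum>k<p. \<sigma> k k) + \<delta> * real p"
    unfolding Str[symmetric] by (simp add: L2_set_def sum_nonneg sum_pair)
  have "cmod ?Z \<le> 1 * ?r * ?s" by (rule arr_bound_form[OF Y])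
  then obtain z where z: "(\<Sum>i<n. \<Sum>j<n. \<Sum>k<p. \<Sum>l<p. F i j k l * \<Phi> i j k l) = 2 * z" "cmod z \<le> 1 * ?r * ?s"
    using Z by blast
  \<comment> \<open>The inequality of arithmetic and geometric means bounds 2 |z| by the two traces
    plus 2 p \<delta>, against the choice of \<delta>.\<close>
  have "- (2 * Re z) \<le> 2 * cmod z" using abs_Re_le_cmod[of z] by linarith
  also have "\<dots> \<le> 2 * ?r * ?s" using z(2) by simp
  also have "\<dots> \<le> ?r\<^sup>2 + ?s\<^sup>2" by (rule sum_squares_bound)
  finally have "- (2 * Re z) \<le> (Re (\<Sum>k<p. \<rho> k k) + \<delta> * real p) + (Re (\<Sum>k<p. \<sigma> k k) + \<delta> * real p)"
    unfolding r2 s2 .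
  moreover have "?N = Re (\<Sum>k<p. \<rho> k k) + Re (\<Sum>k<p. \<sigma> k k) + 2 * Re z" unfolding z(1) by simp
  moreover have "2 * real p * \<delta> = \<delta> * real p + \<delta> * real p" by simp
  ultimately show False using d2 by linarith
qed

text \<open>Lists of pairs make the cone explicit: sums are concatenations, and scaling by r
  multiplies both members of each pair by sqrt r. The three families of numbers form one vector over
  a sum type. The tolerance e appears because separation concerns the closure of the cone.\<close>

lemma matrix_cc_approx:
  assumes cc: "matrix_cc n p \<Phi>" and n: "n > 0" and e: "e > 0"
  obtains L where
    "\<And>k k'. k < p \<Longrightarrow> k' < p \<Longrightarrow> cmod ((\<Sum>(\<alpha>, \<beta>)\<leftarrow>L. gram n \<alpha> k k') - (if k = k' then 1 else 0)) < e"
    "\<And>k k'. k < p \<Longrightarrow> k' < p \<Longrightarrow> cmod ((\<Sum>(\<alpha>, \<beta>)\<leftarrow>L. gram n \<beta> k k') - (if k = k' then 1 else 0)) < e"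
    "\<And>i j k l. i < n \<Longrightarrow> j < n \<Longrightarrow> k < p \<Longrightarrow> l < p \<Longrightarrow>
       cmod ((\<Sum>(\<alpha>, \<beta>)\<leftarrow>L. \<alpha> k i * \<beta> l j) - \<Phi> i j k l) < e"
proof -
  let ?D = "\<lambda>k k'. if k = k' then 1 else 0 :: complex"
  let ?I = "({..<p} \<times> {..<p}) <+> (({..<p} \<times> {..<p}) <+> ({..<n} \<times> {..<n} \<times> {..<p} \<times> {..<p}))"
  define enc :: "(nat \<Rightarrow> nat \<Rightarrow> complex) \<Rightarrow> (nat \<Rightarrow> nat \<Rightarrow> complex) \<Rightarrow> (nat \<Rightarrow> nat \<Rightarrow> nat \<Rightarrow> nat \<Rightarrow> complex) \<Rightarrow>
      (nat \<times> nat) + ((nat \<times> nat) + (nat \<times> nat \<times> nat \<times> nat)) \<Rightarrow> complex"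
    where "enc g h f x = (case x of Inl (k, k') \<Rightarrow> g k k' | Inr (Inl (l, l')) \<Rightarrow> h l l' | Inr (Inr (i, j, k, l)) \<Rightarrow> f i j k l)"
    for g h f x
  define vec :: "((nat \<Rightarrow> nat \<Rightarrow> complex) \<times> (nat \<Rightarrow> nat \<Rightarrow> complex)) list \<Rightarrow> _ \<Rightarrow> complex"
    where "vec L = enc (\<lambda>k k'. \<Sum>(\<alpha>, \<beta>)\<leftarrow>L. gram n \<alpha> k k') (\<lambda>k k'. \<Sum>(\<alpha>, \<beta>)\<leftarrow>L. gram n \<beta> k k')
       (\<lambda>i j k l. \<Sum>(\<alpha>, \<beta>)\<leftarrow>L. \<alpha> k i * \<beta> l j)" for L
  have sumI: "(\<Sum>x\<in>?I. a x * enc g h f x) = (\<Sum>k<p. \<Sum>k'<p. a (Inl (k, k')) * g k k') +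
     (\<Sum>l<p. \<Sum>l'<p. a (Inr (Inl (l, l'))) * h l l') + (\<Sum>i<n. \<Sum>j<n. \<Sum>k<p. \<Sum>l<p. a (Inr (Inr (i, j, k, l))) * f i j k l)"
    for a g h f
    by (simp add: sum.Plus sum_pair enc_def add.assoc)
  have "\<exists>L. \<forall>x\<in>?I. cmod (vec L x - enc ?D ?D \<Phi> x) < e"
  proof (rule ccontr)
    assume "\<not> ?thesis"
    then have far: "\<exists>x\<in>?I. e \<le> cmod (c x - enc ?D ?D \<Phi> x)" if "c \<in> range vec" for c
      using that by (auto simp: not_less)
    have "\<exists>a. (\<forall>c\<in>range vec. 0 \<le> Re (\<Sum>x\<in>?I. a x * c x)) \<and> Re (\<Sum>x\<in>?I. a x * enc ?D ?D \<Phi> x) < 0"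
    proof (rule cone_separation_fun[OF _ _ _ _ e far])
      show "finite ?I" by (intro finite_Plus) auto
      have "vec [] = (\<lambda>_. 0)" by (auto simp: vec_def enc_def split: sum.splits)
      then show "(\<lambda>_. 0) \<in> range vec" by (metis rangeI)
    next
      fix f g assume "f \<in> range vec" "g \<in> range vec"
      then obtain L M where "f = vec L" "g = vec M" by blast
      then have "(\<lambda>x. f x + g x) = vec (L @ M)" by (auto simp: vec_def enc_def split: sum.splits)
      then show "(\<lambda>x. f x + g x) \<in> range vec" by simp
    next
      fix r :: real and f assume r: "0 \<le> r" and "f \<in> range vec"
      then obtain L where f: "f = vec L" by blast
      let ?s = "\<lambda>\<alpha> k i. complex_of_real (sqrt r) * \<alpha> k i"
      have rr: "complex_of_real (sqrt r) * x * (complex_of_real (sqrt r) * y) = of_real r * (x * y)" for x y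
      proof -
        have "complex_of_real (sqrt r) * complex_of_real (sqrt r) = of_real r"
          using r by (simp add: of_real_mult[symmetric] del: of_real_mult)
        then show ?thesis by (metis (no_types) mult.assoc mult.left_commute)
      qed
      have gr: "gram n (?s \<alpha>) k k' = of_real r * gram n \<alpha> k k'" for \<alpha> k k'
        by (simp add: gram_def sum_distrib_left rr)
      let ?M = "map (\<lambda>(\<alpha>, \<beta>). (?s \<alpha>, ?s \<beta>)) L"
      have "(\<Sum>(\<alpha>, \<beta>)\<leftarrow>?M. gram n \<alpha> k k') = of_real r * (\<Sum>(\<alpha>, \<beta>)\<leftarrow>L. gram n \<alpha> k k')"
        "(\<Sum>(\<alpha>, \<beta>)\<leftarrow>?M. gram n \<beta> k k') = of_real r * (\<Sum>(\<alpha>, \<beta>)\<leftarrow>L. gram n \<beta> k k')"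
        "(\<Sum>(\<alpha>, \<beta>)\<leftarrow>?M. \<alpha> k i * \<beta> l j) = of_real r * (\<Sum>(\<alpha>, \<beta>)\<leftarrow>L. \<alpha> k i * \<beta> l j)" for k k' i j l
        by (induction L) (auto simp: gr rr distrib_left)
      then have "(\<lambda>x. of_real r * f x) = vec ?M"
        unfolding f by (auto simp: vec_def enc_def split: sum.splits)
      then show "(\<lambda>x. of_real r * f x) \<in> range vec" by simp
    qed
    then obtain a where a: "\<And>L. 0 \<le> Re (\<Sum>x\<in>?I. a x * vec L x)" "Re (\<Sum>x\<in>?I. a x * enc ?D ?D \<Phi> x) < 0"
      by blast
    have "0 \<le> Re ((\<Sum>k<p. a (Inl (k, k))) + (\<Sum>l<p. a (Inr (Inl (l, l)))) +
       (\<Sum>i<n. \<Sum>j<n. \<Sum>k<p. \<Sum>l<p. a (Inr (Inr (i, j, k, l))) * \<Phi> i j k l))"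
    proof (rule no_separating_functional[OF cc n, where \<rho> = "\<lambda>k k'. a (Inl (k, k'))" and \<sigma> = "\<lambda>l l'. a (Inr (Inl (l, l')))"])
      fix \<alpha> \<beta>
      show "0 \<le> Re ((\<Sum>k<p. \<Sum>k'<p. a (Inl (k, k')) * gram n \<alpha> k k') + (\<Sum>l<p. \<Sum>l'<p. a (Inr (Inl (l, l'))) * gram n \<beta> l l')
       + (\<Sum>i<n. \<Sum>j<n. \<Sum>k<p. \<Sum>l<p. a (Inr (Inr (i, j, k, l))) * (\<alpha> k i * \<beta> l j)))"
        using a(1)[of "[(\<alpha>, \<beta>)]"] unfolding vec_def sumI by simp
    qed
    moreover have "(\<Sum>k'<p. f k' * (if k = k' then 1 else 0)) = f k" if "k < p" for k and f :: "nat \<Rightarrow> complex"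
      using that by (simp add: if_distrib[of "\<lambda>c. _ * c"] cong: if_cong)
    ultimately show False using a(2) unfolding sumI by simp
  qed
  then obtain L where L: "\<And>x. x \<in> ?I \<Longrightarrow> cmod (vec L x - enc ?D ?D \<Phi> x) < e" by blast
  show ?thesis
  proof (rule that)
    show "cmod ((\<Sum>(\<alpha>, \<beta>)\<leftarrow>L. gram n \<alpha> k k') - (if k = k' then 1 else 0)) < e" if "k < p" "k' < p" for k k'
      using L[OF InlI, of "(k, k')"] that by (simp add: vec_def enc_def)
    show "cmod ((\<Sum>(\<alpha>, \<beta>)\<leftarrow>L. gram n \<beta> k k') - (if k = k' then 1 else 0)) < e" if "k < p" "k' < p" for k k'
      using L[OF InrI, OF InlI, of "(k, k')"] that by (simp add: vec_def enc_def)
    show "cmod ((\<Sum>(\<alpha>, \<beta>)\<leftarrow>L. \<alpha> k i * \<beta> l j) - \<Phi> i j k l) < e" if "i < n" "j < n" "k < p" "l < p" for i j k l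
      using L[OF InrI, OF InrI, of "(i, j, k, l)"] that by (simp add: vec_def enc_def)
  qed
qed

text \<open>Each deviation is weighted by |\<eta> k| |\<eta> k'|, at most the mean of the two
  squares; summing over both indices gives p e |\<eta>|^2.\<close>

lemma gram_close_row_bound:
  assumes close: "\<And>k k'. k < p \<Longrightarrow> k' < p \<Longrightarrow> cmod (g k k' - (if k = k' then 1 else 0)) \<le> e" and e: "0 \<le> e"
  shows "Re (\<Sum>k<p. \<Sum>k'<p. \<eta> k * cnj (\<eta> k') * g k k') \<le> (1 + real p * e) * (\<Sum>k<p. (cmod (\<eta> k))\<^sup>2)"
proof -
  let ?n = "\<Sum>k<p. (cmod (\<eta> k))\<^sup>2"
  have "(\<Sum>k<p. \<Sum>k'<p. \<eta> k * cnj (\<eta> k') * (if k = k' then 1 else 0)) = of_real ?n"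
    unfolding of_real_sum complex_norm_square by (simp add: if_distrib[of "\<lambda>c. _ * c"] cong: if_cong)
  then have eq: "(\<Sum>k<p. \<Sum>k'<p. \<eta> k * cnj (\<eta> k') * g k k') =
     of_real ?n + (\<Sum>k<p. \<Sum>k'<p. \<eta> k * cnj (\<eta> k') * (g k k' - (if k = k' then 1 else 0)))"
    by (simp add: right_diff_distrib sum_subtractf)
  have "Re (of_real r + z) \<le> r + cmod z" for r z using complex_Re_le_cmod[of z] by simp
  from this[of ?n "\<Sum>k<p. \<Sum>k'<p. \<eta> k * cnj (\<eta> k') * (g k k' - (if k = k' then 1 else 0))"]
  have "Re (\<Sum>k<p. \<Sum>k'<p. \<eta> k * cnj (\<eta> k') * g k k') \<le>
      ?n + cmod (\<Sum>k<p. \<Sum>k'<p. \<eta> k * cnj (\<eta> k') * (g k k' - (if k = k' then 1 else 0)))"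
    by (simp only: eq)
  also have "cmod (\<Sum>k<p. \<Sum>k'<p. \<eta> k * cnj (\<eta> k') * (g k k' - (if k = k' then 1 else 0))) \<le>
      (\<Sum>k<p. \<Sum>k'<p. ((cmod (\<eta> k))\<^sup>2 + (cmod (\<eta> k'))\<^sup>2) / 2 * e)"
  proof (rule order_trans[OF norm_sum], rule sum_mono, rule order_trans[OF norm_sum], rule sum_mono)
    fix k k' assume kk: "k \<in> {..<p}" "k' \<in> {..<p}"
    have "cmod (\<eta> k) * cmod (\<eta> k') \<le> ((cmod (\<eta> k))\<^sup>2 + (cmod (\<eta> k'))\<^sup>2) / 2"
      using sum_squares_bound[of "cmod (\<eta> k)" "cmod (\<eta> k')"] by simp
    then show "cmod (\<eta> k * cnj (\<eta> k') * (g k k' - (if k = k' then 1 else 0))) \<le> ((cmod (\<eta> k))\<^sup>2 + (cmod (\<eta> k'))\<^sup>2) / 2 * e"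
      unfolding norm_mult complex_mod_cnj using close kk e by (intro mult_mono) auto
  qed
  also have "\<dots> = real p * e * ?n"
    by (simp add: sum_distrib_left sum_distrib_right sum_divide_distrib[symmetric] sum.distrib algebra_simps)
  finally show ?thesis by (simp add: distrib_right)
qed

lemma list_row_sq_le:
  assumes close: "\<And>k k'. k < p \<Longrightarrow> k' < p \<Longrightarrow> cmod ((\<Sum>x\<leftarrow>L. gram n (f x) k k') - (if k = k' then 1 else 0)) < e" and e: "0 \<le> e"
  shows "(\<Sum>x\<leftarrow>L. row_sq p n (f x) \<eta>) \<le> (1 + real p * e) * (\<Sum>k<p. (cmod (\<eta> k))\<^sup>2)"
proof -
  have "complex_of_real (\<Sum>x\<leftarrow>L. row_sq p n (f x) \<eta>) = (\<Sum>k<p. \<Sum>k'<p. \<eta> k * cnj (\<eta> k') * (\<Sum>x\<leftarrow>L. gram n (f x) k k'))"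
    by (induction L) (simp_all add: row_sq_gram distrib_left sum.distrib)
  then have "(\<Sum>x\<leftarrow>L. row_sq p n (f x) \<eta>) = Re (\<Sum>k<p. \<Sum>k'<p. \<eta> k * cnj (\<eta> k') * (\<Sum>x\<leftarrow>L. gram n (f x) k k'))"
    by (metis Re_complex_of_real)
  then show ?thesis using gram_close_row_bound[of p "\<lambda>k k'. \<Sum>x\<leftarrow>L. gram n (f x) k k'" e \<eta>] close e
    by (simp only: less_imp_le)
qed

text \<open>The error of the approximation is itself a sum of elementary terms with small coefficients,
  so that an exact decomposition results.\<close>

theorem matrix_cc_decomposition:
  assumes cc: "matrix_cc n p \<Phi>" and n: "n > 0" and e: "e > 0"
  obtains L where
    "\<And>i j k l. i < n \<Longrightarrow> j < n \<Longrightarrow> k < p \<Longrightarrow> l < p \<Longrightarrow> \<Phi> i j k l = (\<Sum>x\<leftarrow>L. fst x k i * snd x l j)"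
    "\<And>\<eta>. (\<Sum>x\<leftarrow>L. row_sq p n (fst x) \<eta>) \<le> (1 + e) * (\<Sum>k<p. (cmod (\<eta> k))\<^sup>2)"
    "\<And>\<eta>. (\<Sum>x\<leftarrow>L. row_sq p n (snd x) \<eta>) \<le> (1 + e) * (\<Sum>k<p. (cmod (\<eta> k))\<^sup>2)"
proof -
  \<comment> \<open>The summand p comes from the Gram matrices of the approximation, the summand n n
    p from the correction list, in which each row index belongs to n n p members.\<close>
  let ?C = "real p + real n * real n * real p"
  define d where "d = e / (?C + 1)"
  have C0: "0 \<le> ?C" by simp
  then have "0 < ?C + 1" by linarith
  then have d: "d > 0" and "(?C + 1) * d = e" using e by (simp_all add: d_def)
  then have d2: "?C * d \<le> e" by (simp only: distrib_right)
  obtain L where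
    L1: "\<And>k k'. k < p \<Longrightarrow> k' < p \<Longrightarrow> cmod ((\<Sum>(\<alpha>, \<beta>)\<leftarrow>L. gram n \<alpha> k k') - (if k = k' then 1 else 0)) < d"
    and L2: "\<And>k k'. k < p \<Longrightarrow> k' < p \<Longrightarrow> cmod ((\<Sum>(\<alpha>, \<beta>)\<leftarrow>L. gram n \<beta> k k') - (if k = k' then 1 else 0)) < d"
    and L3: "\<And>i j k l. i < n \<Longrightarrow> j < n \<Longrightarrow> k < p \<Longrightarrow> l < p \<Longrightarrow>
       cmod ((\<Sum>(\<alpha>, \<beta>)\<leftarrow>L. \<alpha> k i * \<beta> l j) - \<Phi> i j k l) < d"
    by (rule matrix_cc_approx[OF cc n d]) (rule that)
  define \<Psi> where "\<Psi> i j k l = \<Phi> i j k l - (\<Sum>x\<leftarrow>L. fst x k i * snd x l j)" for i j k l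
  define s where "s = sqrt d"
  have s: "s > 0" "s\<^sup>2 = d" using d by (auto simp: s_def)
  have \<Psi>: "cmod (\<Psi> i j k l / of_real s) \<le> s" if "i < n" "j < n" "k < p" "l < p" for i j k l
  proof -
    have "cmod (\<Psi> i j k l) \<le> s\<^sup>2"
      using L3[OF that] by (simp add: \<Psi>_def s case_prod_unfold norm_minus_commute less_imp_le)
    then show ?thesis using s(1) by (simp add: norm_divide field_simps power2_eq_square)
  qed
  \<comment> \<open>Each entry \<Psi> of the error is written as s times \<Psi> / s with s = sqrt d,
    so that both factors are at most s in modulus and contribute at most d.\<close>
  define A where "A q = (case q of (i, j, k, l) \<Rightarrow> \<lambda>k' i'. if k' = k \<and> i' = i then complex_of_real s else 0)"
    for q :: "nat \<times> nat \<times> nat \<times> nat"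
  define B where "B q = (case q of (i, j, k, l) \<Rightarrow> \<lambda>l' j'. if l' = l \<and> j' = j then \<Psi> i j k l / of_real s else 0)"
    for q :: "nat \<times> nat \<times> nat \<times> nat"
  let ?Q = "List.product [0..<n] (List.product [0..<n] (List.product [0..<p] [0..<p]))"
  define M where "M = map (\<lambda>q. (A q, B q)) ?Q"
  have sumM: "(\<Sum>x\<leftarrow>M. f x) = (\<Sum>i<n. \<Sum>j<n. \<Sum>k<p. \<Sum>l<p. f (A (i, j, k, l), B (i, j, k, l)))"
    for f :: "_ \<Rightarrow> 'b::comm_monoid_add"
  proof -
    have "distinct ?Q" by (intro distinct_product distinct_upt)
    then have "(\<Sum>x\<leftarrow>M. f x) = (\<Sum>q\<in>set ?Q. f (A q, B q))"
      by (simp add: M_def o_def sum_list_distinct_conv_sum_set)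
    then show ?thesis by (simp add: sum_pair lessThan_atLeast0)
  qed
  show ?thesis
  proof (rule that[of "L @ M"])
    fix i j k l assume ij: "i < n" "j < n" "k < p" "l < p"
    have "(\<Sum>x\<leftarrow>M. fst x k i * snd x l j) = (\<Sum>i'<n. \<Sum>j'<n. \<Sum>k'<p. \<Sum>l'<p.
       if l' = l then if k' = k then if j' = j then if i' = i then \<Psi> i j k l else 0 else 0 else 0 else 0)"
      unfolding sumM using s(1) by (intro sum.cong refl) (auto simp: A_def B_def)
    also have "\<dots> = \<Psi> i j k l" using ij by (simp cong: if_cong)
    finally show "\<Phi> i j k l = (\<Sum>x\<leftarrow>L @ M. fst x k i * snd x l j)" by (simp add: \<Psi>_def)
  next
    fix \<eta> :: "nat \<Rightarrow> complex"
    let ?n = "\<Sum>k<p. (cmod (\<eta> k))\<^sup>2"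
    have tot: "(1 + real p * d) * ?n + real n * real n * real p * (d * ?n) \<le> (1 + e) * ?n"
    proof -
      have "(1 + real p * d) * ?n + real n * real n * real p * (d * ?n) = (1 + ?C * d) * ?n" by (simp add: algebra_simps)
      also have "\<dots> \<le> (1 + e) * ?n" using d2 by (intro mult_right_mono sum_nonneg) auto
      finally show ?thesis .
    qed
    have r1: "row_sq p n (A (i, j, k, l)) \<eta> \<le> d * (cmod (\<eta> k))\<^sup>2" if "i < n" "j < n" "k < p" "l < p" for i j k l
    proof -
      have "(\<Sum>k'<p. \<eta> k' * A (i, j, k, l) k' i') = (if i' = i then \<eta> k * of_real s else 0)" for i'
        using that by (simp add: A_def if_distrib[of "\<lambda>c. _ * c"] cong: if_cong)
      then show ?thesis using that s
        by (simp add: row_sq_def if_distrib[of cmod] if_distrib[of "\<lambda>c. c\<^sup>2"] norm_mult power_mult_distrib cong: if_cong)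
    qed
    have r2: "row_sq p n (B (i, j, k, l)) \<eta> \<le> d * (cmod (\<eta> l))\<^sup>2" if "i < n" "j < n" "k < p" "l < p" for i j k l
    proof -
      have "(\<Sum>k'<p. \<eta> k' * B (i, j, k, l) k' i') = (if i' = j then \<eta> l * (\<Psi> i j k l / of_real s) else 0)" for i'
        using that by (simp add: B_def if_distrib[of "\<lambda>c. _ * c"] cong: if_cong)
      then have "row_sq p n (B (i, j, k, l)) \<eta> = (cmod (\<Psi> i j k l / of_real s))\<^sup>2 * (cmod (\<eta> l))\<^sup>2" using that
        by (simp add: row_sq_def if_distrib[of cmod] if_distrib[of "\<lambda>c. c\<^sup>2"] norm_mult norm_divide power_mult_distrib power_divide cong: if_cong)
      also have "\<dots> \<le> s\<^sup>2 * (cmod (\<eta> l))\<^sup>2" by (intro mult_right_mono power_mono \<Psi> that) auto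
      finally show ?thesis using s by simp
    qed
    have "(\<Sum>x\<leftarrow>M. row_sq p n (fst x) \<eta>) \<le> (\<Sum>i<n. \<Sum>j<n. \<Sum>k<p. \<Sum>l<p. d * (cmod (\<eta> k))\<^sup>2)"
      unfolding sumM using r1 by (intro sum_mono) auto
    also have "\<dots> = real n * real n * real p * (d * ?n)" by (simp add: sum_distrib_left mult.assoc)
    finally have "(\<Sum>x\<leftarrow>M. row_sq p n (fst x) \<eta>) \<le> real n * real n * real p * (d * ?n)" .
    moreover have "(\<Sum>x\<leftarrow>L. row_sq p n (fst x) \<eta>) \<le> (1 + real p * d) * ?n"
      using L1 d by (intro list_row_sq_le) (auto simp: case_prod_unfold)
    ultimately show "(\<Sum>x\<leftarrow>L @ M. row_sq p n (fst x) \<eta>) \<le> (1 + e) * ?n" using tot by simp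
    have "(\<Sum>x\<leftarrow>M. row_sq p n (snd x) \<eta>) \<le> (\<Sum>i<n. \<Sum>j<n. \<Sum>k<p. \<Sum>l<p. d * (cmod (\<eta> l))\<^sup>2)"
      unfolding sumM using r2 by (intro sum_mono) auto
    also have "\<dots> = real n * real n * real p * (d * ?n)" by (simp add: sum_distrib_left mult.assoc)
    finally have "(\<Sum>x\<leftarrow>M. row_sq p n (snd x) \<eta>) \<le> real n * real n * real p * (d * ?n)" .
    moreover have "(\<Sum>x\<leftarrow>L. row_sq p n (snd x) \<eta>) \<le> (1 + real p * d) * ?n"
      using L2 d by (intro list_row_sq_le) (auto simp: case_prod_unfold)
    ultimately show "(\<Sum>x\<leftarrow>L @ M. row_sq p n (snd x) \<eta>) \<le> (1 + e) * ?n" using tot by simp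
  qed
qed

section \<open>Amplifications of completely contractive maps to abstract operator spaces\<close>

text \<open>All elements that occur below are linear combinations of the entries of one fixed matrix; to
  work with their coefficient functions avoids manipulations of sums in the operator space.\<close>

definition lin_comb :: "'a opspace \<Rightarrow> nat \<Rightarrow> 'a mat \<Rightarrow> (nat \<times> nat \<Rightarrow> complex) \<Rightarrow> 'a" where
  "lin_comb X n b c = finsum X (\<lambda>ij. c ij \<odot>\<^bsub>X\<^esub> b $$ ij) ({..<n} \<times> {..<n})"

context operator_space begin

lemma scale_closed [simp]: "a \<in> carrier X \<Longrightarrow> (c::complex) \<odot> a \<in> carrier X"
  using smult_closed[of c a] by simp

lemma scale_simps:
  "a \<in> carrier X \<Longrightarrow> (c + d :: complex) \<odot> a = c \<odot> a \<oplus> d \<odot> a"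
  "a \<in> carrier X \<Longrightarrow> (c * d :: complex) \<odot> a = c \<odot> (d \<odot> a)"
  "a \<in> carrier X \<Longrightarrow> b \<in> carrier X \<Longrightarrow> (c :: complex) \<odot> (a \<oplus> b) = c \<odot> a \<oplus> c \<odot> b"
  "a \<in> carrier X \<Longrightarrow> (0 :: complex) \<odot> a = \<zero>"
  "a \<in> carrier X \<Longrightarrow> (1 :: complex) \<odot> a = a"
  "(c :: complex) \<odot> \<zero> = \<zero>"
  using smult_l_distr[of c d a] smult_assoc1[of c d a] smult_r_distr[of c a b] smult_l_null[of a] smult_one[of a]
    smult_r_null[of c] by auto

lemma lin_comb_closed [simp]: "b \<in> Mats n X \<Longrightarrow> lin_comb X n b c \<in> carrier X"
  unfolding lin_comb_def by (rule finsum_closed) (auto intro!: scale_closed dest: MatsD(4))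

lemma lin_comb_add:
  assumes "b \<in> Mats n X"
  shows "lin_comb X n b (\<lambda>ij. c ij + d ij) = lin_comb X n b c \<oplus> lin_comb X n b d"
  unfolding lin_comb_def
  by (subst finsum_addf[symmetric]) (auto intro!: finsum_cong' scale_closed simp: scale_simps MatsD[OF assms])

lemma lin_comb_cong:
  assumes "b \<in> Mats n X" "\<And>i j. i < n \<Longrightarrow> j < n \<Longrightarrow> c (i, j) = d (i, j)"
  shows "lin_comb X n b c = lin_comb X n b d"
  unfolding lin_comb_def using assms(2)
  by (intro finsum_cong') (auto intro!: scale_closed simp: MatsD[OF assms(1)])

lemma lin_comb_zero:
  assumes "b \<in> Mats n X"
  shows "lin_comb X n b (\<lambda>_. 0) = \<zero>"
  unfolding lin_comb_def
  by (rule trans[OF finsum_cong'[where g = "\<lambda>_. \<zero>"]]) (auto simp: scale_simps MatsD[OF assms])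

lemma lin_comb_scale:
  assumes b: "b \<in> Mats n X"
  shows "lin_comb X n b (\<lambda>ij. r * c ij) = r \<odot> lin_comb X n b c"
proof -
  have "finsum X (\<lambda>ij. (r * c ij) \<odot> b $$ ij) I = r \<odot> finsum X (\<lambda>ij. c ij \<odot> b $$ ij) I"
    if "finite I" "I \<subseteq> {..<n} \<times> {..<n}" for I
    using that
  proof (induction I)
    case (insert p I)
    have bI: "b $$ q \<in> carrier X" if "q \<in> insert p I" for q
      using insert.prems that MatsD(4)[OF b] by (cases q) auto
    have bI': "(\<lambda>ij. c ij \<odot> b $$ ij) \<in> I \<rightarrow> carrier X" "(\<lambda>ij. (r * c ij) \<odot> b $$ ij) \<in> I \<rightarrow> carrier X"
      using bI by auto
    show ?case
      using insert bI bI' finsum_closed[OF bI'(1)] by (simp add: scale_simps)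
  qed (simp add: scale_simps)
  then show ?thesis by (simp add: lin_comb_def)
qed

lemma lin_comb_delta:
  assumes b: "b \<in> Mats n X" and ij: "i < n" "j < n"
  shows "lin_comb X n b (\<lambda>p. if p = (i, j) then 1 else 0) = b $$ (i, j)"
proof -
  have "lin_comb X n b (\<lambda>p. if p = (i, j) then 1 else 0) =
      finsum X (\<lambda>p. if (i, j) = p then b $$ p else \<zero>) ({..<n} \<times> {..<n})"
    unfolding lin_comb_def by (intro finsum_cong') (auto simp: scale_simps MatsD[OF b])
  also have "\<dots> = b $$ (i, j)"
    using ij by (intro finsum_singleton) (auto simp: MatsD[OF b])
  finally show ?thesis .
qed

lemma lin_comb_sum:
  assumes b: "b \<in> Mats n X" and "finite S"
  shows "lin_comb X n b (\<lambda>ij. \<Sum>s\<in>S. c s ij) = finsum X (\<lambda>s. lin_comb X n b (c s)) S"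
  using assms(2)
proof (induction S)
  case (insert s S)
  then show ?case using b by (simp add: lin_comb_add Pi_def)
qed (simp add: lin_comb_zero[OF b])

definition block_copies :: "nat \<Rightarrow> nat \<Rightarrow> 'a mat \<Rightarrow> 'a mat" where
  "block_copies N n b = Matrix.mat (N * n) (N * n)
     (\<lambda>(s, t). if s div n = t div n then b $$ (s mod n, t mod n) else \<zero>)"

text \<open>One more copy is a direct sum, and the maximum of equal norms is unchanged.\<close>

lemma block_copies:
  assumes n: "n > 0" and b: "b \<in> Mats n X" and N: "N > 0"
  shows "block_copies N n b \<in> Mats (N * n) X \<and> mnorm X (block_copies N n b) = mnorm X b"
  using N
proof (induction N rule: nat_induct_non_zero)
  case 1
  have "block_copies 1 n b = b"
    by (rule eq_matI) (auto simp: block_copies_def MatsD[OF b])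
  then show ?case using b by simp
next
  case (Suc N)
  have mats: "block_copies M n b \<in> Mats (M * n) X" for M
    using n by (intro MatsI) (auto simp: block_copies_def MatsD[OF b])
  have "block_copies (Suc N) n b = mat_dsum X (block_copies N n b) b"
  proof (rule eq_matI)
    fix s t
    assume st: "s < dim_row (mat_dsum X (block_copies N n b) b)" "t < dim_col (mat_dsum X (block_copies N n b) b)"
    have hi: "r div n = N" "r mod n = r - N * n" if r: "r < N * n + n" "\<not> r < N * n" for r
    proof -
      obtain k where k: "r = N * n + k" using r le_iff_add[of "N * n" r] by auto
      then have "k < n" using r by simp
      then show "r div n = N" "r mod n = r - N * n" using k by auto
    qed
    have lo: "r div n < N" if "r < N * n" for r using that by (simp add: less_mult_imp_div_less)
    have bd: "s < N * n + n" "t < N * n + n"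
      using st by (auto simp: mat_dsum_def block_copies_def MatsD[OF b])
    have "block_copies (Suc N) n b $$ (s, t) = (if s div n = t div n then b $$ (s mod n, t mod n) else \<zero>)"
      using bd by (simp add: block_copies_def add.commute)
    also have "\<dots> = (if s < N * n then if t < N * n then if s div n = t div n then b $$ (s mod n, t mod n) else \<zero> else \<zero>
        else if t < N * n then \<zero> else b $$ (s - N * n, t - N * n))"
      using lo[of s] lo[of t] hi[OF bd(1)] hi[OF bd(2)] by (cases "s < N * n"; cases "t < N * n") simp_all
    also have "\<dots> = mat_dsum X (block_copies N n b) b $$ (s, t)"
      using bd by (simp add: mat_dsum_def block_copies_def MatsD[OF b] mat_zero_def)
    finally show "block_copies (Suc N) n b $$ (s, t) = mat_dsum X (block_copies N n b) b $$ (s, t)" .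
  qed (auto simp: mat_dsum_def block_copies_def MatsD[OF b])
  then have "mnorm X (block_copies (Suc N) n b) = max (mnorm X (block_copies N n b)) (mnorm X b)"
    using mnorm_dsum[OF _ n mats b, of N] Suc.hyps n by simp
  then show ?case using Suc.IH mats[of "Suc N"] by simp
qed

end

section \<open>Realisation of an elementary sum by one sandwich\<close>

lemma arr_bound_transpose:
  assumes "arr_bound I J A K" "0 \<le> K"
  shows "arr_bound J I (\<lambda>j i. A i j) K"
proof (rule arr_boundI_form[OF _ assms(2)])
  fix \<eta> \<xi>
  have "(\<Sum>j\<in>J. \<Sum>i\<in>I. \<eta> j * A i j * \<xi> i) = (\<Sum>i\<in>I. \<Sum>j\<in>J. \<xi> i * A i j * \<eta> j)"
    by (subst sum.swap) (simp add: ac_simps)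
  then show "cmod (\<Sum>j\<in>J. \<Sum>i\<in>I. \<eta> j * A i j * \<xi> i) \<le> K * L2_set (\<lambda>j. cmod (\<eta> j)) J * L2_set (\<lambda>i. cmod (\<xi> i)) I"
    using arr_bound_form[OF assms(1), of \<xi> \<eta>] by (simp add: ac_simps)
qed

lemma sum_flatten:
  fixes g :: "nat \<Rightarrow> nat \<Rightarrow> 'b::comm_monoid_add"
  assumes "n > 0"
  shows "(\<Sum>s<N * n. g (s div n) (s mod n)) = (\<Sum>q<N. \<Sum>i<n. g q i)"
proof -
  have "(\<Sum>s<N * n. g (s div n) (s mod n)) =
      (\<Sum>x\<in>{..<N} \<times> {..<n}. g ((case x of (a, k) \<Rightarrow> a * n + k) div n) ((case x of (a, k) \<Rightarrow> a * n + k) mod n))"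
    by (rule sum.reindex_bij_betw[OF bij_betw_flatten[OF assms], symmetric])
  then show ?thesis by (simp add: sum_pair)
qed

text \<open>The array stacks the transposes of the blocks f q and pads them with zero columns up to
  m; the squared norm of its product with \<xi> is the sum of the \<open>row_sq\<close>
  values.\<close>

lemma arr_bound_rows:
  assumes n: "n > 0" and K: "0 \<le> K" and pm: "p \<le> m"
    and le: "\<And>\<eta>. (\<Sum>q<N. row_sq p n (f q) \<eta>) \<le> K\<^sup>2 * (\<Sum>k<p. (cmod (\<eta> k))\<^sup>2)"
  shows "arr_bound {..<N * n} {..<m} (\<lambda>s k. if k < p then f (s div n) k (s mod n) else 0) K"
  unfolding arr_bound_sq[OF K]
proof
  fix \<xi> :: "nat \<Rightarrow> complex"
  have "(\<Sum>k<m. (if k < p then g k else 0) * \<xi> k) = (\<Sum>k<p. \<xi> k * g k)" for g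
  proof -
    have "(\<Sum>k<m. (if k < p then g k else 0) * \<xi> k) = (\<Sum>k\<in>{..<m} \<inter> {..<p}. \<xi> k * g k)"
      unfolding sum.inter_restrict[OF finite_lessThan] by (intro sum.cong) auto
    moreover have "{..<m} \<inter> {..<p} = {..<p}" using pm by auto
    ultimately show ?thesis by simp
  qed
  then have "(\<Sum>s<N * n. (cmod (\<Sum>k<m. (if k < p then f (s div n) k (s mod n) else 0) * \<xi> k))\<^sup>2) =
      (\<Sum>q<N. row_sq p n (f q) \<xi>)"
    by (simp add: row_sq_def sum_flatten[OF n, of "\<lambda>q i. (cmod (\<Sum>k<p. \<xi> k * f q k i))\<^sup>2"])
  also have "\<dots> \<le> K\<^sup>2 * (\<Sum>k<p. (cmod (\<xi> k))\<^sup>2)" by (rule le)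
  also have "\<dots> \<le> K\<^sup>2 * (\<Sum>k<m. (cmod (\<xi> k))\<^sup>2)"
    using pm by (intro mult_left_mono sum_mono2) auto
  finally show "(\<Sum>s<N * n. (cmod (\<Sum>k<m. (if k < p then f (s div n) k (s mod n) else 0) * \<xi> k))\<^sup>2)
     \<le> K\<^sup>2 * (\<Sum>k<m. (cmod (\<xi> k))\<^sup>2)" .
qed

context operator_space begin

text \<open>The image of b is A c B, where c consists of N diagonal copies of b, A is the row of all
  \<alpha> q and B the column of all transposed \<beta> q. Ruan's inequality is about square
  matrices, so A and B are padded with zeros to size m = N n. The product is then the direct sum of
  the image and a zero block of size m - p, nonempty since p < N n.\<close>

lemma elementary_amplification_le:
  assumes n: "n > 0" and p: "p > 0" and b: "b \<in> Mats n X" and Np: "p < N * n" and K: "0 \<le> K"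
    and \<Phi>: "\<And>i j k l. i < n \<Longrightarrow> j < n \<Longrightarrow> k < p \<Longrightarrow> l < p \<Longrightarrow> \<Phi> i j k l = (\<Sum>q<N. \<alpha> q k i * \<beta> q l j)"
    and \<alpha>: "\<And>\<eta>. (\<Sum>q<N. row_sq p n (\<alpha> q) \<eta>) \<le> K\<^sup>2 * (\<Sum>k<p. (cmod (\<eta> k))\<^sup>2)"
    and \<beta>: "\<And>\<eta>. (\<Sum>q<N. row_sq p n (\<beta> q) \<eta>) \<le> K\<^sup>2 * (\<Sum>k<p. (cmod (\<eta> k))\<^sup>2)"
  shows "mnorm X (Matrix.mat p p (\<lambda>(k, l). lin_comb X n b (\<lambda>(i, j). \<Phi> i j k l))) \<le> K\<^sup>2 * mnorm X b"
proof -
  define m where "m = N * n"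
  let ?w = "Matrix.mat p p (\<lambda>(k, l). lin_comb X n b (\<lambda>(i, j). \<Phi> i j k l))"
  let ?f = "\<lambda>\<gamma> s k. if k < p then \<gamma> (s div n) k (s mod n) else (0::complex)"
  define A where "A = Matrix.mat m m (\<lambda>(k, s). ?f \<alpha> s k)"
  define B where "B = Matrix.mat m m (\<lambda>(t, l). ?f \<beta> t l)"
  have N0: "N > 0" using Np by (cases N) auto
  have m: "p < m" "m > 0" unfolding m_def by (rule Np) (use Np in linarith)
  have A: "A \<in> carrier_mat m m" and B: "B \<in> carrier_mat m m" by (auto simp: A_def B_def)
  have bd: "arr_bound {..<m} {..<m} (?f \<gamma>) K"
    if "\<And>\<eta>. (\<Sum>q<N. row_sq p n (\<gamma> q) \<eta>) \<le> K\<^sup>2 * (\<Sum>k<p. (cmod (\<eta> k))\<^sup>2)" for \<gamma>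
    using arr_bound_rows[OF n K _ that, of m] m by (simp add: m_def)
  have "arr_bound {..<m} {..<m} (\<lambda>i j. A $$ (i, j)) K"
    by (rule arr_bound_cong[THEN iffD1, OF _ arr_bound_transpose[OF bd[OF \<alpha>] K]]) (auto simp: A_def)
  then have nA: "cmat_norm A \<le> K" using A by (simp add: cmat_norm_le_iff[OF K])
  have "arr_bound {..<m} {..<m} (\<lambda>i j. B $$ (i, j)) K"
    by (rule arr_bound_cong[THEN iffD1, OF _ bd[OF \<beta>]]) (auto simp: B_def)
  then have nB: "cmat_norm B \<le> K" using B by (simp add: cmat_norm_le_iff[OF K])
  let ?c = "block_copies N n b"
  have c: "?c \<in> Mats m X" "mnorm X ?c = mnorm X b" using block_copies[OF n b N0] by (auto simp: m_def)
  \<comment> \<open>Coefficient function of entry (s, t) of the block matrix: a matrix unit within a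
    diagonal block, zero elsewhere.\<close>
  define \<delta> where "\<delta> s t ij = (if s div n = t div n \<and> ij = (s mod n, t mod n) then 1 else (0::complex))" for s t ij
  have cL: "?c $$ (s, t) = lin_comb X n b (\<delta> s t)" if "s < m" "t < m" for s t
  proof (cases "s div n = t div n")
    case True
    then have "\<delta> s t = (\<lambda>ij. if ij = (s mod n, t mod n) then 1 else 0)" by (auto simp: \<delta>_def)
    then show ?thesis using that True n by (simp add: block_copies_def m_def lin_comb_delta[OF b])
  next
    case False
    then have "\<delta> s t = (\<lambda>ij. 0)" by (auto simp: \<delta>_def)
    then show ?thesis using that False by (simp add: block_copies_def m_def lin_comb_zero[OF b])
  qed
  have entry: "mat_sandwich X A ?c B $$ (k, l) = lin_comb X n b (\<lambda>ij. \<Sum>s<m. \<Sum>t<m. (A $$ (k, s) * B $$ (t, l)) * \<delta> s t ij)"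
    if "k < m" "l < m" for k l
  proof -
    have "mat_sandwich X A ?c B $$ (k, l) =
       finsum X (\<lambda>s. finsum X (\<lambda>t. (A $$ (k, s) * B $$ (t, l)) \<odot> ?c $$ (s, t)) {..<m}) {..<m}"
      using that A B by (simp add: mat_sandwich_def MatsD[OF c(1)])
    also have "\<dots> = finsum X (\<lambda>s. finsum X (\<lambda>t. lin_comb X n b (\<lambda>ij. (A $$ (k, s) * B $$ (t, l)) * \<delta> s t ij)) {..<m}) {..<m}"
      using b by (intro finsum_cong' refl) (auto simp: lin_comb_scale cL intro!: finsum_cong')
    also have "\<dots> = finsum X (\<lambda>s. lin_comb X n b (\<lambda>ij. \<Sum>t<m. (A $$ (k, s) * B $$ (t, l)) * \<delta> s t ij)) {..<m}"
      using b by (intro finsum_cong' refl) (auto simp: lin_comb_sum)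
    also have "\<dots> = lin_comb X n b (\<lambda>ij. \<Sum>s<m. \<Sum>t<m. (A $$ (k, s) * B $$ (t, l)) * \<delta> s t ij)"
      by (rule lin_comb_sum[OF b, symmetric]) simp
    finally show ?thesis .
  qed
  have w: "?w \<in> Mats p X" using b by (intro MatsI) auto
  let ?z = "mat_zero X (m - p) (m - p)"
  have z: "?z \<in> Mats (m - p) X" by (intro MatsI) (auto simp: mat_zero_def)
  have "mat_sandwich X A ?c B = mat_dsum X ?w ?z"
  proof (rule eq_matI)
    fix k l assume "k < dim_row (mat_dsum X ?w ?z)" "l < dim_col (mat_dsum X ?w ?z)"
    then have kl: "k < m" "l < m" using m by (auto simp: mat_dsum_def mat_zero_def)
    show "mat_sandwich X A ?c B $$ (k, l) = mat_dsum X ?w ?z $$ (k, l)"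
    proof (cases "k < p \<and> l < p")
      case True
      have "(\<Sum>s<m. \<Sum>t<m. (A $$ (k, s) * B $$ (t, l)) * \<delta> s t (i, j)) = \<Phi> i j k l" if "i < n" "j < n" for i j
      proof -
        have "(\<Sum>s<m. \<Sum>t<m. (A $$ (k, s) * B $$ (t, l)) * \<delta> s t (i, j)) =
          (\<Sum>s<m. \<Sum>t<m. (\<alpha> (s div n) k (s mod n) * \<beta> (t div n) l (t mod n)) *
             (if s div n = t div n \<and> i = s mod n \<and> j = t mod n then 1 else 0))"
          using True kl by (intro sum.cong refl) (auto simp: A_def B_def \<delta>_def)
        also have "\<dots> = (\<Sum>q<N. \<Sum>i'<n. \<Sum>q'<N. \<Sum>j'<n. (\<alpha> q k i' * \<beta> q' l j') * (if q = q' \<and> i = i' \<and> j = j' then 1 else 0))"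
          unfolding m_def
            sum_flatten[OF n, of "\<lambda>q' j'. (\<alpha> (_ div n) k (_ mod n) * \<beta> q' l j') * (if _ div n = q' \<and> i = _ mod n \<and> j = j' then 1 else 0)"]
          by (rule sum_flatten[OF n, of "\<lambda>q i'. \<Sum>q'<N. \<Sum>j'<n. (\<alpha> q k i' * \<beta> q' l j') * (if q = q' \<and> i = i' \<and> j = j' then 1 else 0)"])
        also have "\<dots> = (\<Sum>q<N. \<Sum>i'<n. \<Sum>q'<N. \<Sum>j'<n. if j = j' then if q = q' then if i = i' then \<alpha> q k i * \<beta> q l j else 0 else 0 else 0)"
          by (intro sum.cong refl) auto
        also have "\<dots> = \<Phi> i j k l" using that True by (simp add: \<Phi> cong: if_cong)
        finally show ?thesis .
      qed
      then show ?thesis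
        unfolding entry[OF kl] using True kl m
        by (simp add: mat_dsum_def mat_zero_def) (rule lin_comb_cong[OF b], simp)
    next
      case False
      then have "A $$ (k, s) * B $$ (t, l) = 0" if "s < m" "t < m" for s t
        using that kl by (auto simp: A_def B_def)
      then have "(\<lambda>ij. \<Sum>s<m. \<Sum>t<m. (A $$ (k, s) * B $$ (t, l)) * \<delta> s t ij) = (\<lambda>_. 0)"
        by (intro ext sum.neutral ballI) (metis lessThan_iff mult_zero_left)
      then have "lin_comb X n b (\<lambda>ij. \<Sum>s<m. \<Sum>t<m. (A $$ (k, s) * B $$ (t, l)) * \<delta> s t ij) = \<zero>"
        by (simp add: lin_comb_zero[OF b])
      then show ?thesis
        unfolding entry[OF kl] using False kl m by (auto simp: mat_dsum_def mat_zero_def)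
    qed
  qed (use A B m in \<open>auto simp: mat_sandwich_def mat_dsum_def mat_zero_def\<close>)
  moreover have "mnorm X (mat_dsum X ?w ?z) = max (mnorm X ?w) (mnorm X ?z)"
    using m by (intro mnorm_dsum[OF p _ w z]) simp
  ultimately have "mnorm X ?w \<le> mnorm X (mat_sandwich X A ?c B)" by simp
  also have "\<dots> \<le> cmat_norm A * mnorm X ?c * cmat_norm B"
    by (rule mnorm_sandwich[OF m(2) c(1) A B])
  also have "\<dots> \<le> K * mnorm X b * K"
    using nA nB K mnorm_nonneg[OF n b] unfolding c(2)
    by (intro mult_mono mult_nonneg_nonneg cmat_norm_nonneg) auto
  finally show ?thesis by (simp add: power2_eq_square ac_simps)
qed

text \<open>The decomposition is available with constant 1 + d for every d > 0, which makes both
  factors of the sandwich of norm at most sqrt (1 + d).\<close>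

theorem amplification_le:
  assumes n: "n > 0" and p: "p > 0" and b: "b \<in> Mats n X" and cc: "matrix_cc n p \<Phi>"
  shows "mnorm X (Matrix.mat p p (\<lambda>(k, l). lin_comb X n b (\<lambda>(i, j). \<Phi> i j k l))) \<le> mnorm X b"
proof (rule field_le_epsilon)
  fix e :: real assume e: "e > 0"
  define d where "d = e / (mnorm X b + 1)"
  have nb: "0 \<le> mnorm X b" by (rule mnorm_nonneg[OF n b])
  have d: "d > 0" and "(mnorm X b + 1) * d = e" using e nb by (simp_all add: d_def)
  then have de: "d * mnorm X b \<le> e" by (simp only: distrib_right mult.commute[of d])
  obtain L where
    L1: "\<And>i j k l. i < n \<Longrightarrow> j < n \<Longrightarrow> k < p \<Longrightarrow> l < p \<Longrightarrow> \<Phi> i j k l = (\<Sum>x\<leftarrow>L. fst x k i * snd x l j)"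
    and L2: "\<And>\<eta>. (\<Sum>x\<leftarrow>L. row_sq p n (fst x) \<eta>) \<le> (1 + d) * (\<Sum>k<p. (cmod (\<eta> k))\<^sup>2)"
    and L3: "\<And>\<eta>. (\<Sum>x\<leftarrow>L. row_sq p n (snd x) \<eta>) \<le> (1 + d) * (\<Sum>k<p. (cmod (\<eta> k))\<^sup>2)"
    by (rule matrix_cc_decomposition[OF cc n d]) (rule that)
  \<comment> \<open>Zero terms are appended to make the block matrix larger than \<open>p\<close>, because the direct sum
    axiom needs a nonempty second block.\<close>
  define M where "M = L @ replicate (Suc p) (\<lambda>_ _. 0, \<lambda>_ _. 0)"
  have M: "(\<Sum>x\<leftarrow>M. f x) = (\<Sum>q<length M. f (M ! q))" for f :: "_ \<Rightarrow> 'c::comm_monoid_add"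
    by (simp add: sum_list_sum_nth lessThan_atLeast0)
  have pad: "(\<Sum>x\<leftarrow>L. f x) = (\<Sum>q<length M. f (M ! q))" if "f (\<lambda>_ _. 0, \<lambda>_ _. 0) = 0" for f :: "_ \<Rightarrow> 'c::comm_monoid_add"
  proof -
    have "(\<Sum>x\<leftarrow>replicate k (\<lambda>_ _. 0, \<lambda>_ _. 0). f x) = 0" for k using that by (induction k) auto
    then have "(\<Sum>x\<leftarrow>M. f x) = (\<Sum>x\<leftarrow>L. f x)" by (simp only: M_def map_append sum_list_append add_0_right)
    then show ?thesis by (simp only: M)
  qed
  have "p < length M" by (simp add: M_def)
  also have "length M \<le> length M * n" using n by simp
  finally have "p < length M * n" .
  moreover have "0 \<le> sqrt (1 + d)" "(sqrt (1 + d))\<^sup>2 = 1 + d" using d by auto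
  ultimately have "mnorm X (Matrix.mat p p (\<lambda>(k, l). lin_comb X n b (\<lambda>(i, j). \<Phi> i j k l))) \<le> (sqrt (1 + d))\<^sup>2 * mnorm X b"
    by (intro elementary_amplification_le[OF n p b, where \<alpha> = "\<lambda>q. fst (M ! q)" and \<beta> = "\<lambda>q. snd (M ! q)" and N = "length M"])
       (use L1 L2 L3 in \<open>simp_all add: pad row_sq_def\<close>)
  also have "\<dots> \<le> mnorm X b + e" using de d by (simp add: distrib_right)
  finally show "mnorm X (Matrix.mat p p (\<lambda>(k, l). lin_comb X n b (\<lambda>(i, j). \<Phi> i j k l))) \<le> mnorm X b + e" .
qed

end

section \<open>Maps from $T(\ell_2)$ with prescribed values\<close>

lemma complete_contraction_iff:
  "complete_contraction X Y u \<longleftrightarrow> u \<in> module_hom class_ring X Y \<and>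
     (\<forall>n>0. \<forall>x\<in>Mats n X. mnorm X x \<le> 1 \<longrightarrow> mnorm Y (map_mat u x) \<le> 1)"
  using cb_norm_le_iff[of 1 X Y u] by (simp add: complete_contraction_def)

lemma module_hom_iff:
  "u \<in> module_hom (class_ring :: complex ring) X Y \<longleftrightarrow> (\<forall>a\<in>carrier X. u a \<in> carrier Y) \<and>
     (\<forall>a\<in>carrier X. \<forall>b\<in>carrier X. u (a \<oplus>\<^bsub>X\<^esub> b) = u a \<oplus>\<^bsub>Y\<^esub> u b) \<and>
     (\<forall>c. \<forall>a\<in>carrier X. u (c \<odot>\<^bsub>X\<^esub> a) = c \<odot>\<^bsub>Y\<^esub> u a)"
  by (auto simp: module_hom_def)

lemma norm_sum_basis_le:
  assumes "finite I"
  shows "(norm (\<Sum>i\<in>I. cscale (z i) (ell2_basis i)))\<^sup>2 \<le> (\<Sum>i\<in>I. (cmod (z i))\<^sup>2)"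
proof -
  let ?v = "\<Sum>i\<in>I. cscale (z i) (ell2_basis i)" and ?S = "\<Sum>i\<in>I. (cmod (z i))\<^sup>2"
  have S0: "0 \<le> ?S" by (simp add: sum_nonneg)
  have rep: "Rep_ell2 ?v m = (if m \<in> I then z m else 0)" for m
    using assms by (simp add: if_distrib[of "\<lambda>c. _ * c"] cong: if_cong)
  have "norm ?v \<le> sqrt ?S"
  proof (rule norm_ell2_bound)
    fix N
    have "(\<Sum>m<N. (cmod (Rep_ell2 ?v m))\<^sup>2) = (\<Sum>m\<in>{..<N} \<inter> I. (cmod (z m))\<^sup>2)"
      unfolding rep sum.inter_restrict[OF finite_lessThan] by (intro sum.cong) auto
    also have "\<dots> \<le> ?S" using assms by (intro sum_mono2) auto
    finally show "(\<Sum>m<N. (cmod (Rep_ell2 ?v m))\<^sup>2) \<le> (sqrt ?S)\<^sup>2" using S0 by simp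
  qed (simp add: S0)
  then show ?thesis using S0 by (metis norm_ge_zero power_mono real_sqrt_pow2)
qed

text \<open>A contraction c in M_p(M_n) is placed in the upper left corners of operators on l2 and
  becomes a contraction x in M_p(B(l2)). Applying the completely contractive map given by t to x
  yields the image of c.\<close>

lemma coefficients_matrix_cc:
  assumes p: "p > 0" and t: "t \<in> Mats p T_ell2" and le: "mnorm T_ell2 t \<le> 1"
  shows "matrix_cc n p (\<lambda>i j k l. Rep_ell2 ((t $$ (k, l)) (ell2_basis i)) j)"
  unfolding matrix_cc_def
proof (intro allI impI)
  fix c :: "nat \<times> nat \<Rightarrow> nat \<times> nat \<Rightarrow> complex"
  assume c: "arr_bound ({..<p} \<times> {..<n}) ({..<p} \<times> {..<n}) c 1"
  have cb: "cb_bound p t 1" using mnorm_T_le_iff[OF p t, of 1] le by simp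
  define x where "x = Matrix.mat p p (\<lambda>(a, b) v. \<Sum>i<n. \<Sum>j<n. cscale (c (a, i) (b, j)) (butterfly (ell2_basis i) (ell2_basis j) v))"
  have x: "x \<in> Mats p B_ell2"
    by (rule MatsI) (auto simp: x_def intro!: bounded_clinear_sum bounded_clinear_cscale bounded_clinear_butterfly)
  have "op_mat_norm x \<le> 1"
  proof (rule Mats_B_unitI[OF x])
    fix \<xi> :: "nat \<Rightarrow> ell2"
    have eq: "(\<Sum>b<p. (x $$ (a, b)) (\<xi> b)) =
       (\<Sum>i<n. cscale (\<Sum>q\<in>{..<p} \<times> {..<n}. c (a, i) q * (case q of (b, j) \<Rightarrow> Rep_ell2 (\<xi> b) j)) (ell2_basis i))"
      if "a < p" for a
    proof -
      have sc: "(\<Sum>b\<in>J. cscale (f b) v) = cscale (sum f J) v" for f :: "nat \<Rightarrow> complex" and J v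
        by (rule ell2_eqI) (simp add: sum_distrib_right)
      have "(\<Sum>b<p. (x $$ (a, b)) (\<xi> b)) = (\<Sum>b<p. \<Sum>i<n. cscale (\<Sum>j<n. c (a, i) (b, j) * Rep_ell2 (\<xi> b) j) (ell2_basis i))"
        using that by (intro sum.cong refl) (simp add: x_def butterfly_def sc)
      also have "\<dots> = (\<Sum>i<n. \<Sum>b<p. cscale (\<Sum>j<n. c (a, i) (b, j) * Rep_ell2 (\<xi> b) j) (ell2_basis i))"
        by (rule sum.swap)
      finally show ?thesis by (simp add: sc sum_pair)
    qed
    have "(\<Sum>a<p. (norm (\<Sum>b<p. (x $$ (a, b)) (\<xi> b)))\<^sup>2) \<le>
       (\<Sum>a<p. \<Sum>i<n. (cmod (\<Sum>q\<in>{..<p} \<times> {..<n}. c (a, i) q * (case q of (b, j) \<Rightarrow> Rep_ell2 (\<xi> b) j)))\<^sup>2)"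
      by (intro sum_mono) (simp only: eq lessThan_iff norm_sum_basis_le[OF finite_lessThan])
    also have "\<dots> = (\<Sum>r\<in>{..<p} \<times> {..<n}. (cmod (\<Sum>q\<in>{..<p} \<times> {..<n}. c r q * (case q of (b, j) \<Rightarrow> Rep_ell2 (\<xi> b) j)))\<^sup>2)"
      by (simp only: sum_pair[of _ "{..<p}" "{..<n}"])
    also have "\<dots> \<le> 1\<^sup>2 * (\<Sum>q\<in>{..<p} \<times> {..<n}. (cmod (case q of (b, j) \<Rightarrow> Rep_ell2 (\<xi> b) j))\<^sup>2)"
      using c unfolding arr_bound_sq[OF zero_le_one] by blast
    also have "\<dots> \<le> (\<Sum>b<p. (norm (\<xi> b))\<^sup>2)"
      unfolding sum_pair by (simp add: sum_mono sum_Rep_le)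
    finally show "L2_set (\<lambda>a. norm (\<Sum>b<p. (x $$ (a, b)) (\<xi> b))) {..<p} \<le> L2_set (\<lambda>b. norm (\<xi> b)) {..<p}"
      by (simp add: L2_set_def)
  qed
  note bound = cb_boundD[OF cb p x this]
  have eq: "trace_pairing (t $$ (k, l)) (x $$ (a, b)) = (\<Sum>i<n. \<Sum>j<n. c (a, i) (b, j) * Rep_ell2 ((t $$ (k, l)) (ell2_basis i)) j)"
    if a: "a < p" "k < p" "b < p" "l < p" for a k b l
  proof -
    have T: "trace_class (t $$ (k, l))" using MatsD(4)[OF t, of k l] a by simp
    have "trace_pairing (t $$ (k, l)) (x $$ (a, b)) =
       (\<Sum>i<n. trace_pairing (t $$ (k, l)) (\<lambda>v. \<Sum>j<n. cscale (c (a, i) (b, j)) (butterfly (ell2_basis i) (ell2_basis j) v)))"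
      using a by (simp add: x_def) (intro trace_pairing_sum_right[OF T] bounded_clinear_sum bounded_clinear_cscale bounded_clinear_butterfly)
    also have "\<dots> = (\<Sum>i<n. \<Sum>j<n. trace_pairing (t $$ (k, l)) (\<lambda>v. cscale (c (a, i) (b, j)) (butterfly (ell2_basis i) (ell2_basis j) v)))"
      by (intro sum.cong refl trace_pairing_sum_right[OF T] bounded_clinear_cscale bounded_clinear_butterfly)
    finally show ?thesis
      by (simp add: trace_pairing_scale_right[OF T bounded_clinear_butterfly] trace_pairing_basis_right[OF T])
  qed
  show "arr_bound ({..<p} \<times> {..<p}) ({..<p} \<times> {..<p})
     (\<lambda>(a, k) (b, l). \<Sum>i<n. \<Sum>j<n. c (a, i) (b, j) * Rep_ell2 ((t $$ (k, l)) (ell2_basis i)) j) 1"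
    by (rule arr_bound_cong[THEN iffD1, OF _ bound]) (auto simp: eq)
qed

text \<open>The indices are crossed because |e_l><e_k| represents the functional b |-> <e_k, b e_l>,
  which is entry (k, l) of b.\<close>

definition unit_matrix :: "nat \<Rightarrow> (ell2 \<Rightarrow> ell2) mat" where
  "unit_matrix n = Matrix.mat n n (\<lambda>(k, l). butterfly (ell2_basis l) (ell2_basis k))"

lemma unit_matrix_Mats: "unit_matrix n \<in> Mats n T_ell2"
  by (rule MatsI) (auto simp: unit_matrix_def trace_class_butterfly_basis)

text \<open>The matrix of matrix units represents the compression of \<open>B(\<ell>\<^sub>2)\<close> to the first \<open>n\<close>
  coordinates.\<close>

lemma mnorm_unit_matrix:
  assumes n: "n > 0"
  shows "mnorm T_ell2 (unit_matrix n) \<le> 1"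
proof -
  have "cb_bound n (unit_matrix n) 1"
    unfolding cb_bound_def
  proof (intro allI impI ballI)
    fix r x assume r: "r > 0" and x: "x \<in> Mats r B_ell2" and le: "op_mat_norm x \<le> 1"
    have bl: "bounded_clinear (x $$ (a, b))" if "a < r" "b < r" for a b using MatsD(4)[OF x that] by simp
    have "arr_bound ({..<r} \<times> {..<n}) ({..<r} \<times> {..<n}) (\<lambda>(a, k) (b, l). Rep_ell2 ((x $$ (a, b)) (ell2_basis l)) k) 1"
      unfolding arr_bound_sq[OF zero_le_one]
    proof
      fix \<xi> :: "nat \<times> nat \<Rightarrow> complex"
      define v where "v b = (\<Sum>l<n. cscale (\<xi> (b, l)) (ell2_basis l))" for b
      have "(\<Sum>q\<in>{..<r} \<times> {..<n}. (case q of (b, l) \<Rightarrow> Rep_ell2 ((x $$ (a, b)) (ell2_basis l)) k) * \<xi> q) =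
          Rep_ell2 (\<Sum>b<r. (x $$ (a, b)) (v b)) k" if "a < r" for a k
        using that by (simp add: sum_pair v_def bounded_clinear_simps[OF bl] mult.commute)
      then have "(\<Sum>s\<in>{..<r} \<times> {..<n}. (cmod (\<Sum>q\<in>{..<r} \<times> {..<n}. (case s of (a, k) \<Rightarrow> \<lambda>(b, l). Rep_ell2 ((x $$ (a, b)) (ell2_basis l)) k) q * \<xi> q))\<^sup>2)
         = (\<Sum>a<r. \<Sum>k<n. (cmod (Rep_ell2 (\<Sum>b<r. (x $$ (a, b)) (v b)) k))\<^sup>2)"
        unfolding sum_pair[of _ "{..<r}" "{..<n}"] by (intro sum.cong refl) simp
      also have "\<dots> \<le> (\<Sum>a<r. (norm (\<Sum>b<r. (x $$ (a, b)) (v b)))\<^sup>2)"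
        by (intro sum_mono sum_Rep_le) simp
      also have "\<dots> \<le> (\<Sum>b<r. (norm (v b))\<^sup>2)"
        using Mats_B_unit[OF x le, of v] by (simp add: L2_set_def)
      also have "\<dots> \<le> (\<Sum>b<r. \<Sum>l<n. (cmod (\<xi> (b, l)))\<^sup>2)"
        unfolding v_def by (intro sum_mono norm_sum_basis_le) simp
      also have "\<dots> = 1\<^sup>2 * (\<Sum>q\<in>{..<r} \<times> {..<n}. (cmod (\<xi> q))\<^sup>2)" by (simp add: sum_pair)
      finally show "(\<Sum>s\<in>{..<r} \<times> {..<n}. (cmod (\<Sum>q\<in>{..<r} \<times> {..<n}. (case s of (a, k) \<Rightarrow> \<lambda>(b, l). Rep_ell2 ((x $$ (a, b)) (ell2_basis l)) k) q * \<xi> q))\<^sup>2)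
         \<le> 1\<^sup>2 * (\<Sum>q\<in>{..<r} \<times> {..<n}. (cmod (\<xi> q))\<^sup>2)" .
    qed
    then show "arr_bound ({..<r} \<times> {..<n}) ({..<r} \<times> {..<n}) (\<lambda>(a, k) (b, l). trace_pairing (unit_matrix n $$ (k, l)) (x $$ (a, b))) 1"
      by (rule arr_bound_cong[THEN iffD1, rotated]) (auto simp: unit_matrix_def trace_pairing_basis_left bl)
  qed
  then show ?thesis using mnorm_T_le_iff[OF n unit_matrix_Mats] by simp
qed

definition coefficient_map :: "'a opspace \<Rightarrow> nat \<Rightarrow> 'a mat \<Rightarrow> (ell2 \<Rightarrow> ell2) \<Rightarrow> 'a" where
  "coefficient_map X n b t = lin_comb X n b (\<lambda>(i, j). Rep_ell2 (t (ell2_basis i)) j)"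

context operator_space begin

text \<open>On a matrix t over T(l2) the map acts as the amplification to X of the coefficients of
  t, so \<open>amplification_le\<close> applies.\<close>

lemma coefficient_map_cc:
  assumes n: "n > 0" and b: "b \<in> Mats n X" and le: "mnorm X b \<le> 1"
  shows "complete_contraction T_ell2 X (coefficient_map X n b)"
  unfolding complete_contraction_iff module_hom_iff
proof (intro conjI ballI allI impI)
  show "coefficient_map X n b t \<in> carrier X" for t using b by (simp add: coefficient_map_def)
  show "coefficient_map X n b (s \<oplus>\<^bsub>T_ell2\<^esub> t) = coefficient_map X n b s \<oplus> coefficient_map X n b t" for s t
    unfolding coefficient_map_def by (subst lin_comb_add[OF b, symmetric]) (rule lin_comb_cong[OF b], simp)
  show "coefficient_map X n b (c \<odot>\<^bsub>T_ell2\<^esub> t) = c \<odot> coefficient_map X n b t" for c t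
    unfolding coefficient_map_def by (subst lin_comb_scale[OF b, symmetric]) (rule lin_comb_cong[OF b], simp)
  fix p t assume p: "(p::nat) > 0" and t: "t \<in> Mats p T_ell2" and t1: "mnorm T_ell2 t \<le> 1"
  have "map_mat (coefficient_map X n b) t =
      Matrix.mat p p (\<lambda>(k, l). lin_comb X n b (\<lambda>(i, j). Rep_ell2 ((t $$ (k, l)) (ell2_basis i)) j))"
    by (rule eq_matI) (auto simp: coefficient_map_def MatsD[OF t])
  then show "mnorm X (map_mat (coefficient_map X n b) t) \<le> 1"
    using amplification_le[OF n p b coefficients_matrix_cc[OF p t t1]] le by simp
qed

lemma coefficient_map_unit_matrix:
  assumes b: "b \<in> Mats n X"
  shows "map_mat (coefficient_map X n b) (unit_matrix n) = b"
proof (rule eq_matI)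
  fix k l assume "k < dim_row b" "l < dim_col b"
  then have kl: "k < n" "l < n" by (auto simp: MatsD[OF b])
  have "lin_comb X n b (\<lambda>(i, j). Rep_ell2 (butterfly (ell2_basis l) (ell2_basis k) (ell2_basis i)) j) =
      lin_comb X n b (\<lambda>p. if p = (k, l) then 1 else 0)"
    by (rule lin_comb_cong[OF b]) (auto simp: butterfly_def)
  then show "map_mat (coefficient_map X n b) (unit_matrix n) $$ (k, l) = b $$ (k, l)"
    using kl by (simp add: unit_matrix_def coefficient_map_def lin_comb_delta[OF b])
qed (auto simp: unit_matrix_def MatsD[OF b])

end

section \<open>Copies of operator spaces\<close>

lemma opspace_copy_simps:
  "carrier (opspace_copy e X) = e ` carrier X" "\<zero>\<^bsub>opspace_copy e X\<^esub> = e \<zero>\<^bsub>X\<^esub>"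
  "a \<oplus>\<^bsub>opspace_copy e X\<^esub> b = e (inv_into (carrier X) e a \<oplus>\<^bsub>X\<^esub> inv_into (carrier X) e b)"
  "c \<odot>\<^bsub>opspace_copy e X\<^esub> a = e (c \<odot>\<^bsub>X\<^esub> inv_into (carrier X) e a)"
  "mnorm (opspace_copy e X) x = mnorm X (map_mat (inv_into (carrier X) e) x)"
  by (simp_all add: opspace_copy_def Let_def)

context
  fixes X :: "'a opspace" and e :: "'a \<Rightarrow> 'b"
  assumes X: "operator_space X" and e: "inj_on e (carrier X)"
begin

interpretation X: operator_space X by (rule X)

private abbreviation (input) "Y \<equiv> opspace_copy e X"
private abbreviation (input) "d \<equiv> inv_into (carrier X) e"

lemma copy_inv: "a \<in> carrier X \<Longrightarrow> d (e a) = a" "y \<in> carrier Y \<Longrightarrow> d y \<in> carrier X" "y \<in> carrier Y \<Longrightarrow> e (d y) = y"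
  using e by (auto simp: opspace_copy_simps)

lemma copy_closed: "a \<in> carrier X \<Longrightarrow> e a \<in> carrier Y"
  by (simp add: opspace_copy_simps)

lemma copy_ops:
  "a \<in> carrier Y \<Longrightarrow> b \<in> carrier Y \<Longrightarrow> d (a \<oplus>\<^bsub>Y\<^esub> b) = d a \<oplus>\<^bsub>X\<^esub> d b"
  "a \<in> carrier Y \<Longrightarrow> d (c \<odot>\<^bsub>Y\<^esub> a) = c \<odot>\<^bsub>X\<^esub> d a"
  "d \<zero>\<^bsub>Y\<^esub> = \<zero>\<^bsub>X\<^esub>"
  "a \<in> carrier Y \<Longrightarrow> b \<in> carrier Y \<Longrightarrow> a \<oplus>\<^bsub>Y\<^esub> b \<in> carrier Y"
  "a \<in> carrier Y \<Longrightarrow> c \<odot>\<^bsub>Y\<^esub> a \<in> carrier Y"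
  "\<zero>\<^bsub>Y\<^esub> \<in> carrier Y"
  using copy_inv(1) copy_inv(2) by (auto simp: opspace_copy_simps copy_inv(1))

lemma copy_eqI: "a \<in> carrier Y \<Longrightarrow> b \<in> carrier Y \<Longrightarrow> d a = d b \<Longrightarrow> a = b"
  using copy_inv(3) by metis

lemma vectorspace_copy: "vectorspace class_ring Y"
proof -
  have "abelian_group Y"
  proof (rule abelian_groupI)
    fix y assume y: "y \<in> carrier Y"
    show "\<exists>z\<in>carrier Y. z \<oplus>\<^bsub>Y\<^esub> y = \<zero>\<^bsub>Y\<^esub>"
    proof (intro bexI)
      show "(- 1) \<odot>\<^bsub>Y\<^esub> y \<oplus>\<^bsub>Y\<^esub> y = \<zero>\<^bsub>Y\<^esub>"
      proof (rule copy_eqI)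
        have "(- 1 + 1 :: complex) \<odot>\<^bsub>X\<^esub> d y = (- 1) \<odot>\<^bsub>X\<^esub> d y \<oplus>\<^bsub>X\<^esub> d y"
          using copy_inv(2)[OF y] X.scale_simps(1)[of "d y" "-1" 1] X.scale_simps(5)[of "d y"] by simp
        then show "d ((- 1) \<odot>\<^bsub>Y\<^esub> y \<oplus>\<^bsub>Y\<^esub> y) = d \<zero>\<^bsub>Y\<^esub>"
          using y copy_inv(2)[OF y] by (simp add: copy_ops X.scale_simps)
      qed (use y in \<open>auto simp: copy_ops\<close>)
    qed (use y in \<open>simp add: copy_ops\<close>)
  qed (auto simp: copy_ops copy_inv X.add.m_assoc X.add.m_comm X.add.m_lcomm intro!: copy_eqI)
  moreover have "cring (class_ring :: complex ring)"
    using class_field unfolding field_def domain_def by blast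
  ultimately have "module class_ring Y"
    by (intro moduleI) (auto simp: copy_ops copy_inv X.scale_simps intro!: copy_eqI)
  then show ?thesis by (intro vectorspace.intro class_field)
qed

interpretation Y: vectorspace class_ring Y by (rule vectorspace_copy)

lemma copy_minus: "a \<in> carrier Y \<Longrightarrow> b \<in> carrier Y \<Longrightarrow> d (a \<ominus>\<^bsub>Y\<^esub> b) = d a \<ominus>\<^bsub>X\<^esub> d b"
proof -
  assume ab: "a \<in> carrier Y" "b \<in> carrier Y"
  have "d (\<ominus>\<^bsub>Y\<^esub> b) \<oplus>\<^bsub>X\<^esub> d b = \<zero>\<^bsub>X\<^esub>"
    using copy_ops(1)[of "\<ominus>\<^bsub>Y\<^esub> b" b] ab by (simp add: Y.M.l_neg copy_ops(3))
  then have "\<ominus>\<^bsub>X\<^esub> d b = d (\<ominus>\<^bsub>Y\<^esub> b)"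
    using ab by (intro X.M.minus_equality) (auto intro: copy_inv(2))
  then show ?thesis using ab by (simp add: a_minus_def copy_ops)
qed

lemma copy_finsum:
  "finite A \<Longrightarrow> (\<And>i. i \<in> A \<Longrightarrow> f i \<in> carrier Y) \<Longrightarrow> d (finsum Y f A) = finsum X (\<lambda>i. d (f i)) A"
  by (induction A rule: finite_induct) (auto simp: copy_ops copy_inv(2) Pi_def)

lemma copy_Mats: "x \<in> Mats n Y \<Longrightarrow> map_mat d x \<in> Mats n X"
  by (rule MatsI) (auto simp: MatsD copy_inv(2) dest: MatsD(4))

text \<open>The inverse d of the embedding intertwines all operations, so each axiom at x is the
  axiom of X at \<open>map_mat d x\<close>.\<close>

lemma operator_space_copy: "operator_space Y"
proof
  fix n :: nat and x assume n: "n > 0" and x: "x \<in> Mats n Y"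
  have dx: "map_mat d x \<in> Mats n X" by (rule copy_Mats[OF x])
  show "0 \<le> mnorm Y x" using X.mnorm_nonneg[OF n dx] by (simp add: opspace_copy_simps)
  have "map_mat d x = mat_zero X n n \<longleftrightarrow> x = mat_zero Y n n"
  proof
    assume z: "map_mat d x = mat_zero X n n"
    show "x = mat_zero Y n n"
    proof (rule eq_matI)
      fix i j assume "i < dim_row (mat_zero Y n n)" "j < dim_col (mat_zero Y n n)"
      then have ij: "i < n" "j < n" by (auto simp: mat_zero_def)
      have "map_mat d x $$ (i, j) = \<zero>\<^bsub>X\<^esub>" unfolding z using ij by (simp add: mat_zero_def)
      then show "x $$ (i, j) = mat_zero Y n n $$ (i, j)"
        using ij MatsD[OF x] by (auto simp: mat_zero_def copy_ops intro!: copy_eqI)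
    qed (auto simp: mat_zero_def MatsD[OF x])
  next
    assume "x = mat_zero Y n n"
    then show "map_mat d x = mat_zero X n n" by (intro eq_matI) (auto simp: mat_zero_def copy_ops)
  qed
  then show "mnorm Y x = 0 \<longleftrightarrow> x = mat_zero Y n n"
    using X.mnorm_eq_0[OF n dx] by (simp add: opspace_copy_simps(5))
  show "mnorm Y (mat_scale Y c x) = cmod c * mnorm Y x" for c
  proof -
    have "map_mat d (mat_scale Y c x) = mat_scale X c (map_mat d x)"
      by (rule eq_matI) (auto simp: mat_scale_def MatsD[OF x] copy_ops)
    then show ?thesis using X.mnorm_scale[OF n dx] by (simp add: opspace_copy_simps(5))
  qed
  show "mnorm Y (mat_plus Y x y) \<le> mnorm Y x + mnorm Y y" if y: "y \<in> Mats n Y" for y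
  proof -
    have "map_mat d (mat_plus Y x y) = mat_plus X (map_mat d x) (map_mat d y)"
      by (rule eq_matI) (auto simp: mat_plus_def MatsD[OF x] MatsD[OF y] copy_ops)
    then show ?thesis using X.mnorm_triangle[OF n dx copy_Mats[OF y]] by (simp add: opspace_copy_simps(5))
  qed
  show "mnorm Y (mat_dsum Y x y) = max (mnorm Y x) (mnorm Y y)" if m: "m > 0" and y: "y \<in> Mats m Y" for m y
  proof -
    have "map_mat d (mat_dsum Y x y) = mat_dsum X (map_mat d x) (map_mat d y)"
      by (rule eq_matI) (auto simp: mat_dsum_def mat_zero_def MatsD[OF x] MatsD[OF y] copy_ops(3))
    then show ?thesis using X.mnorm_dsum[OF n m dx copy_Mats[OF y]] by (simp add: opspace_copy_simps(5))
  qed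
  show "mnorm Y (mat_sandwich Y \<alpha> x \<beta>) \<le> cmat_norm \<alpha> * mnorm Y x * cmat_norm \<beta>"
    if \<alpha>: "\<alpha> \<in> carrier_mat n n" and \<beta>: "\<beta> \<in> carrier_mat n n" for \<alpha> \<beta>
  proof -
    have "map_mat d (mat_sandwich Y \<alpha> x \<beta>) = mat_sandwich X \<alpha> (map_mat d x) \<beta>"
    proof (rule eq_matI)
      fix i j assume "i < dim_row (mat_sandwich X \<alpha> (map_mat d x) \<beta>)" "j < dim_col (mat_sandwich X \<alpha> (map_mat d x) \<beta>)"
      then have ij: "i < n" "j < n" using \<alpha> \<beta> by (auto simp: mat_sandwich_def)
      have in1: "(\<alpha> $$ (i, k) * \<beta> $$ (l, j)) \<odot>\<^bsub>Y\<^esub> x $$ (k, l) \<in> carrier Y" if "k < n" "l < n" for k l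
        using MatsD(4)[OF x that] by (intro copy_ops)
      have "d (finsum Y (\<lambda>k. finsum Y (\<lambda>l. (\<alpha> $$ (i, k) * \<beta> $$ (l, j)) \<odot>\<^bsub>Y\<^esub> x $$ (k, l)) {..<n}) {..<n}) =
         finsum X (\<lambda>k. d (finsum Y (\<lambda>l. (\<alpha> $$ (i, k) * \<beta> $$ (l, j)) \<odot>\<^bsub>Y\<^esub> x $$ (k, l)) {..<n})) {..<n}"
        using in1 by (intro copy_finsum Y.M.finsum_closed) auto
      also have "\<dots> = finsum X (\<lambda>k. finsum X (\<lambda>l. (\<alpha> $$ (i, k) * \<beta> $$ (l, j)) \<odot>\<^bsub>X\<^esub> map_mat d x $$ (k, l)) {..<n}) {..<n}"
      proof (rule X.M.finsum_cong'[OF refl])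
        fix k assume "k \<in> {..<n}"
        then have k: "k < n" by simp
        have "d (finsum Y (\<lambda>l. (\<alpha> $$ (i, k) * \<beta> $$ (l, j)) \<odot>\<^bsub>Y\<^esub> x $$ (k, l)) {..<n}) =
            finsum X (\<lambda>l. d ((\<alpha> $$ (i, k) * \<beta> $$ (l, j)) \<odot>\<^bsub>Y\<^esub> x $$ (k, l))) {..<n}"
          using in1 k by (intro copy_finsum) auto
        also have "\<dots> = finsum X (\<lambda>l. (\<alpha> $$ (i, k) * \<beta> $$ (l, j)) \<odot>\<^bsub>X\<^esub> map_mat d x $$ (k, l)) {..<n}"
          using k MatsD[OF x] MatsD[OF dx] by (intro X.M.finsum_cong'[OF refl]) (auto simp: copy_ops intro!: X.scale_closed copy_inv(2))
        finally show "d (finsum Y (\<lambda>l. (\<alpha> $$ (i, k) * \<beta> $$ (l, j)) \<odot>\<^bsub>Y\<^esub> x $$ (k, l)) {..<n}) = \<dots>" .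
      qed (use MatsD[OF dx] in \<open>auto intro!: X.M.finsum_closed X.scale_closed\<close>)
      finally show "map_mat d (mat_sandwich Y \<alpha> x \<beta>) $$ (i, j) = mat_sandwich X \<alpha> (map_mat d x) \<beta> $$ (i, j)"
        using ij \<alpha> \<beta> by (simp add: mat_sandwich_def MatsD[OF x])
    qed (auto simp: mat_sandwich_def)
    then show ?thesis using X.mnorm_sandwich[OF n dx \<alpha> \<beta>] by (simp add: opspace_copy_simps(5))
  qed
next
  fix s :: "nat \<Rightarrow> 'b"
  assume s: "range s \<subseteq> carrier Y" and cauchy: "\<forall>\<epsilon>>0. \<exists>N. \<forall>i\<ge>N. \<forall>j\<ge>N. vnorm Y (s i \<ominus>\<^bsub>Y\<^esub> s j) < \<epsilon>"
  have vn: "vnorm Y y = vnorm X (d y)" for y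
  proof -
    have "map_mat d (Matrix.mat 1 1 (\<lambda>_. y)) = Matrix.mat 1 1 (\<lambda>_. d y)" by (rule eq_matI) auto
    then show ?thesis by (simp only: vnorm_def opspace_copy_simps(5))
  qed
  have sc: "s i \<in> carrier Y" for i using s by auto
  have "range (\<lambda>i. d (s i)) \<subseteq> carrier X" using sc copy_inv(2) by auto
  moreover have "\<forall>\<epsilon>>0. \<exists>N. \<forall>i\<ge>N. \<forall>j\<ge>N. vnorm X (d (s i) \<ominus>\<^bsub>X\<^esub> d (s j)) < \<epsilon>"
    using cauchy unfolding vn copy_minus[OF sc sc] .
  ultimately obtain a where a: "a \<in> carrier X" "(\<lambda>i. vnorm X (d (s i) \<ominus>\<^bsub>X\<^esub> a)) \<longlonglongrightarrow> 0"
    using X.vnorm_complete[of "\<lambda>i. d (s i)"] by blast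
  show "\<exists>a\<in>carrier Y. (\<lambda>i. vnorm Y (s i \<ominus>\<^bsub>Y\<^esub> a)) \<longlonglongrightarrow> 0"
    using a by (intro bexI[of _ "e a"]) (simp_all add: vn copy_minus sc copy_closed copy_inv(1))
qed

lemma complete_contraction_copy:
  assumes u: "complete_contraction X Z u"
  shows "complete_contraction Y Z (\<lambda>y. u (d y))"
  unfolding complete_contraction_iff module_hom_iff
proof (intro conjI ballI allI impI)
  have u': "u \<in> module_hom class_ring X Z" using u by (simp add: complete_contraction_iff)
  show "u (d y) \<in> carrier Z" if "y \<in> carrier Y" for y
    using u' copy_inv(2)[OF that] by (simp add: module_hom_iff)
  show "u (d (a \<oplus>\<^bsub>Y\<^esub> b)) = u (d a) \<oplus>\<^bsub>Z\<^esub> u (d b)" if "a \<in> carrier Y" "b \<in> carrier Y" for a b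
    using u' that by (simp add: module_hom_iff copy_ops copy_inv(2))
  show "u (d (c \<odot>\<^bsub>Y\<^esub> a)) = c \<odot>\<^bsub>Z\<^esub> u (d a)" if "a \<in> carrier Y" for a c
    using u' that by (simp add: module_hom_iff copy_ops copy_inv(2))
  fix n x assume n: "(n::nat) > 0" and x: "x \<in> Mats n Y" "mnorm Y x \<le> 1"
  have "map_mat (\<lambda>y. u (d y)) x = map_mat u (map_mat d x)" by (rule eq_matI) auto
  then show "mnorm Z (map_mat (\<lambda>y. u (d y)) x) \<le> 1"
    using u n copy_Mats[OF x(1)] x(2) by (simp add: complete_contraction_iff opspace_copy_simps(5))
qed

lemma copy_matrix:
  assumes x: "x \<in> Mats n X"
  shows "map_mat e x \<in> Mats n Y" "mnorm Y (map_mat e x) = mnorm X x" "map_mat d (map_mat e x) = x"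
proof -
  show "map_mat e x \<in> Mats n Y" by (rule MatsI) (auto simp: MatsD[OF x] copy_closed)
  show "map_mat d (map_mat e x) = x" by (rule eq_matI) (auto simp: MatsD[OF x] copy_inv(1))
  then show "mnorm Y (map_mat e x) = mnorm X x" by (simp only: opspace_copy_simps(5))
qed

end

section \<open>The category of operator spaces\<close>

lemma OS_simps:
  "Ob OS = {X. operator_space X}"
  "u \<in> Hom OS A B \<longleftrightarrow> u \<in> extensional (carrier A) \<and> complete_contraction A B u"
  "Comp OS A B C g f = compose (carrier A) g f" "Ident OS A = restrict id (carrier A)"
  by (simp_all add: OS_def)

lemma complete_contraction_cong:
  assumes X: "operator_space X" and eq: "\<And>a. a \<in> carrier X \<Longrightarrow> u a = v a" and u: "complete_contraction X Y u"
  shows "complete_contraction X Y v"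
proof -
  interpret operator_space X by (rule X)
  have "map_mat u x = map_mat v x" if "x \<in> Mats n X" for n x
    by (rule eq_matI) (auto simp: MatsD[OF that] eq)
  then show ?thesis
    using u unfolding complete_contraction_iff module_hom_iff by (auto simp: eq[symmetric])
qed

lemma module_homD:
  assumes "u \<in> module_hom (class_ring :: complex ring) X Y"
  shows "a \<in> carrier X \<Longrightarrow> u a \<in> carrier Y"
    "a \<in> carrier X \<Longrightarrow> b \<in> carrier X \<Longrightarrow> u (a \<oplus>\<^bsub>X\<^esub> b) = u a \<oplus>\<^bsub>Y\<^esub> u b"
    "a \<in> carrier X \<Longrightarrow> u (c \<odot>\<^bsub>X\<^esub> a) = c \<odot>\<^bsub>Y\<^esub> u a"
  using assms by (simp_all add: module_hom_iff)

context operator_space begin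

lemma single_Mats: "a \<in> carrier X \<Longrightarrow> Matrix.mat 1 1 (\<lambda>_. a) \<in> Mats 1 X"
  by (rule MatsI) auto

lemma exists_scaling:
  assumes a: "a \<in> carrier X"
  obtains c :: complex where "c \<noteq> 0" "mnorm X (Matrix.mat 1 1 (\<lambda>_. c \<odot> a)) \<le> 1"
proof -
  define r where "r = 1 / (vnorm X a + 1)"
  have v: "0 \<le> vnorm X a" unfolding vnorm_def by (rule mnorm_nonneg[OF _ single_Mats[OF a]]) simp
  have "mat_scale X (of_real r) (Matrix.mat 1 1 (\<lambda>_. a)) = Matrix.mat 1 1 (\<lambda>_. of_real r \<odot> a)"
    by (rule eq_matI) (auto simp: mat_scale_def)
  then have "mnorm X (Matrix.mat 1 1 (\<lambda>_. of_real r \<odot> a)) = \<bar>r\<bar> * vnorm X a"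
    using mnorm_scale[OF _ single_Mats[OF a], of "of_real r"] by (simp add: vnorm_def)
  also have "\<dots> \<le> 1" using v by (simp add: r_def)
  finally have "mnorm X (Matrix.mat 1 1 (\<lambda>_. of_real r \<odot> a)) \<le> 1" .
  moreover have "r \<noteq> 0" using v by (simp add: r_def)
  ultimately show ?thesis by (intro that[of "of_real r"]) simp_all
qed

lemma scale_cancel:
  assumes "a \<in> carrier X" "b \<in> carrier X" "(c::complex) \<noteq> 0" "c \<odot> a = c \<odot> b"
  shows "a = b"
proof -
  have "(inverse c * c) \<odot> a = (inverse c * c) \<odot> b" using assms by (simp only: scale_simps(2))
  then show ?thesis using assms by (simp add: scale_simps)
qed

lemma hom_zero:
  assumes "operator_space Y" and u: "u \<in> module_hom class_ring X Y"
  shows "u \<zero> = \<zero>\<^bsub>Y\<^esub>"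
proof -
  interpret Y: operator_space Y by fact
  show ?thesis
    using module_homD(3)[OF u M.zero_closed, of 0] Y.scale_simps(4)[OF module_homD(1)[OF u M.zero_closed]]
    by (simp add: scale_simps)
qed

end

text \<open>The map s is the coefficient map of b, and t is the copy of
  \<open>unit_matrix n\<close>. The last conclusion, that all values lie in the span of the entries
  of b, serves to keep a map inside the kernel of a morphism.\<close>

lemma unit_ball_lifting:
  fixes e :: "(ell2 \<Rightarrow> ell2) \<Rightarrow> 'u" and A :: "'u opspace"
  assumes e: "inj_on e (carrier T_ell2)" and A: "operator_space A"
    and n: "n > 0" and b: "b \<in> Mats n A" and le: "mnorm A b \<le> 1"
  obtains s t where "s \<in> Hom OS (opspace_copy e T_ell2) A" "t \<in> Mats n (opspace_copy e T_ell2)"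
    "mnorm (opspace_copy e T_ell2) t \<le> 1" "map_mat s t = b"
    "\<And>x. x \<in> carrier (opspace_copy e T_ell2) \<Longrightarrow> \<exists>c. s x = lin_comb A n b c"
proof -
  interpret A: operator_space A by (rule A)
  let ?S = "opspace_copy e T_ell2" and ?d = "inv_into (carrier T_ell2) e"
  note copy = operator_space_T_ell2 e
  define s where "s = restrict (\<lambda>y. coefficient_map A n b (?d y)) (carrier ?S)"
  have "complete_contraction ?S A s"
    by (rule complete_contraction_cong[OF operator_space_copy[OF copy] _
          complete_contraction_copy[OF copy A.coefficient_map_cc[OF n b le]]]) (simp add: s_def)
  then have "s \<in> Hom OS ?S A" by (simp add: OS_simps s_def)
  moreover have t: "map_mat e (unit_matrix n) \<in> Mats n ?S" by (rule copy_matrix(1)[OF copy unit_matrix_Mats])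
  moreover have "mnorm ?S (map_mat e (unit_matrix n)) \<le> 1"
    unfolding copy_matrix(2)[OF copy unit_matrix_Mats] by (rule mnorm_unit_matrix[OF n])
  moreover have "map_mat s (map_mat e (unit_matrix n)) = b"
  proof -
    have "map_mat s (map_mat e (unit_matrix n)) = map_mat (coefficient_map A n b) (map_mat ?d (map_mat e (unit_matrix n)))"
    proof (rule eq_matI)
      fix i j
      assume "i < dim_row (map_mat (coefficient_map A n b) (map_mat ?d (map_mat e (unit_matrix n))))"
        "j < dim_col (map_mat (coefficient_map A n b) (map_mat ?d (map_mat e (unit_matrix n))))"
      then have ij: "i < n" "j < n" by (simp_all add: unit_matrix_def)
      then show "map_mat s (map_mat e (unit_matrix n)) $$ (i, j) =
          map_mat (coefficient_map A n b) (map_mat ?d (map_mat e (unit_matrix n))) $$ (i, j)"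
        using MatsD[OF unit_matrix_Mats[of n]] copy_closed[OF copy MatsD(4)[OF unit_matrix_Mats ij]] by (simp add: s_def)
    qed auto
    then show ?thesis
      unfolding copy_matrix(3)[OF copy unit_matrix_Mats] A.coefficient_map_unit_matrix[OF b] .
  qed
  moreover have "\<exists>c. s x = lin_comb A n b c" if "x \<in> carrier ?S" for x
    using that by (auto simp: s_def coefficient_map_def)
  ultimately show ?thesis by (rule that)
qed

text \<open>The case of 1 x 1 matrices, after scaling a into the unit ball; the span of the single
  entry is contained in the line through a.\<close>

lemma vector_lifting:
  fixes e :: "(ell2 \<Rightarrow> ell2) \<Rightarrow> 'u" and A :: "'u opspace"
  assumes e: "inj_on e (carrier T_ell2)" and A: "operator_space A" and a: "a \<in> carrier A"
  obtains s t c where "s \<in> Hom OS (opspace_copy e T_ell2) A" "t \<in> carrier (opspace_copy e T_ell2)"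
    "c \<noteq> 0" "s t = c \<odot>\<^bsub>A\<^esub> a" "\<And>x. x \<in> carrier (opspace_copy e T_ell2) \<Longrightarrow> \<exists>r. s x = r \<odot>\<^bsub>A\<^esub> a"
proof -
  interpret A: operator_space A by (rule A)
  obtain c :: complex where c: "c \<noteq> 0" "mnorm A (Matrix.mat 1 1 (\<lambda>_. c \<odot>\<^bsub>A\<^esub> a)) \<le> 1"
    by (rule A.exists_scaling[OF a])
  let ?b = "Matrix.mat 1 1 (\<lambda>_. c \<odot>\<^bsub>A\<^esub> a)"
  have b: "?b \<in> Mats 1 A" by (rule A.single_Mats[OF A.scale_closed[OF a]])
  obtain s t where s: "s \<in> Hom OS (opspace_copy e T_ell2) A" and t: "t \<in> Mats 1 (opspace_copy e T_ell2)"
    and st: "map_mat s t = ?b" and rng: "\<And>x. x \<in> carrier (opspace_copy e T_ell2) \<Longrightarrow> \<exists>c. s x = lin_comb A 1 ?b c"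
    by (rule unit_ball_lifting[OF e A _ b c(2)]) auto
  show ?thesis
  proof (rule that[OF s _ c(1)])
    show "t $$ (0, 0) \<in> carrier (opspace_copy e T_ell2)" using MatsD(4)[OF t] by simp
    show "s (t $$ (0, 0)) = c \<odot>\<^bsub>A\<^esub> a" using arg_cong[OF st, of "\<lambda>m. m $$ (0, 0)"] MatsD[OF t] by simp
    fix x assume "x \<in> carrier (opspace_copy e T_ell2)"
    then obtain r where r: "s x = lin_comb A 1 ?b r" using rng by blast
    have "lin_comb A 1 ?b r = lin_comb A 1 ?b (\<lambda>ij. r (0, 0) * (if ij = (0, 0) then 1 else 0))"
      by (rule A.lin_comb_cong[OF b]) simp
    also have "\<dots> = r (0, 0) \<odot>\<^bsub>A\<^esub> (c \<odot>\<^bsub>A\<^esub> a)"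
      unfolding A.lin_comb_scale[OF b] using A.lin_comb_delta[OF b, of 0 0] by simp
    finally show "\<exists>r. s x = r \<odot>\<^bsub>A\<^esub> a" unfolding r using A.scale_simps(2)[OF a] by metis
  qed
qed

text \<open>For k in the kernel there is a map s from the generator with values in the line through
  k, so m takes s and the zero map to the same composite. Cancelling m gives s = 0, although s
  attains a nonzero multiple of k; hence k = 0.\<close>

lemma monomorphism_injective:
  fixes e :: "(ell2 \<Rightarrow> ell2) \<Rightarrow> 'u" and A B :: "'u opspace"
  assumes e: "inj_on e (carrier T_ell2)" and A: "operator_space A" and B: "operator_space B"
    and mono: "monomorphism OS A B m"
  shows "inj_on m (carrier A)"
proof (rule inj_onI)
  interpret A: operator_space A by (rule A)
  interpret B: operator_space B by (rule B)
  let ?S = "opspace_copy e T_ell2"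
  have S: "operator_space ?S" by (rule operator_space_copy[OF operator_space_T_ell2 e])
  interpret S: operator_space ?S by (rule S)
  fix a a' assume a: "a \<in> carrier A" and a': "a' \<in> carrier A" and eq: "m a = m a'"
  have m: "m \<in> module_hom class_ring A B"
    using mono by (simp add: monomorphism_def OS_simps complete_contraction_iff)
  define k where "k = a \<oplus>\<^bsub>A\<^esub> ((- 1) \<odot>\<^bsub>A\<^esub> a')"
  have k: "k \<in> carrier A" using a a' by (simp add: k_def)
  have neg: "y \<oplus>\<^bsub>Y\<^esub> ((- 1) \<odot>\<^bsub>Y\<^esub> y) = \<zero>\<^bsub>Y\<^esub>" if "operator_space Y" "y \<in> carrier Y" for Y :: "'u opspace" and y
  proof -
    interpret Y: operator_space Y by fact
    show ?thesis using Y.scale_simps(1)[OF that(2), of 1 "- 1"] that(2) by (simp add: Y.scale_simps)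
  qed
  have mk: "m k = \<zero>\<^bsub>B\<^esub>"
    using a a' neg[OF B module_homD(1)[OF m a']] by (simp add: k_def module_homD[OF m] eq)
  obtain s t c where s: "s \<in> Hom OS ?S A" and t: "t \<in> carrier ?S" and c: "c \<noteq> 0" and st: "s t = c \<odot>\<^bsub>A\<^esub> k"
    and rng: "\<And>x. x \<in> carrier ?S \<Longrightarrow> \<exists>r. s x = r \<odot>\<^bsub>A\<^esub> k"
    by (rule vector_lifting[OF e A k]) (rule that)
  define h where "h = (\<lambda>x\<in>carrier ?S. \<zero>\<^bsub>A\<^esub>)"
  have h: "h \<in> Hom OS ?S A"
    unfolding OS_simps complete_contraction_iff module_hom_iff
  proof (intro conjI ballI allI impI)
    fix n x assume n: "(n::nat) > 0" and x: "x \<in> Mats n ?S"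
    have "map_mat h x = mat_zero A n n" by (rule eq_matI) (auto simp: h_def mat_zero_def MatsD[OF x])
    moreover have "mat_zero A n n \<in> Mats n A" by (rule MatsI) (auto simp: mat_zero_def)
    ultimately show "mnorm A (map_mat h x) \<le> 1" using A.mnorm_eq_0[OF n, of "mat_zero A n n"] by simp
  qed (auto simp: h_def A.scale_simps)
  have "compose (carrier ?S) m s = compose (carrier ?S) m h"
  proof (rule ext)
    fix x
    show "compose (carrier ?S) m s x = compose (carrier ?S) m h x"
    proof (cases "x \<in> carrier ?S")
      case True
      then obtain r where "s x = r \<odot>\<^bsub>A\<^esub> k" using rng by blast
      then show ?thesis
        using True k by (simp add: compose_def h_def module_homD[OF m] mk B.scale_simps A.hom_zero[OF B m])
    qed (simp add: compose_def)
  qed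
  then have "s = h"
    using mono[unfolded monomorphism_def, THEN conjunct2, rule_format, of ?S s h] S s h
    by (simp add: OS_simps(1,3))
  then have "s t = \<zero>\<^bsub>A\<^esub>" using t by (simp add: h_def)
  then have "c \<odot>\<^bsub>A\<^esub> k = c \<odot>\<^bsub>A\<^esub> \<zero>\<^bsub>A\<^esub>" unfolding st A.scale_simps(6) .
  then have k0: "k = \<zero>\<^bsub>A\<^esub>" using A.scale_cancel[OF k _ c] by simp
  have "a = a \<oplus>\<^bsub>A\<^esub> ((- 1) \<odot>\<^bsub>A\<^esub> a' \<oplus>\<^bsub>A\<^esub> a')"
    using neg[OF A a'] a a' by (simp add: A.add.m_comm)
  also have "\<dots> = k \<oplus>\<^bsub>A\<^esub> a'" using a a' by (simp add: k_def A.add.m_assoc)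
  finally show "a = a'" using a' by (simp add: k0)
qed

theorem corollary4p24:
  fixes e :: "(ell2 \<Rightarrow> ell2) \<Rightarrow> 'u"
  assumes "inj_on e (carrier T_ell2)"
  shows "strong_generator OS (opspace_copy e T_ell2)"
proof -
  let ?S = "opspace_copy e T_ell2"
  have S: "operator_space ?S" by (rule operator_space_copy[OF operator_space_T_ell2 assms])
  have gen: "generating_set OS {?S}"
    unfolding generating_set_def
  proof (intro conjI ballI impI)
    show "{?S} \<subseteq> Ob OS" using S by (simp add: OS_simps)
    fix A B :: "'u opspace" and f g
    assume AB: "A \<in> Ob OS" "B \<in> Ob OS" and f: "f \<in> Hom OS A B" and g: "g \<in> Hom OS A B" and "f \<noteq> g"
    interpret A: operator_space A using AB by (simp add: OS_simps)
    interpret B: operator_space B using AB by (simp add: OS_simps)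
    have fh: "f \<in> module_hom class_ring A B" and gh: "g \<in> module_hom class_ring A B"
      using f g by (simp_all add: OS_simps complete_contraction_iff)
    obtain a where a: "a \<in> carrier A" "f a \<noteq> g a"
      using f g \<open>f \<noteq> g\<close> extensionalityI[of f "carrier A" g] by (auto simp: OS_simps)
    obtain s t c where s: "s \<in> Hom OS ?S A" and t: "t \<in> carrier ?S" and c: "c \<noteq> 0" and st: "s t = c \<odot>\<^bsub>A\<^esub> a"
      by (rule vector_lifting[OF assms A.operator_space_axioms a(1)]) (rule that)
    have "f (s t) \<noteq> g (s t)"
      using B.scale_cancel[OF module_homD(1)[OF fh a(1)] module_homD(1)[OF gh a(1)] c] a
      by (auto simp: st module_homD(3)[OF fh] module_homD(3)[OF gh])
    then have "Comp OS ?S A B f s t \<noteq> Comp OS ?S A B g s t" using t by (simp add: OS_simps(3) compose_def)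
    then have "Comp OS ?S A B f s \<noteq> Comp OS ?S A B g s" by metis
    then show "\<exists>S\<in>{?S}. \<exists>s\<in>Hom OS S A. Comp OS S A B f s \<noteq> Comp OS S A B g s"
      using s by blast
  qed
  \<comment> \<open>Contrapositive of the condition on monomorphisms: one through which every map
    from the generator factors is invertible.\<close>
  have "isomorphism OS A B m"
    if AB: "A \<in> Ob OS" "B \<in> Ob OS" and mono: "monomorphism OS A B m"
      and factor: "\<And>f. f \<in> Hom OS ?S B \<Longrightarrow> \<exists>g\<in>Hom OS ?S A. f = Comp OS ?S A B m g" for A B :: "'u opspace" and m
  proof -
    interpret A: operator_space A using AB by (simp add: OS_simps)
    interpret B: operator_space B using AB by (simp add: OS_simps)
    have inj: "inj_on m (carrier A)"
      by (rule monomorphism_injective[OF assms A.operator_space_axioms B.operator_space_axioms mono])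
    have mH: "m \<in> Hom OS A B" using mono by (simp add: monomorphism_def)
    have m: "m \<in> module_hom class_ring A B" using mH by (simp add: OS_simps complete_contraction_iff)
    \<comment> \<open>A map that attains c b factors through m, so c b is in the range of m.\<close>
    have surj: "b \<in> m ` carrier A" if b: "b \<in> carrier B" for b
    proof -
      obtain s t c where s: "s \<in> Hom OS ?S B" and t: "t \<in> carrier ?S" and c: "c \<noteq> 0" and st: "s t = c \<odot>\<^bsub>B\<^esub> b"
        by (rule vector_lifting[OF assms B.operator_space_axioms b]) (rule that)
      obtain g where g: "g \<in> Hom OS ?S A" "s = compose (carrier ?S) m g" using factor[OF s] by (auto simp: OS_simps)
      have gt: "g t \<in> carrier A"
        using g(1) t by (simp add: OS_simps complete_contraction_iff module_hom_iff)
      have "m (inverse c \<odot>\<^bsub>A\<^esub> g t) = inverse c \<odot>\<^bsub>B\<^esub> (c \<odot>\<^bsub>B\<^esub> b)"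
        using st t gt by (simp add: module_homD(3)[OF m] g(2) compose_def)
      also have "\<dots> = b" using b c by (simp add: B.scale_simps(2)[symmetric] B.scale_simps(5))
      finally show ?thesis using gt by (metis A.scale_closed imageI)
    qed
    define k where "k = restrict (inv_into (carrier A) m) (carrier B)"
    have km: "k (m a) = a" if "a \<in> carrier A" for a
      using that inj module_homD(1)[OF m] by (simp add: k_def)
    have kA: "k b \<in> carrier A" and mk: "m (k b) = b" if "b \<in> carrier B" for b
      using surj[OF that] that by (auto simp: k_def f_inv_into_f inv_into_into)
    have "k \<in> Hom OS B A"
      unfolding OS_simps complete_contraction_iff module_hom_iff
    proof (intro conjI ballI allI impI)
      show "k \<in> extensional (carrier B)" by (simp add: k_def)
      show "k b \<in> carrier A" if "b \<in> carrier B" for b by (rule kA[OF that])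
      show "k (b \<oplus>\<^bsub>B\<^esub> b') = k b \<oplus>\<^bsub>A\<^esub> k b'" if "b \<in> carrier B" "b' \<in> carrier B" for b b'
        using km[of "k b \<oplus>\<^bsub>A\<^esub> k b'"] that by (simp add: module_homD(2)[OF m] kA mk)
      show "k (c \<odot>\<^bsub>B\<^esub> b) = c \<odot>\<^bsub>A\<^esub> k b" if "b \<in> carrier B" for b c
        using km[of "c \<odot>\<^bsub>A\<^esub> k b"] that by (simp add: module_homD(3)[OF m] kA mk)
      \<comment> \<open>A matrix b in the unit ball is the image of a unit-ball matrix t under a map
        s = m g. The inverse k sends b to the image of t under g, and g is completely
        contractive.\<close>
      fix n b assume n: "(n::nat) > 0" and b: "b \<in> Mats n B" "mnorm B b \<le> 1"
      obtain s t where s: "s \<in> Hom OS ?S B" and t: "t \<in> Mats n ?S" "mnorm ?S t \<le> 1" and st: "map_mat s t = b"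
        by (rule unit_ball_lifting[OF assms B.operator_space_axioms n b]) (rule that)
      obtain g where g: "g \<in> Hom OS ?S A" "s = compose (carrier ?S) m g" using factor[OF s] by (auto simp: OS_simps)
      have gc: "g y \<in> carrier A" if "y \<in> carrier ?S" for y
        using g(1) that by (simp add: OS_simps complete_contraction_iff module_hom_iff)
      have "map_mat k b = map_mat g t"
        unfolding st[symmetric] by (rule eq_matI) (auto simp: g(2) compose_def MatsD[OF t(1)] km gc)
      then show "mnorm A (map_mat k b) \<le> 1"
        using g(1) n t by (simp add: OS_simps complete_contraction_iff)
    qed
    moreover have "compose (carrier A) k m = restrict id (carrier A)"
      by (auto simp: compose_def km)
    moreover have "compose (carrier B) m k = restrict id (carrier B)"
      by (auto simp: compose_def mk)
    ultimately show ?thesis using mH by (auto simp: isomorphism_def OS_simps)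
  qed
  then show ?thesis
    unfolding strong_generator_def strong_generating_set_def using gen by blast
qed

end
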